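(* For $(a,b)\in\mathbb{C}^2$ consider the linear forms $\ell_2=y$, $\ell_3=x+y+z$, $\ell_4=x+ay+b(1-a)z$, $\ell_5=(b-1)x+(ab-1)y+b(b-1)(1-a)z$, $\ell_6=(b-1)x+(ab-1)y+(b-1)z$, $\ell_7=x+ay+az$, $\ell_8=x+y$, $\ell_9=y+(1-b)z$, $\ell_{10}=x+bz$, $\ell_{11}=z$. Let $\mathcal{B}_q$ be the arrangement of the ten lines $\ell_2\cdots\ell_{11}=0$ for $(a,b)=(31,17)$, and let $\mathcal{B}_p$ be the arrangement of the ten lines $\ell_2\cdots\ell_{11}=0$ for $(a,b)=\left(\frac{3}{10},\frac{2}{7}\right)$. Then $\mathcal{B}_q$ and $\mathcal{B}_p$ have isomorphic intersection lattices, each with exactly $15$ double points and $10$ triple points and no other multiple points; the exponents of $\mathcal{B}_q$ are $(6,6,6,7)$ and the exponents of $\mathcal{B}_p$ are $(6,6,6,7,7)$. Hence $(\mathcal{B}_q,\mathcal{B}_p)$ is a Ziegler pair of ten lines; the two arrangements have the same minimal degree of a Jacobian relation, and their Milnor algebras have the same Hilbert function.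
   Context: $S=\mathbb{C}[x,y,z]$ with the standard grading; line arrangements are in $\mathbb{P}^2=\mathbb{P}^2_{\mathbb{C}}$. For a line arrangement $\mathcal{A}: f=0$ (with $f$ a product of pairwise non-proportional linear forms), $L(\mathcal{A})$ is the intersection lattice of the corresponding central arrangement of planes in $\mathbb{C}^3$; a double (triple) point is a point lying on exactly two (three) lines. Let $AR(f)=\{(\alpha,\beta,\gamma)\in S^3:\alpha f_x+\beta f_y+\gamma f_z=0\}$, graded by the common degree of $\alpha,\beta,\gamma$; the exponents (degree sequence) of $\mathcal{A}$ are the degrees, in non-decreasing order, of a minimal homogeneous generating set of $AR(f)$, and the minimal degree of a Jacobian relation $\mathrm{mdr}(f)$ is the smallest of them. The Milnor algebra is $M(f)=S/(f_x,f_y,f_z)$. A Ziegler pair is a pair of line arrangements $\mathcal{A}: f=0$, $\mathcal{A}': f'=0$ with isomorphic intersection lattices such that the minimal graded free resolutions of $M(f)$ and $M(f')$ have distinct graded Betti tables. *)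

theory Defs
  imports "HOL-Analysis.Analysis" "HOL-Library.Poly_Mapping"
begin

text \<open>
  The graded polynomial ring \<open>S = \<complex>[x, y, z]\<close> is the monoid algebra of the exponent
  vectors \<open>3 \<Rightarrow>\<^sub>0 nat\<close>; the variables are indexed by \<open>1, 2, 3 :: 3\<close>, as are the
  components of \<open>vector [u, v, w] :: _ ^ 3\<close>.
\<close>

type_synonym S = "(3 \<Rightarrow>\<^sub>0 nat) \<Rightarrow>\<^sub>0 complex"

definition Const :: "complex \<Rightarrow> S" where
  "Const c = Poly_Mapping.single 0 c"

definition Var :: "3 \<Rightarrow> S" where
  "Var i = Poly_Mapping.single (Poly_Mapping.single i 1) 1"

definition mdeg :: "(3 \<Rightarrow>\<^sub>0 nat) \<Rightarrow> nat" where
  "mdeg m = (\<Sum>i\<in>UNIV. Poly_Mapping.lookup m i)"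

definition homogeneous :: "nat \<Rightarrow> S \<Rightarrow> bool" where
  "homogeneous d p \<longleftrightarrow> (\<forall>m\<in>Poly_Mapping.keys p. mdeg m = d)"

definition pd :: "3 \<Rightarrow> S \<Rightarrow> S" where
  "pd i p = (\<Sum>m\<in>Poly_Mapping.keys p.
     Poly_Mapping.single (m - Poly_Mapping.single i 1)
       (of_nat (Poly_Mapping.lookup m i) * Poly_Mapping.lookup p m))"


subsection \<open>Line arrangements\<close>

text \<open>
  A linear form \<open>u x + v y + w z\<close> is given by its coefficient vector \<open>(u, v, w)\<close>, and an
  arrangement by the list of its linear forms.
\<close>

definition linear_form :: "complex^3 \<Rightarrow> S" where
  "linear_form l = (\<Sum>i\<in>UNIV. Const (l $ i) * Var i)"

definition plane :: "complex^3 \<Rightarrow> (complex^3) set" where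
  "plane l = {v. (\<Sum>i\<in>UNIV. l $ i * v $ i) = 0}"

definition line_arrangement :: "(complex^3) list \<Rightarrow> bool" where
  "line_arrangement ls \<longleftrightarrow> 0 \<notin> set ls \<and> sorted_wrt (\<lambda>l l'. \<nexists>c. l' = c *s l) ls"

definition defining_poly :: "(complex^3) list \<Rightarrow> S" where
  "defining_poly ls = prod_list (map linear_form ls)"

definition intersection_lattice :: "(complex^3) list \<Rightarrow> (complex^3) set set" where
  "intersection_lattice ls = {\<Inter>H | H. H \<subseteq> plane ` set ls}"

definition isomorphic_lattices :: "(complex^3) list \<Rightarrow> (complex^3) list \<Rightarrow> bool" where
  "isomorphic_lattices ls ls' \<longleftrightarrow>
     (\<exists>\<phi>. bij_betw \<phi> (intersection_lattice ls) (intersection_lattice ls') \<and>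
        (\<forall>X\<in>intersection_lattice ls. \<forall>Y\<in>intersection_lattice ls. X \<supseteq> Y \<longleftrightarrow> \<phi> X \<supseteq> \<phi> Y))"

definition proj_plane :: "(complex^3) set set" where
  "proj_plane = {vec.span {v} | v. v \<noteq> 0}"

definition multiplicity_at :: "(complex^3) list \<Rightarrow> (complex^3) set \<Rightarrow> nat" where
  "multiplicity_at ls P = card {H \<in> plane ` set ls. P \<subseteq> H}"

definition points_of_mult :: "(complex^3) list \<Rightarrow> nat \<Rightarrow> (complex^3) set set" where
  "points_of_mult ls k = {P \<in> proj_plane. multiplicity_at ls P = k}"


subsection \<open>Jacobian relations\<close>

interpretation S3: module "(*s) :: S \<Rightarrow> S^3 \<Rightarrow> S^3"
  by unfold_locales
    (simp_all add: vec_eq_iff vector_scalar_mult_def algebra_simps)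

definition AR :: "S \<Rightarrow> (S^3) set" where
  "AR f = {r. (\<Sum>i\<in>UNIV. r $ i * pd i f) = 0}"

definition minimal_generators :: "(S^3) set \<Rightarrow> (S^3) set \<Rightarrow> bool" where
  "minimal_generators N G \<longleftrightarrow> S3.span G = N \<and> (\<forall>G'. G' \<subset> G \<longrightarrow> S3.span G' \<noteq> N)"

definition is_degree_sequence :: "(S^3) set \<Rightarrow> nat list \<Rightarrow> bool" where
  "is_degree_sequence N ds \<longleftrightarrow> sorted ds \<and>
     (\<exists>gs. distinct gs \<and> minimal_generators N (set gs) \<and>
        list_all2 (\<lambda>d g. \<forall>i. homogeneous d (g $ i)) ds gs)"

definition exponents :: "(complex^3) list \<Rightarrow> nat list" where
  "exponents ls = (THE ds. is_degree_sequence (AR (defining_poly ls)) ds)"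

definition mdr :: "(complex^3) list \<Rightarrow> nat" where
  "mdr ls = Min (set (exponents ls))"


subsection \<open>The Milnor algebra\<close>

text \<open>
  The Milnor algebra \<open>M(f) = S / J\<close> is represented by its ideal \<open>J\<close>, elements of \<open>M(f)\<close> by
  polynomials modulo \<open>J\<close>.
\<close>

definition jacobian_ideal :: "S \<Rightarrow> S set" where
  "jacobian_ideal f = {\<Sum>i\<in>UNIV. r i * pd i f | r. True}"

definition basis_mod :: "S set \<Rightarrow> nat \<Rightarrow> S set \<Rightarrow> bool" where
  "basis_mod J k B \<longleftrightarrow> finite B \<and> (\<forall>b\<in>B. homogeneous k b) \<and>
     (\<forall>p. homogeneous k p \<longrightarrow>
        (\<exists>!c. (\<forall>b. b \<notin> B \<longrightarrow> c b = 0) \<and> p - (\<Sum>b\<in>B. Const (c b) * b) \<in> J))"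

text \<open>
  \<open>basis_mod J k B\<close> says that the residue classes of the elements of \<open>B\<close> form a basis of
  \<open>(S / J)\<^sub>k\<close> over \<open>\<complex>\<close>, so the following is the dimension of \<open>(S / J)\<^sub>k\<close>.
\<close>

definition hilbert_function :: "S set \<Rightarrow> nat \<Rightarrow> nat" where
  "hilbert_function J k = (THE n. \<exists>B. basis_mod J k B \<and> card B = n)"


subsection \<open>Graded free resolutions\<close>

text \<open>
  A graded free module \<open>\<Oplus>\<^sub>j S(-d\<^sub>j)\<close> is given by the list of the degrees \<open>d\<^sub>j\<close> of its basis.
  Its elements are the \<open>v :: nat \<Rightarrow> S\<close> vanishing from the rank on. A homomorphism of degree \<open>0\<close>
  is a matrix whose entry in row \<open>k\<close>, column \<open>j\<close> is homogeneous of degree \<open>d\<^sub>j - e\<^sub>k\<close>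
  (so zero if this is negative).
\<close>

definition free_elems :: "int list \<Rightarrow> (nat \<Rightarrow> S) set" where
  "free_elems ds = {v. \<forall>j\<ge>length ds. v j = 0}"

definition homogeneous_int :: "int \<Rightarrow> S \<Rightarrow> bool" where
  "homogeneous_int d p \<longleftrightarrow> (\<forall>m\<in>Poly_Mapping.keys p. int (mdeg m) = d)"

definition graded_matrix :: "int list \<Rightarrow> int list \<Rightarrow> (nat \<Rightarrow> nat \<Rightarrow> S) \<Rightarrow> bool" where
  "graded_matrix ds es A \<longleftrightarrow>
     (\<forall>k<length es. \<forall>j<length ds. homogeneous_int (ds ! j - es ! k) (A k j))"

definition apply_matrix ::
    "int list \<Rightarrow> int list \<Rightarrow> (nat \<Rightarrow> nat \<Rightarrow> S) \<Rightarrow> (nat \<Rightarrow> S) \<Rightarrow> nat \<Rightarrow> S" where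
  "apply_matrix ds es A v =
     (\<lambda>k. if k < length es then \<Sum>j<length ds. A k j * v j else 0)"

text \<open>
  \<open>F i\<close> lists the degrees of the \<open>i\<close>-th free module, \<open>A i\<close> is the differential from the
  module \<open>i + 1\<close> to the module \<open>i\<close>, and \<open>e j\<close> represents the image in \<open>S / J\<close> of the
  \<open>j\<close>-th basis element under the augmentation. In order, the conjuncts say that the maps
  are graded, that the augmentation is surjective, that the complex is exact, and that the
  differentials map into \<open>(x, y, z)\<close> times their target.
\<close>

definition minimal_free_resolution ::
    "S set \<Rightarrow> (nat \<Rightarrow> int list) \<Rightarrow> (nat \<Rightarrow> nat \<Rightarrow> nat \<Rightarrow> S) \<Rightarrow> (nat \<Rightarrow> S) \<Rightarrow> bool" where
  "minimal_free_resolution J F A e \<longleftrightarrow>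
     (\<forall>i. graded_matrix (F (Suc i)) (F i) (A i)) \<and>
     (\<forall>j<length (F 0). homogeneous_int (F 0 ! j) (e j)) \<and>
     (\<forall>p. \<exists>v\<in>free_elems (F 0). p - (\<Sum>j<length (F 0). v j * e j) \<in> J) \<and>
     {v \<in> free_elems (F 0). (\<Sum>j<length (F 0). v j * e j) \<in> J} =
       apply_matrix (F 1) (F 0) (A 0) ` free_elems (F 1) \<and>
     (\<forall>i. {v \<in> free_elems (F (Suc i)). apply_matrix (F (Suc i)) (F i) (A i) v = (\<lambda>_. 0)} =
       apply_matrix (F (Suc (Suc i))) (F (Suc i)) (A (Suc i)) ` free_elems (F (Suc (Suc i)))) \<and>
     (\<forall>i. \<forall>k<length (F i). \<forall>j<length (F (Suc i)). Poly_Mapping.lookup (A i k j) 0 = 0)"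

text \<open>The entry at \<open>i\<close>, \<open>j\<close> is the number of summands \<open>S(-j)\<close> of the \<open>i\<close>-th free module.\<close>

definition is_betti_table :: "S set \<Rightarrow> (nat \<Rightarrow> int \<Rightarrow> nat) \<Rightarrow> bool" where
  "is_betti_table J \<beta> \<longleftrightarrow>
     (\<exists>F A e. minimal_free_resolution J F A e \<and> \<beta> = (\<lambda>i j. count_list (F i) j))"

text \<open>
  Minimal graded free resolutions exist and have a unique Betti table. The definition does not
  presuppose this: it asks for existence on both sides and for the tables to differ whatever
  minimal resolutions are taken.
\<close>

definition distinct_betti_tables :: "S set \<Rightarrow> S set \<Rightarrow> bool" where
  "distinct_betti_tables J J' \<longleftrightarrow>
     (\<exists>\<beta>. is_betti_table J \<beta>) \<and> (\<exists>\<beta>'. is_betti_table J' \<beta>') \<and>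
     (\<forall>\<beta> \<beta>'. is_betti_table J \<beta> \<longrightarrow> is_betti_table J' \<beta>' \<longrightarrow> \<beta> \<noteq> \<beta>')"

definition ziegler_pair :: "(complex^3) list \<Rightarrow> (complex^3) list \<Rightarrow> bool" where
  "ziegler_pair ls ls' \<longleftrightarrow>
     line_arrangement ls \<and> line_arrangement ls' \<and> isomorphic_lattices ls ls' \<and>
     distinct_betti_tables (jacobian_ideal (defining_poly ls)) (jacobian_ideal (defining_poly ls'))"


subsection \<open>The ten lines\<close>

text \<open>The coefficient vectors of \<open>\<ell>\<^sub>2, \<dots>, \<ell>\<^sub>1\<^sub>1\<close>.\<close>

definition ten_lines :: "complex \<Rightarrow> complex \<Rightarrow> (complex^3) list" where
  "ten_lines a b =
     [vector [0, 1, 0],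
      vector [1, 1, 1],
      vector [1, a, b * (1 - a)],
      vector [b - 1, a * b - 1, b * (b - 1) * (1 - a)],
      vector [b - 1, a * b - 1, b - 1],
      vector [1, a, a],
      vector [1, 1, 0],
      vector [0, 1, 1 - b],
      vector [1, 0, b],
      vector [0, 0, 1]]"

end

theory Submission
  imports Defs "HOL-Library.Function_Algebras"
begin

text \<open>
  Six of the ten forms have a nonzero coefficient of \<open>x\<close>; the others are \<open>y\<close>, \<open>z\<close> and forms
  \<open>m\<close> in \<open>y, z\<close> and \<open>n\<close> in \<open>x, z\<close>. A relation among the partial derivatives of \<open>f\<close> is, up to a
  multiple of the Euler field, a logarithmic vector field \<open>(n a, y m b, 0)\<close>, and this turns the
  relations into the pairs \<open>(a, b)\<close> such that each of the six forms \<open>l\<close> divides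
  \<open>l\<^sub>x n a + l\<^sub>y y m b\<close>. For both arrangements these pairs are described by a matrix \<open>B\<close> with five
  rows of degrees \<open>6, 6, 6, 7, 7\<close> and three columns of degrees \<open>7, 8, 8\<close>, and by two vectors \<open>v\<close>
  and \<open>w\<close>: if \<open>M\<close> is the antisymmetric matrix of the complementary maximal minors of \<open>B\<close>, the
  entries of \<open>M v\<close> and \<open>M w\<close> are the coordinates of five generators, and the square matrix
  \<open>(B | v | w)\<close> has determinant a constant times the product of the six forms.

  That the five pairs generate and that the columns of \<open>B\<close> are all of their relations is the
  exactness of the Buchsbaum-Rim complex of \<open>B\<close>. It follows from Cramer's rule, which makes the
  complex split up to any maximal minor, together with explicit identities that put \<open>x\<^sup>5\<close>, \<open>y\<^sup>5\<close>
  and \<open>z\<^sup>5\<close> into the ideal of maximal minors, because powers of the variables form a regular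
  sequence (\<open>cominor_kernel\<close>, \<open>left_kernel\<close>). The result is a graded free resolution of the
  module of relations of the same shape for both arrangements
  (\<open>AR_resolution_exists\<close>). In particular the Hilbert functions agree (\<open>same_hilbert_function\<close>).

  The difference is one constant. For \<open>(3/10, 2/7)\<close> the linear relation given by the first
  column of \<open>B\<close> is a relation among the three generators of degree \<open>6\<close>, and the resolution is
  minimal. For \<open>(31, 17)\<close> it says that the second generator of degree \<open>7\<close> is zero, and
  both cancel (\<open>AR_resolution_cancel\<close>). Degree sequences and the second Betti numbers are
  read off from any minimal resolution: the matrices relating two minimal systems of homogeneous
  generators are inverse to each other modulo \<open>(x, y, z)\<close>, and traces count the generators of
  each degree (\<open>minimal_families_same_degrees\<close>).

  The intersection lattice depends only on the concurrent triples of lines, which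
  are the same for both arrangements and are found by computing determinants of integers.
\<close>

section \<open>The polynomial ring\<close>

abbreviation "lookup \<equiv> Poly_Mapping.lookup"
abbreviation "keys \<equiv> Poly_Mapping.keys"
abbreviation "single \<equiv> Poly_Mapping.single"

lemma S_monomials: "(p::S) = (\<Sum>m\<in>keys p. single m (lookup p m))"
  by (rule poly_mapping_eqI) (auto simp: lookup_sum lookup_single when_def in_keys_iff)

lemma S_induct [case_names monomial add]:
  fixes p :: S
  assumes "\<And>m c. P (single m c)" "\<And>p q. P p \<Longrightarrow> P q \<Longrightarrow> P (p + q)"
  shows "P p"
proof -
  have P0: "P 0" using assms(1)[of 0 0] by simp
  have "P (\<Sum>m\<in>A. single m (lookup p m))" if "finite A" for A
    using that by (induction A rule: finite_induct) (auto intro: assms P0)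
  then show ?thesis using S_monomials[of p] finite_keys by metis
qed

definition mpart :: "((3 \<Rightarrow>\<^sub>0 nat) \<Rightarrow> bool) \<Rightarrow> S \<Rightarrow> S" where
  "mpart P p = Abs_poly_mapping (\<lambda>m. if P m then lookup p m else 0)"

lemma lookup_mpart: "lookup (mpart P p) m = (if P m then lookup p m else 0)"
proof -
  have "finite {m. (if P m then lookup p m else 0) \<noteq> 0}"
    by (rule finite_subset[OF _ finite_keys[of p]]) (auto simp: in_keys_iff)
  then show ?thesis unfolding mpart_def by simp
qed

lemma mdeg_simps [simp]:
  "mdeg 0 = 0" "mdeg (m + n) = mdeg m + mdeg n" "mdeg (single i k) = k"
  by (simp_all add: mdeg_def lookup_add sum.distrib lookup_single when_def)

lemma mdeg_eq_0_iff [simp]: "mdeg m = 0 \<longleftrightarrow> m = 0"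
  by (auto simp: mdeg_def intro: poly_mapping_eqI)

lemma homogeneous_iff: "homogeneous d p \<longleftrightarrow> (\<forall>m. lookup p m \<noteq> 0 \<longrightarrow> mdeg m = d)"
  by (auto simp: homogeneous_def in_keys_iff)

lemma homogeneous_0 [simp]: "homogeneous d 0"
  and homogeneous_single: "mdeg m = d \<Longrightarrow> homogeneous d (single m c)"
  and homogeneous_add: "homogeneous d p \<Longrightarrow> homogeneous d q \<Longrightarrow> homogeneous d (p + q)"
  and homogeneous_diff: "homogeneous d p \<Longrightarrow> homogeneous d q \<Longrightarrow> homogeneous d (p - q)"
  and homogeneous_uminus: "homogeneous d p \<Longrightarrow> homogeneous d (- p)"
      apply (auto simp: homogeneous_iff lookup_single when_def lookup_add lookup_minus split: if_splits)
  by (metis add.right_neutral) (metis diff_0_right)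

lemma homogeneous_Const [simp]: "homogeneous 0 (Const c)"
  and homogeneous_Var [simp]: "homogeneous 1 (Var i)"
  by (simp_all add: Const_def Var_def homogeneous_single)

lemma homogeneous_mult:
  assumes "homogeneous d p" "homogeneous e q" "d + e = n"
  shows "homogeneous n (p * q)"
  unfolding homogeneous_def
proof
  fix m assume "m \<in> keys (p * q)"
  then obtain a b where "m = a + b" "a \<in> keys p" "b \<in> keys q" using keys_mult by blast
  then show "mdeg m = n" using assms by (simp add: homogeneous_def)
qed

lemma homogeneous_sum: "(\<And>i. i \<in> A \<Longrightarrow> homogeneous d (g i)) \<Longrightarrow> homogeneous d (sum g A)"
  by (induction A rule: infinite_finite_induct) (auto intro: homogeneous_add)

lemma homogeneous_power: "homogeneous d p \<Longrightarrow> homogeneous (k * d) (p ^ k)"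
proof (induction k)
  case 0
  show ?case using homogeneous_Const[of 1] by (simp add: Const_def)
next
  case (Suc k)
  then show ?case by (auto intro: homogeneous_mult)
qed

lemma homogeneous_0_imp_Const: "homogeneous 0 p \<Longrightarrow> p = Const (lookup p 0)"
  by (rule poly_mapping_eqI) (auto simp: homogeneous_iff Const_def lookup_single when_def)

lemma Const_simps [simp]:
  "Const 0 = 0" "Const 1 = 1" "Const (a + b) = Const a + Const b" "Const (a - b) = Const a - Const b"
  "Const (- a) = - Const a" "Const (a * b) = Const a * Const b"
  by (simp_all add: Const_def single_add single_diff single_uminus mult_single)

lemma Const_numeral [simp]: "Const (numeral k) = numeral k"
  and Const_of_int [simp]: "Const (of_int n) = of_int n"
  by (simp_all add: Const_def)

lemma Const_eq_0_iff [simp]: "Const c = 0 \<longleftrightarrow> c = 0"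
  by (metis Const_def lookup_single_eq lookup_zero single_zero)

lemma lookup_Const: "lookup (Const c) m = (if m = 0 then c else 0)"
  by (simp add: Const_def lookup_single when_def)

definition hc :: "nat \<Rightarrow> S \<Rightarrow> S" where
  "hc d = mpart (\<lambda>m. mdeg m = d)"

lemma lookup_hc: "lookup (hc d p) m = (if mdeg m = d then lookup p m else 0)"
  by (simp add: hc_def lookup_mpart)

lemma homogeneous_hc [simp]: "homogeneous d (hc d p)"
  by (simp add: homogeneous_iff lookup_hc)

lemma hc_0 [simp]: "hc d 0 = 0"
  and hc_add: "hc d (p + q) = hc d p + hc d q"
  and hc_diff: "hc d (p - q) = hc d p - hc d q"
  by (auto intro!: poly_mapping_eqI simp: lookup_hc lookup_add lookup_minus)

lemma hc_sum: "hc d (sum g A) = (\<Sum>i\<in>A. hc d (g i))"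
  by (induction A rule: infinite_finite_induct) (auto simp: hc_add)

lemma hc_homogeneous: "homogeneous e p \<Longrightarrow> hc d p = (if d = e then p else 0)"
  by (rule poly_mapping_eqI) (auto simp: lookup_hc homogeneous_iff)

lemma hc_mult:
  assumes "homogeneous e q"
  shows "hc d (p * q) = (if e \<le> d then hc (d - e) p * q else 0)"
proof (induction p rule: S_induct)
  case (monomial m c)
  have "homogeneous (mdeg m + e) (single m c * q)"
    using assms homogeneous_single by (auto intro: homogeneous_mult)
  then show ?case
    by (auto simp: hc_homogeneous[OF homogeneous_single[OF refl]] hc_homogeneous)
next
  case (add p q)
  then show ?case by (auto simp: hc_add algebra_simps)
qed

lemma hc_mult_left:
  "homogeneous e q \<Longrightarrow> hc d (q * p) = (if e \<le> d then q * hc (d - e) p else 0)"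
  using hc_mult[of e q d p] by (simp add: mult.commute)

lemma homogeneous_cofactor:
  assumes "homogeneous e p" "homogeneous d (p * q)" "p \<noteq> 0" "d = e + n"
  shows "homogeneous n q"
proof -
  have "p * q = hc d (p * q)" using assms(2) by (simp add: hc_homogeneous)
  also have "\<dots> = p * hc n q" using assms by (simp add: hc_mult_left)
  finally have "q = hc n q" using assms(3) by simp
  then show ?thesis using homogeneous_hc by metis
qed

lemma lookup_0_mult: "lookup (p * q) 0 = lookup p 0 * lookup (q :: S) 0"
proof (induction p rule: S_induct)
  case (monomial m c)
  show ?case
  proof (induction q rule: S_induct)
    case (monomial n d)
    have "m + n = 0 \<longleftrightarrow> m = 0 \<and> n = 0" by (metis mdeg_simps(2) mdeg_eq_0_iff add_is_0)
    then show ?case by (auto simp: mult_single lookup_single when_def)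
  qed (simp add: lookup_add algebra_simps)
qed (simp add: lookup_add algebra_simps)

lemma lookup_0_homogeneous: "homogeneous d p \<Longrightarrow> d \<noteq> 0 \<Longrightarrow> lookup p 0 = 0"
  by (auto simp: homogeneous_iff)

subsection \<open>Partial derivatives\<close>

lemma lookup_pd: "lookup (pd i p) n = of_nat (lookup n i + 1) * lookup p (n + single i 1)"
proof -
  let ?g = "\<lambda>m. of_nat (lookup m i) * lookup p m"
  have *: "(m - single i 1 = n \<and> lookup m i \<noteq> 0) \<longleftrightarrow> m = n + single i 1" for m :: "3 \<Rightarrow>\<^sub>0 nat"
  proof
    assume a: "m - single i 1 = n \<and> lookup m i \<noteq> 0"
    then have "lookup m k = lookup (m - single i 1 + single i 1) k" for k
      by (auto simp: lookup_add lookup_minus lookup_single when_def)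
    then show "m = n + single i 1" using a poly_mapping_eqI by metis
  qed (auto simp: lookup_add lookup_single)
  have "lookup (pd i p) n = (\<Sum>m\<in>keys p. if m - single i 1 = n then ?g m else 0)"
    by (simp add: pd_def lookup_sum lookup_single when_def)
  also have "\<dots> = (\<Sum>m\<in>keys p. if m = n + single i 1 then ?g m else 0)"
    by (intro sum.cong refl) (metis * mult_eq_0_iff of_nat_0)
  also have "\<dots> = ?g (n + single i 1)"
    by (simp add: in_keys_iff)
  finally show ?thesis by (simp add: lookup_add)
qed

lemma pd_add: "pd i (p + q) = pd i p + pd i q"
  by (rule poly_mapping_eqI) (simp add: lookup_pd lookup_add algebra_simps)

lemma pd_single: "pd i (single m c) = single (m - single i 1) (of_nat (lookup m i) * c)"
  by (cases "c = 0") (simp_all add: pd_def)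

lemma pd_mult: "pd i (p * q) = pd i p * q + p * pd i q"
proof (induction p rule: S_induct)
  case (monomial m a)
  show ?case
  proof (induction q rule: S_induct)
    case (monomial n b)
    let ?e = "single i (1::nat)"
    have 1: "m - ?e + n = m + n - ?e" if "lookup m i \<noteq> 0"
      using that by (auto intro!: poly_mapping_eqI simp: lookup_add lookup_minus lookup_single when_def)
    have 2: "m + (n - ?e) = m + n - ?e" if "lookup n i \<noteq> 0"
      using that by (auto intro!: poly_mapping_eqI simp: lookup_add lookup_minus lookup_single when_def)
    have "pd i (single m a) * single n b = single (m + n - ?e) (of_nat (lookup m i) * a * b)"
      using 1 by (cases "lookup m i = 0") (simp_all add: pd_single mult_single)
    moreover have "single m a * pd i (single n b) = single (m + n - ?e) (of_nat (lookup n i) * a * b)"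
      using 2 by (cases "lookup n i = 0") (simp_all add: pd_single mult_single algebra_simps)
    ultimately show ?case
      by (simp add: mult_single pd_single lookup_add algebra_simps flip: single_add)
  qed (simp add: pd_add algebra_simps)
qed (simp add: pd_add algebra_simps)

lemma pd_Const [simp]: "pd i (Const c) = 0"
  by (simp add: Const_def pd_single)

lemma pd_Var: "pd i (Var j) = (if i = j then 1 else 0)"
  by (auto simp: Var_def pd_single lookup_single)

lemma homogeneous_pd: "homogeneous (Suc d) p \<Longrightarrow> homogeneous d (pd i p)"
  by (fastforce simp: homogeneous_iff lookup_pd)

subsection \<open>Powers of variables form a regular sequence\<close>

lemma Var_power: "Var i ^ k = single (single i k) 1"
  by (induction k) (simp_all add: Var_def mult_single flip: single_add)

lemma lookup_Var_power_mult:
  "lookup (Var i ^ k * p) (m + single i k) = lookup p m"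
proof (induction p rule: S_induct)
  case (monomial n c)
  show ?case by (simp add: Var_power mult_single lookup_single when_def add.commute)
qed (simp add: lookup_add algebra_simps)

lemma lookup_Var_power_mult_0:
  "lookup m i < k \<Longrightarrow> lookup (Var i ^ k * p) m = 0"
proof (induction p rule: S_induct)
  case (monomial n c)
  then have "single i k + n \<noteq> m" by (auto simp: lookup_add)
  then show ?case by (simp add: Var_power mult_single lookup_single when_def)
qed (simp add: lookup_add algebra_simps)

lemma Var_power_dvd_iff: "Var i ^ k dvd p \<longleftrightarrow> (\<forall>m. lookup p m \<noteq> 0 \<longrightarrow> k \<le> lookup m i)"
proof
  assume "Var i ^ k dvd p"
  then show "\<forall>m. lookup p m \<noteq> 0 \<longrightarrow> k \<le> lookup m i"
    by (metis dvdE lookup_Var_power_mult_0 not_le)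
next
  assume *: "\<forall>m. lookup p m \<noteq> 0 \<longrightarrow> k \<le> lookup m i"
  have "Var i ^ k dvd single m (lookup p m)" if "m \<in> keys p" for m
  proof -
    have "m = single i k + (m - single i k)"
      using * that
      by (auto intro!: poly_mapping_eqI simp: in_keys_iff lookup_add lookup_minus lookup_single when_def)
    then have "single m (lookup p m) = Var i ^ k * single (m - single i k) (lookup p m)"
      by (simp add: Var_power mult_single)
    then show ?thesis by simp
  qed
  then have "Var i ^ k dvd (\<Sum>m\<in>keys p. single m (lookup p m))" by (rule dvd_sum)
  then show "Var i ^ k dvd p" by (simp flip: S_monomials)
qed

text \<open>
  Divisibility by a power of a variable can be read off from the exponents of the monomials, so the
  regularity of the sequence of powers needs no unique factorization.
\<close>

lemma Var_powers_regular2: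
  assumes "Var i ^ k * a = Var j ^ k * b" "i \<noteq> j"
  shows "Var j ^ k dvd a"
  unfolding Var_power_dvd_iff
proof (intro allI impI)
  fix m assume "lookup a m \<noteq> 0"
  then have "lookup (Var j ^ k * b) (m + single i k) \<noteq> 0"
    by (simp add: lookup_Var_power_mult flip: assms(1))
  then have "k \<le> lookup (m + single i k) j"
    using lookup_Var_power_mult_0 by (metis not_le)
  then show "k \<le> lookup m j" using assms(2) by (simp add: lookup_add lookup_single)
qed

lemma Var_powers_regular3:
  assumes "Var l ^ k * s = Var i ^ k * a + Var j ^ k * b" "i \<noteq> l" "j \<noteq> l"
  shows "\<exists>a' b'. s = Var i ^ k * a' + Var j ^ k * b'"
proof -
  have *: "k \<le> lookup m i \<or> k \<le> lookup m j" if "lookup s m \<noteq> 0" for m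
  proof -
    have "lookup (Var i ^ k * a) (m + single l k) \<noteq> 0 \<or> lookup (Var j ^ k * b) (m + single l k) \<noteq> 0"
      using that lookup_Var_power_mult[of l k s m] assms(1) by (auto simp: lookup_add)
    then have "k \<le> lookup (m + single l k) i \<or> k \<le> lookup (m + single l k) j"
      using lookup_Var_power_mult_0 by (metis not_le)
    then show ?thesis using assms(2,3) by (simp add: lookup_add lookup_single)
  qed
  let ?s = "mpart (\<lambda>m. k \<le> lookup m i) s"
  have "Var i ^ k dvd ?s" by (auto simp: Var_power_dvd_iff lookup_mpart)
  moreover have "Var j ^ k dvd s - ?s"
    using * by (auto simp: Var_power_dvd_iff lookup_mpart lookup_minus split: if_splits)
  moreover have "s = ?s + (s - ?s)" by simp
  ultimately show ?thesis by (metis dvdE)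
qed

section \<open>Derivations and products of linear forms\<close>

definition der :: "S^3 \<Rightarrow> S \<Rightarrow> S" where
  "der u p = (\<Sum>i\<in>UNIV. u $ i * pd i p)"

lemma AR_iff_der: "u \<in> AR f \<longleftrightarrow> der u f = 0"
  by (simp add: AR_def der_def)

lemma der_add: "der u (p + q) = der u p + der u q"
  and der_mult: "der u (p * q) = der u p * q + p * der u q"
  and der_Const [simp]: "der u (Const c) = 0"
  and der_Var [simp]: "der u (Var i) = u $ i"
  by (simp_all add: der_def pd_add pd_mult pd_Var algebra_simps sum.distrib sum_distrib_left
      mult_delta_right)

lemma der_linear_form: "der u (linear_form l) = (\<Sum>i\<in>UNIV. Const (l $ i) * u $ i)"
  by (simp add: linear_form_def sum_3 der_add der_mult)

lemma der_left_add: "der (u + w) p = der u p + der w p"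
  and der_left_diff: "der (u - w) p = der u p - der w p"
  and der_left_scale: "der (c *s u) p = c * der u p"
  by (simp_all add: der_def sum.distrib sum_subtractf algebra_simps sum_distrib_left)

definition euler :: "S^3" where
  "euler = (\<chi> i. Var i)"

lemma der_euler_linear_form: "der euler (linear_form l) = linear_form l"
  unfolding der_linear_form by (simp add: linear_form_def euler_def)

lemma der_euler_defining_poly:
  "der euler (defining_poly ls) = of_nat (length ls) * defining_poly ls"
proof (induction ls)
  case Nil
  show ?case using der_Const[of euler 1] by (simp add: defining_poly_def)
next
  case (Cons l ls)
  then show ?case by (simp add: defining_poly_def der_mult der_euler_linear_form algebra_simps)
qed

lemma linear_form_scale: "linear_form (c *s l) = Const c * linear_form l"
  by (simp add: linear_form_def sum_distrib_left algebra_simps)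

lemma homogeneous_linear_form: "homogeneous 1 (linear_form l)"
  unfolding linear_form_def
  by (auto intro!: homogeneous_sum homogeneous_mult[OF homogeneous_Const homogeneous_Var])

lemma single_Suc_0_inject: "single j (Suc 0) = single i (Suc 0) \<longleftrightarrow> i = j"
  by (metis lookup_single_eq lookup_single_not_eq n_not_Suc_n)

lemma lookup_linear_form: "lookup (linear_form l) (single i 1) = l $ i"
proof -
  have "lookup (Const c * Var j) (single i 1) = (if j = i then c else 0)" for c :: complex and j
    by (auto simp: Const_def Var_def mult_single lookup_single when_def single_Suc_0_inject)
  then show ?thesis by (simp add: linear_form_def lookup_sum)
qed

lemma linear_form_eq_0_iff [simp]: "linear_form l = 0 \<longleftrightarrow> l = 0"
proof
  assume "linear_form l = 0"
  then have "l $ i = 0" for i using lookup_linear_form[of l i] by simp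
  then show "l = 0" by (simp add: vec_eq_iff)
qed (simp add: linear_form_def)

lemma linear_form_dvdD:
  assumes "linear_form l dvd linear_form l'"
  shows "\<exists>c. l' = c *s l"
proof -
  obtain h where h: "linear_form l' = linear_form l * h" using assms by (elim dvdE)
  have "linear_form l' = hc 1 (linear_form l * h)"
    using h homogeneous_linear_form[of l'] by (simp add: hc_homogeneous)
  also have "\<dots> = linear_form l * hc 0 h"
    using homogeneous_linear_form[of l] by (simp add: hc_mult_left)
  finally have "linear_form l' = linear_form (lookup (hc 0 h) 0 *s l)"
    using homogeneous_0_imp_Const[OF homogeneous_hc] linear_form_scale by (metis mult.commute)
  then have "l' = lookup (hc 0 h) 0 *s l"
    by (metis lookup_linear_form vec_eq_iff)
  then show ?thesis by blast
qed

subsection \<open>Linear forms are prime\<close>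

definition subst :: "(3 \<Rightarrow> S) \<Rightarrow> S \<Rightarrow> S" where
  "subst v p = (\<Sum>m\<in>keys p. Const (lookup p m) * (\<Prod>i\<in>UNIV. v i ^ lookup m i))"

lemma subst_superset:
  "finite A \<Longrightarrow> keys p \<subseteq> A \<Longrightarrow>
    subst v p = (\<Sum>m\<in>A. Const (lookup p m) * (\<Prod>i\<in>UNIV. v i ^ lookup m i))"
  unfolding subst_def by (rule sum.mono_neutral_left) (auto simp: in_keys_iff)

lemma subst_add: "subst v (p + q) = subst v p + subst v q"
proof -
  let ?A = "keys p \<union> keys q"
  have "subst v (p + q) = (\<Sum>m\<in>?A. Const (lookup (p + q) m) * (\<Prod>i\<in>UNIV. v i ^ lookup m i))"
    by (rule subst_superset) (use keys_add[of p q] in auto)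
  also have "\<dots> = subst v p + subst v q"
    by (simp add: subst_superset[of ?A p] subst_superset[of ?A q] lookup_add algebra_simps sum.distrib)
  finally show ?thesis .
qed

lemma subst_single: "subst v (single m c) = Const c * (\<Prod>i\<in>UNIV. v i ^ lookup m i)"
  by (cases "c = 0") (simp_all add: subst_def)

lemma subst_mult: "subst v (p * q) = subst v p * subst v q"
proof (induction p rule: S_induct)
  case (monomial m c)
  show ?case
    by (induction q rule: S_induct)
      (simp_all add: mult_single subst_single lookup_add power_add prod.distrib subst_add algebra_simps)
qed (simp add: subst_add algebra_simps)

lemma subst_Const [simp]: "subst v (Const c) = Const c"
  using subst_single[of v 0 c] by (simp flip: Const_def)

lemma subst_Var [simp]: "subst v (Var j) = v j"
proof -
  have "(\<Prod>i\<in>UNIV. v i ^ lookup (single j (Suc 0)) i) = (\<Prod>i\<in>UNIV. if i = j then v i else 1)"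
    by (intro prod.cong) (auto simp: lookup_single when_def)
  then show ?thesis by (simp add: Var_def subst_single)
qed

lemma prod_3: "prod g (UNIV :: 3 set) = g 1 * g 2 * g 3"
  unfolding UNIV_3 by (simp add: ac_simps)

lemma single_eq_prod: "single m c = Const c * (\<Prod>i\<in>UNIV. Var i ^ lookup m i)"
proof -
  have "m = single 1 (lookup m 1) + single 2 (lookup m 2) + single 3 (lookup m 3)"
  proof (rule poly_mapping_eqI)
    fix i :: 3
    show "lookup m i = lookup (single 1 (lookup m 1) + single 2 (lookup m 2) + single 3 (lookup m 3)) i"
      using exhaust_3[of i] by (auto simp: lookup_add lookup_single when_def)
  qed
  then have "single m c = single (single 1 (lookup m 1) + single 2 (lookup m 2) + single 3 (lookup m 3)) c"
    by (rule arg_cong[where f = "\<lambda>m. single m c"])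
  also have "\<dots> = single 0 c * single (single 1 (lookup m 1) + single 2 (lookup m 2)
      + single 3 (lookup m 3)) 1"
    by (simp add: mult_single)
  also have "\<dots> = Const c * (\<Prod>i\<in>UNIV. Var i ^ lookup m i)"
    unfolding prod_3 Var_power Const_def mult_single by simp
  finally show ?thesis .
qed

lemma dvd_diff_mult:
  fixes l :: "'a::comm_ring_1"
  assumes "l dvd a - b" "l dvd c - d"
  shows "l dvd a * c - b * d"
proof -
  have "a * c - b * d = (a - b) * c + b * (c - d)" by (simp add: algebra_simps)
  then show ?thesis using assms by (simp add: dvd_add)
qed

text \<open>
  The substitution is the identity modulo the ideal generated by the differences \<open>Var i - v i\<close>.
\<close>

lemma dvd_diff_subst:
  assumes "\<And>i. l dvd Var i - v i"
  shows "l dvd p - subst v p"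
proof (induction p rule: S_induct)
  case (monomial m c)
  have pow: "l dvd Var i ^ k - v i ^ k" for i k
    by (induction k) (auto intro: dvd_diff_mult assms)
  have "l dvd (\<Prod>i\<in>A. Var i ^ lookup m i) - (\<Prod>i\<in>A. v i ^ lookup m i)" for A
    by (induction A rule: infinite_finite_induct) (auto intro: dvd_diff_mult pow)
  then have "l dvd Const c * (\<Prod>i\<in>UNIV. Var i ^ lookup m i) - Const c * (\<Prod>i\<in>UNIV. v i ^ lookup m i)"
    by (intro dvd_diff_mult) auto
  then show ?case by (metis single_eq_prod subst_single)
next
  case (add p q)
  have "p + q - subst v (p + q) = (p - subst v p) + (q - subst v q)" by (simp add: subst_add)
  then show ?case using dvd_add[OF add] by (simp only:)
qed

text \<open>
  Solving the equation of the line for one of the variables gives an endomorphism of the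
  ring that annihilates the linear form and is the identity modulo it. As the ring has no
  zero divisors, the linear form generates a prime ideal.
\<close>

lemma linear_form_prime:
  assumes "l \<noteq> 0" "linear_form l dvd p * q"
  shows "linear_form l dvd p \<or> linear_form l dvd q"
proof -
  obtain j where j: "l $ j \<noteq> 0" using assms(1) by (auto simp: vec_eq_iff)
  define v where "v = (\<lambda>i. if i = j then Var j - Const (1 / l $ j) * linear_form l else Var i)"
  have mod: "linear_form l dvd p - subst v p" for p
    by (rule dvd_diff_subst) (simp add: v_def)
  have "subst v (linear_form l) = (\<Sum>i\<in>UNIV. Const (l $ i) * v i)"
    by (simp add: linear_form_def sum_3 subst_add subst_mult)
  also have "\<dots> = (\<Sum>i\<in>UNIV. Const (l $ i) * Var i
      - (if i = j then Const (l $ j) * (Const (1 / l $ j) * linear_form l) else 0))"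
    by (intro sum.cong) (auto simp: v_def algebra_simps)
  also have "\<dots> = linear_form l - Const (l $ j) * (Const (1 / l $ j) * linear_form l)"
    by (simp add: sum_subtractf flip: linear_form_def)
  also have "Const (l $ j) * (Const (1 / l $ j) * linear_form l) = linear_form l"
  proof -
    have "Const (l $ j) * Const (1 / l $ j) = 1" using j by (simp flip: Const_simps(6))
    then show ?thesis by (simp only: mult.assoc[symmetric] mult_1)
  qed
  finally have "subst v (linear_form l) = 0" by simp
  then have "subst v p * subst v q = 0"
    using assms(2) by (metis dvd_def mult_zero_left subst_mult)
  then show ?thesis using mod[of p] mod[of q] by auto
qed

subsection \<open>Logarithmic derivations\<close>

lemma defining_poly_Nil [simp]: "defining_poly [] = 1"
  and defining_poly_Cons [simp]: "defining_poly (l # ls) = linear_form l * defining_poly ls"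
  and defining_poly_append [simp]: "defining_poly (ls @ ks) = defining_poly ls * defining_poly ks"
  by (simp_all add: defining_poly_def)

lemma defining_poly_nonzero: "0 \<notin> set ls \<Longrightarrow> defining_poly ls \<noteq> 0"
  by (induction ls) auto

lemma homogeneous_defining_poly: "homogeneous (length ls) (defining_poly ls)"
proof (induction ls)
  case Nil
  show ?case using homogeneous_Const[of 1] by simp
next
  case (Cons l ls)
  then show ?case using homogeneous_linear_form[of l] by (auto intro: homogeneous_mult)
qed

lemma line_arrangement_Cons:
  "line_arrangement (l # ls) \<longleftrightarrow>
    l \<noteq> 0 \<and> (\<forall>l'\<in>set ls. \<nexists>c. l' = c *s l) \<and> line_arrangement ls"
  by (auto simp: line_arrangement_def)

lemma line_arrangement_append:
  "line_arrangement (ls @ ks) \<longleftrightarrow> line_arrangement ls \<and> line_arrangement ks \<and>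
    (\<forall>l\<in>set ls. \<forall>l'\<in>set ks. \<nexists>c. l' = c *s l)"
  by (auto simp: line_arrangement_def sorted_wrt_append)

lemma nonproportional_sym:
  fixes l l' :: "complex^3"
  assumes "\<nexists>c. l' = c *s l" "l \<noteq> 0"
  shows "\<nexists>c. l = c *s l'"
proof
  assume "\<exists>c. l = c *s l'"
  then obtain c where c: "l = c *s l'" by blast
  then have "c \<noteq> 0" using assms(2) by auto
  then have "l' = (1 / c) *s l" using c by (simp add: vec_eq_iff)
  then show False using assms(1) by blast
qed

lemma linear_form_not_dvd_defining_poly:
  assumes "l \<noteq> 0" "\<And>l'. l' \<in> set ls \<Longrightarrow> \<nexists>c. l' = c *s l"
  shows "\<not> linear_form l dvd defining_poly ls"
  using assms(2)
proof (induction ls)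
  case Nil
  show ?case
  proof
    assume "linear_form l dvd defining_poly []"
    then obtain h where "1 = linear_form l * h" by (auto elim: dvdE)
    then have "lookup (linear_form l) 0 * lookup h 0 = 1"
      using lookup_0_mult[of "linear_form l" h] by simp
    then show False using lookup_0_homogeneous[OF homogeneous_linear_form, of l] by simp
  qed
next
  case (Cons l' ls)
  then show ?case
    using linear_form_prime[OF assms(1)] linear_form_dvdD[of l] by (metis defining_poly_Cons list.set_intros)
qed

lemma defining_poly_dvd:
  assumes "line_arrangement ls" "\<And>l. l \<in> set ls \<Longrightarrow> linear_form l dvd p"
  shows "defining_poly ls dvd p"
  using assms
proof (induction ls arbitrary: p)
  case Nil
  then show ?case by simp
next
  case (Cons l ls)
  obtain p' where p': "p = linear_form l * p'" using Cons.prems(2)[of l] by (auto elim: dvdE)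
  have "linear_form l' dvd p'" if l': "l' \<in> set ls" for l'
  proof -
    have "l' \<noteq> 0" using Cons.prems(1) l' by (auto simp: line_arrangement_def)
    moreover have "\<nexists>c. l = c *s l'"
      using nonproportional_sym[of l' l] Cons.prems(1) l' by (auto simp: line_arrangement_Cons)
    moreover have "linear_form l' dvd linear_form l * p'" using Cons.prems(2)[of l'] l' p' by simp
    ultimately show ?thesis using linear_form_prime linear_form_dvdD by blast
  qed
  then have "defining_poly ls dvd p'"
    using Cons.IH Cons.prems(1) by (simp add: line_arrangement_Cons)
  then show ?case by (simp add: p' mult_dvd_mono)
qed

lemma dvd_der_defining_poly:
  assumes "\<And>l. l \<in> set ls \<Longrightarrow> linear_form l dvd der u (linear_form l)"
  shows "defining_poly ls dvd der u (defining_poly ls)"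
  using assms
proof (induction ls)
  case Nil
  then show ?case using der_Const[of u 1] by simp
next
  case (Cons l ls)
  then show ?case by (auto simp: der_mult intro!: dvd_add mult_dvd_mono)
qed

text \<open>
  The converse is where primality enters: for \<open>f = l g\<close> with \<open>l\<close> prime to \<open>g\<close>, the product
  rule leaves \<open>l\<close> dividing \<open>g\<close> times the derivative of \<open>l\<close>.
\<close>

lemma linear_form_dvd_der:
  assumes "line_arrangement ls" "defining_poly ls dvd der u (defining_poly ls)" "l \<in> set ls"
  shows "linear_form l dvd der u (linear_form l)"
proof -
  obtain xs ys where ls: "ls = xs @ l # ys" using assms(3) by (auto simp: in_set_conv_decomp)
  let ?g = "defining_poly (xs @ ys)"
  have f: "defining_poly ls = linear_form l * ?g" by (simp add: ls algebra_simps)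
  have "l \<noteq> 0" using assms(1,3) by (auto simp: line_arrangement_def)
  moreover have "\<nexists>c. l' = c *s l" if "l' \<in> set (xs @ ys)" for l'
  proof (cases "l' \<in> set ys")
    case True
    then show ?thesis
      using assms(1) by (auto simp: ls line_arrangement_append line_arrangement_Cons)
  next
    case False
    then have "l' \<in> set xs" using that by simp
    then have "\<nexists>c. l = c *s l'"
      using assms(1) unfolding ls line_arrangement_append by simp
    moreover have "l' \<noteq> 0"
      using \<open>l' \<in> set xs\<close> assms(1) by (auto simp: ls line_arrangement_def)
    ultimately have "\<nexists>c. l = c *s l'" "l' \<noteq> 0" .
    then show ?thesis using nonproportional_sym by blast
  qed
  ultimately have nd: "\<not> linear_form l dvd ?g" by (rule linear_form_not_dvd_defining_poly)
  have "linear_form l dvd der u (defining_poly ls)"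
    using assms(2) f by (metis dvd_mult_left)
  then have "linear_form l dvd der u (linear_form l) * ?g"
    unfolding f der_mult by (simp add: dvd_add_left_iff)
  then show ?thesis using linear_form_prime[OF \<open>l \<noteq> 0\<close>] nd by blast
qed

lemma AR_Const_mult: "c \<noteq> 0 \<Longrightarrow> AR (Const c * f) = AR f"
  by (auto simp: AR_iff_der der_mult)

lemma jacobian_ideal_Const_mult:
  assumes "c \<noteq> 0"
  shows "jacobian_ideal (Const c * f) = jacobian_ideal f"
proof -
  have pd: "pd i (Const c * f) = Const c * pd i f" for i by (simp add: pd_mult)
  have "\<exists>r'. (\<Sum>i\<in>UNIV. r i * pd i f) = (\<Sum>i\<in>UNIV. r' i * (Const c * pd i f))" for r
  proof (intro exI[of _ "\<lambda>i. Const (1 / c) * r i"] sum.cong refl)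
    fix i
    have "Const (1 / c) * Const c = 1" using assms by (simp flip: Const_simps(6))
    moreover have "Const (1 / c) * r i * (Const c * pd i f) = (Const (1 / c) * Const c) * (r i * pd i f)"
      by (simp only: ac_simps)
    ultimately show "r i * pd i f = Const (1 / c) * r i * (Const c * pd i f)" by simp
  qed
  moreover have "\<exists>r'. (\<Sum>i\<in>UNIV. r i * (Const c * pd i f)) = (\<Sum>i\<in>UNIV. r' i * pd i f)" for r
    by (intro exI[of _ "\<lambda>i. Const c * r i"] sum.cong refl) (simp add: algebra_simps)
  ultimately show ?thesis unfolding jacobian_ideal_def pd by blast
qed

section \<open>The Buchsbaum-Rim complex of a matrix with five rows and three columns\<close>

lemma sum_lessThan_3: "(\<Sum>i<3::nat. g i) = g 0 + g 1 + (g 2 :: 'a::comm_monoid_add)"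
  and sum_lessThan_5: "(\<Sum>i<5::nat. g i) = g 0 + g 1 + g 2 + g 3 + (g 4 :: 'a::comm_monoid_add)"
  by (simp_all add: eval_nat_numeral)

lemma less_3_cases: "(i::nat) < 3 \<longleftrightarrow> i = 0 \<or> i = 1 \<or> i = 2"
  and less_5_cases: "(i::nat) < 5 \<longleftrightarrow> i = 0 \<or> i = 1 \<or> i = 2 \<or> i = 3 \<or> i = 4"
  by auto

definition det3 :: "(nat \<Rightarrow> 'a) \<Rightarrow> (nat \<Rightarrow> 'a) \<Rightarrow> (nat \<Rightarrow> 'a) \<Rightarrow> 'a::comm_ring_1" where
  "det3 p q r = p 0 * (q 1 * r 2 - q 2 * r 1) - p 1 * (q 0 * r 2 - q 2 * r 0)
     + p 2 * (q 0 * r 1 - q 1 * r 0)"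

definition cross :: "(nat \<Rightarrow> 'a) \<Rightarrow> (nat \<Rightarrow> 'a) \<Rightarrow> nat \<Rightarrow> 'a::comm_ring_1" where
  "cross p q c = (if c = 0 then p 1 * q 2 - p 2 * q 1
     else if c = 1 then p 2 * q 0 - p 0 * q 2 else p 0 * q 1 - p 1 * q 0)"

definition other_rows :: "nat \<Rightarrow> nat \<Rightarrow> nat list" where
  "other_rows i j = filter (\<lambda>k. k \<noteq> i \<and> k \<noteq> j) [0, 1, 2, 3, 4]"

text \<open>
  The signed maximal minor complementary to the rows \<open>i\<close> and \<open>j\<close>, antisymmetric in the two.
\<close>

definition cominor :: "(nat \<Rightarrow> nat \<Rightarrow> 'a) \<Rightarrow> nat \<Rightarrow> nat \<Rightarrow> 'a::comm_ring_1" where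
  "cominor B i j = (if i = j then 0 else
     (if i < j then 1 else - 1) * (- 1) ^ (i + j + 1) *
     (case other_rows i j of [k, l, m] \<Rightarrow> det3 (B k) (B l) (B m) | _ \<Rightarrow> 0))"

text \<open>
  The adjugate of the square submatrix complementary to the rows \<open>i < j\<close>, applied to \<open>t\<close>.
\<close>

definition cramer :: "(nat \<Rightarrow> nat \<Rightarrow> 'a) \<Rightarrow> nat \<Rightarrow> nat \<Rightarrow> (nat \<Rightarrow> 'a) \<Rightarrow> nat \<Rightarrow> 'a::comm_ring_1" where
  "cramer B i j t c = (- 1) ^ (i + j + 1) *
     (case other_rows i j of [k, l, m] \<Rightarrow>
        t k * cross (B l) (B m) c + t l * cross (B m) (B k) c + t m * cross (B k) (B l) c | _ \<Rightarrow> 0)"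

lemma cominor_antisym: "cominor B j i = - cominor B i j"
proof -
  have "other_rows j i = other_rows i j" unfolding other_rows_def by (rule filter_cong) auto
  then show ?thesis by (auto simp: cominor_def add.commute)
qed

lemma cominor_mult:
  assumes "i < 5" "c < 3"
  shows "(\<Sum>m<5. cominor B i m * B m c) = 0"
  using assms unfolding less_5_cases less_3_cases
  by (elim disjE; simp add: sum_lessThan_5 cominor_def other_rows_def det3_def; simp add: algebra_simps)

text \<open>
  Cramer's rule for three of the rows; for the two remaining rows it fails by maximal minors of
  the matrix bordered by \<open>t\<close>, which are the entries of the antisymmetric matrix applied to \<open>t\<close>.
\<close>

lemma cramer_mult:
  assumes "i < j" "j < 5" "l < 5"
  shows "(\<Sum>c<3. B l c * cramer B i j t c) = cominor B i j * t l +
    (if l = i then (\<Sum>m<5. cominor B j m * t m)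
     else if l = j then - (\<Sum>m<5. cominor B i m * t m) else 0)"
proof -
  have "i < 5" using assms by simp
  with assms show ?thesis unfolding less_5_cases
    by (elim disjE; simp add: sum_lessThan_5 sum_lessThan_3 cominor_def cramer_def other_rows_def
        det3_def cross_def; simp add: algebra_simps)
qed

lemma cramer_image:
  assumes "i < j" "j < 5" "c < 3"
  shows "cramer B i j (\<lambda>r. \<Sum>c<3. B r c * s c) c = cominor B i j * s c"
proof -
  have "i < 5" using assms by simp
  with assms show ?thesis unfolding less_5_cases less_3_cases
    by (elim disjE; simp add: sum_lessThan_3 cominor_def cramer_def other_rows_def
        det3_def cross_def; simp add: algebra_simps)
qed

lemma cramer_linear:
  "cramer B i j (\<lambda>r. a * t r - b * u r) c = a * cramer B i j t c - b * cramer B i j u c"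
  by (auto simp: cramer_def algebra_simps split: list.split)

lemma cramer_cong:
  assumes "\<And>l. l < 5 \<Longrightarrow> t l = u l"
  shows "cramer B i j t c = cramer B i j u c"
proof -
  have "t l = u l" if "l \<in> set (other_rows i j)" for l
    using that assms by (auto simp: other_rows_def split: if_splits)
  then show ?thesis by (auto simp: cramer_def split: list.split)
qed

definition in_minor_ideal :: "(nat \<Rightarrow> nat \<Rightarrow> 'a) \<Rightarrow> 'a::comm_ring_1 \<Rightarrow> bool" where
  "in_minor_ideal B x \<longleftrightarrow>
     (\<exists>e. x = (\<Sum>j<5. \<Sum>i<j. e i j * cominor B i j))"

text \<open>
  Multiplication by an element of the ideal of maximal minors is homotopic to zero on the
  complex; this lemma and the next two give the homotopies.
\<close>

lemma left_inverse_up_to: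
  assumes "in_minor_ideal B x"
  shows "\<exists>N. (\<forall>a b t u c. N (\<lambda>r. a * t r - b * u r) c = a * N t c - b * N u c) \<and>
    (\<forall>s. \<forall>c<3. N (\<lambda>r. \<Sum>c<3. B r c * s c) c = x * s c) \<and>
    (\<forall>t u c. (\<forall>l<5. t l = u l) \<longrightarrow> N t c = N u c)"
proof -
  obtain e where e: "x = (\<Sum>j<5. \<Sum>i<j. e i j * cominor B i j)"
    using assms unfolding in_minor_ideal_def by blast
  define N where "N t c = (\<Sum>j<5. \<Sum>i<j. e i j * cramer B i j t c)" for t c
  have "N (\<lambda>r. a * t r - b * u r) c = a * N t c - b * N u c" for a b t u c
    by (simp add: N_def cramer_linear sum_distrib_left sum_subtractf algebra_simps)
  moreover have "N (\<lambda>r. \<Sum>c<3. B r c * s c) c = x * s c" if "c < 3" for s c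
    unfolding e N_def sum_distrib_right using that
    by (intro sum.cong refl) (simp add: cramer_image mult.assoc)
  moreover have "N t c = N u c" if "\<forall>l<5. t l = u l" for t u c
    unfolding N_def using that by (simp cong: cramer_cong)
  ultimately show ?thesis by blast
qed

lemma minor_ideal_solves:
  assumes "in_minor_ideal B x" "\<And>i. i < 5 \<Longrightarrow> (\<Sum>m<5. cominor B i m * t m) = 0"
  shows "\<exists>s. \<forall>l<5. (\<Sum>c<3. B l c * s c) = x * t l"
proof -
  obtain e where e: "x = (\<Sum>j<5. \<Sum>i<j. e i j * cominor B i j)"
    using assms unfolding in_minor_ideal_def by blast
  define N where "N c = (\<Sum>j<5. \<Sum>i<j. e i j * cramer B i j t c)" for c
  have "(\<Sum>c<3. B l c * N c) = x * t l" if "l < 5" for l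
  proof -
    have "(\<Sum>c<3. B l c * N c) = (\<Sum>j<5. \<Sum>i<j. e i j * (\<Sum>c<3. B l c * cramer B i j t c))"
      by (simp add: N_def sum_lessThan_3 sum_distrib_left sum.distrib algebra_simps)
    also have "\<dots> = x * t l"
      unfolding e sum_distrib_right using that assms(2)
      by (intro sum.cong refl) (simp add: cramer_mult mult.assoc)
    finally show ?thesis .
  qed
  then show ?thesis by blast
qed

text \<open>
  A vector orthogonal to the columns satisfies the three-term relations that express that the
  left kernel has rank two.
\<close>

lemma left_kernel_cominor:
  assumes "\<And>c. c < 3 \<Longrightarrow> (\<Sum>l<5. q l * B l c) = 0" "i < 5" "j < 5" "p < 5"
  shows "cominor B i j * q p = cominor B p j * q i - cominor B p i * q j"
proof -
  have *: "cominor B i j * q p = cominor B p j * q i - cominor B p i * q j" if "i < j" "j < 5" for i j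
  proof -
    define t where "t = (\<lambda>r. if r = p then 1 else 0 :: 'a)"
    have t: "(\<Sum>m<5. cominor B i m * t m) = cominor B i p" for i
      using assms(4) unfolding t_def by (simp add: mult_delta_right)
    have "(\<Sum>l<5. q l * (\<Sum>c<3. B l c * cramer B i j t c)) = (\<Sum>c<3. cramer B i j t c * (\<Sum>l<5. q l * B l c))"
      unfolding sum_distrib_left by (subst sum.swap) (simp add: algebra_simps)
    also have "\<dots> = 0" using assms(1) by simp
    finally have "0 = (\<Sum>l<5. q l * (cominor B i j * t l + (if l = i then cominor B j p
        else if l = j then - cominor B i p else 0)))"
      using that by (simp add: cramer_mult t cong: if_cong)
    also have "\<dots> = (\<Sum>l<5. (if l = p then cominor B i j * q p else 0)
        + (if l = i then q i * cominor B j p else 0) + (if l = j then - q j * cominor B i p else 0))"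
      using that by (intro sum.cong) (auto simp: t_def algebra_simps)
    also have "\<dots> = cominor B i j * q p + q i * cominor B j p - q j * cominor B i p"
      using that assms(4) by (simp add: sum.distrib)
    finally show ?thesis
      using cominor_antisym[of B p j] cominor_antisym[of B p i] by (simp add: algebra_simps)
  qed
  consider "i < j" | "j < i" | "i = j" by linarith
  then show ?thesis
  proof cases
    case 2
    then show ?thesis using *[of j i] assms cominor_antisym[of B i j]
      by (simp add: algebra_simps)
  qed (use * assms in \<open>auto simp: cominor_def\<close>)
qed

lemma left_kernel_up_to:
  assumes "in_minor_ideal B x" "\<And>c. c < 3 \<Longrightarrow> (\<Sum>l<5. q l * B l c) = 0"
  shows "\<exists>h. \<forall>p<5. x * q p = (\<Sum>m<5. cominor B p m * h m)"
proof -
  obtain e where e: "x = (\<Sum>j<5. \<Sum>i<j. e i j * cominor B i j)"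
    using assms unfolding in_minor_ideal_def by blast
  define h where "h m = (\<Sum>j<5. \<Sum>i<j. e i j * ((if m = j then q i else 0) - (if m = i then q j else 0)))" for m
  have "x * q p = (\<Sum>m<5. cominor B p m * h m)" if "p < 5" for p
  proof -
    have "(\<Sum>m<5. cominor B p m * h m) = (\<Sum>j<5. \<Sum>i<j. \<Sum>m<5. cominor B p m *
        (e i j * ((if m = j then q i else 0) - (if m = i then q j else 0))))"
      unfolding h_def sum_distrib_left by (subst sum.swap) (intro sum.cong refl sum.swap)
    also have "\<dots> = (\<Sum>j<5. \<Sum>i<j. e i j * (cominor B p j * q i - cominor B p i * q j))"
    proof (intro sum.cong refl)
      fix i j :: nat assume ij: "j \<in> {..<5}" "i \<in> {..<j}"
      have "(\<Sum>m<5. cominor B p m * (e i j * ((if m = j then q i else 0) - (if m = i then q j else 0))))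
        = (\<Sum>m<5. (if m = j then e i j * cominor B p j * q i else 0)
            - (if m = i then e i j * cominor B p i * q j else 0))"
        by (intro sum.cong) (auto simp: algebra_simps)
      also have "\<dots> = e i j * (cominor B p j * q i - cominor B p i * q j)"
        using ij by (simp add: sum_subtractf algebra_simps)
      finally show "(\<Sum>m<5. cominor B p m * (e i j * ((if m = j then q i else 0) - (if m = i then q j else 0))))
        = e i j * (cominor B p j * q i - cominor B p i * q j)" .
    qed
    also have "\<dots> = (\<Sum>j<5. \<Sum>i<j. e i j * (cominor B i j * q p))"
      by (intro sum.cong refl arg_cong2[where f = "(*)"] left_kernel_cominor[OF assms(2), symmetric])
        (use that in auto)
    finally show ?thesis by (simp add: e sum_distrib_right mult.assoc)
  qed
  then show ?thesis by blast
qed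

lemma sum_scale:
  fixes a b :: "'a::comm_ring_1"
  shows "(\<Sum>m\<in>A. u m * (a * t m - b * w m)) = a * (\<Sum>m\<in>A. u m * t m) - b * (\<Sum>m\<in>A. u m * w m)"
  by (simp add: sum_distrib_left sum_subtractf algebra_simps)

lemma Var_nonzero [simp]: "Var i \<noteq> 0"
  by (metis Var_def lookup_single_eq lookup_zero zero_neq_one)

context
  fixes B :: "nat \<Rightarrow> nat \<Rightarrow> S" and k :: nat
  assumes powers: "\<And>i. in_minor_ideal B (Var i ^ k)"
begin

text \<open>
  Exactness up to a power of each variable becomes plain exactness: solutions for the powers of
  different variables are compared by the exactness one step before, and then the regularity of
  the sequence of powers lets the power be divided out. The injectivity of \<open>B\<close> needs one variable,
  the next step two, and the last one all three.
\<close>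

lemma columns_independent:
  assumes "\<And>l. l < 5 \<Longrightarrow> (\<Sum>c<3. B l c * s c) = 0" "c < 3"
  shows "s c = 0"
proof -
  obtain e where e: "Var 1 ^ k = (\<Sum>j<5. \<Sum>i<j. e i j * cominor B i j)"
    using powers[of 1] unfolding in_minor_ideal_def by blast
  have "cominor B i j * s c = 0" if "i < j" "j < 5" for i j
  proof -
    have "i < 5" using that by simp
    then have "cramer B i j (\<lambda>r. \<Sum>c<3. B r c * s c) c = 0"
      using that assms(1) unfolding less_5_cases
      by (elim disjE; simp add: cramer_def other_rows_def)
    then show ?thesis using cramer_image[OF that assms(2), of B s] by simp
  qed
  then have "e i j * (cominor B i j * s c) = 0" if "i < j" "j < 5" for i j using that by simp
  then have "Var 1 ^ k * s c = 0"
    unfolding e sum_distrib_right mult.assoc by (intro sum.neutral ballI) simp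
  then show ?thesis by simp
qed

lemma cominor_kernel:
  assumes "\<And>i. i < 5 \<Longrightarrow> (\<Sum>m<5. cominor B i m * t m) = 0"
  shows "\<exists>s. \<forall>l<5. t l = (\<Sum>c<3. B l c * s c)"
proof -
  obtain N1 where N1: "\<And>l. l < 5 \<Longrightarrow> (\<Sum>c<3. B l c * N1 c) = Var 1 ^ k * t l"
    using minor_ideal_solves[OF powers assms] by blast
  obtain N2 where N2: "\<And>l. l < 5 \<Longrightarrow> (\<Sum>c<3. B l c * N2 c) = Var 2 ^ k * t l"
    using minor_ideal_solves[OF powers assms] by blast
  have "Var 2 ^ k * N1 c - Var 1 ^ k * N2 c = 0" if "c < 3" for c
    by (rule columns_independent[of "\<lambda>c. Var 2 ^ k * N1 c - Var 1 ^ k * N2 c"])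
      (use that in \<open>simp_all add: sum_scale N1 N2\<close>)
  then have "Var 1 ^ k dvd N1 c" if "c < 3" for c
    using Var_powers_regular2[of 2 k "N1 c" 1 "N2 c"] that by simp
  then obtain s where s: "\<And>c. c < 3 \<Longrightarrow> N1 c = Var 1 ^ k * s c" unfolding dvd_def by metis
  have "t l = (\<Sum>c<3. B l c * s c)" if "l < 5" for l
  proof -
    have "Var 1 ^ k * t l = Var 1 ^ k * (\<Sum>c<3. B l c * s c)"
      using N1[OF that] s by (simp add: sum_distrib_left sum_lessThan_3 algebra_simps)
    then show ?thesis by simp
  qed
  then show ?thesis by blast
qed

lemma left_kernel:
  assumes "\<And>c. c < 3 \<Longrightarrow> (\<Sum>l<5. q l * B l c) = 0"
  shows "\<exists>t. \<forall>p<5. q p = (\<Sum>m<5. cominor B p m * t m)"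
proof -
  let ?x = "Var 1 ^ k" and ?y = "Var 2 ^ k"
  obtain h where h: "\<And>p. p < 5 \<Longrightarrow> ?x * q p = (\<Sum>m<5. cominor B p m * h m)"
    using left_kernel_up_to[OF powers assms] by blast
  obtain h' where h': "\<And>p. p < 5 \<Longrightarrow> ?y * q p = (\<Sum>m<5. cominor B p m * h' m)"
    using left_kernel_up_to[OF powers assms] by blast
  have "(\<Sum>m<5. cominor B p m * (?y * h m - ?x * h' m)) = 0" if "p < 5" for p
    unfolding sum_scale h[OF that, symmetric] h'[OF that, symmetric] by simp
  from cominor_kernel[OF this] obtain s where
    s: "\<And>l. l < 5 \<Longrightarrow> ?y * h l - ?x * h' l = (\<Sum>c<3. B l c * s c)" by blast
  obtain N where N: "\<And>a b t u c. N (\<lambda>r. a * t r - b * u r) c = a * N t c - b * N u c"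
    "\<And>s c. c < 3 \<Longrightarrow> N (\<lambda>r. \<Sum>c<3. B r c * s c) c = Var 3 ^ k * s c"
    "\<And>t u c. \<forall>l<5. t l = u l \<Longrightarrow> N t c = N u c"
    using left_inverse_up_to[OF powers[of 3]] by blast
  have regular: "\<exists>a b. s c = ?y * a + ?x * b" if "c < 3" for c
  proof -
    have "Var 3 ^ k * s c = N (\<lambda>r. ?y * h r - ?x * h' r) c"
      unfolding N(2)[OF that, symmetric] by (rule N(3)) (simp add: s)
    then show ?thesis
      using Var_powers_regular3[of 3 k "s c" 2 "N h c" 1 "- N h' c"] by (simp add: N(1))
  qed
  then obtain a b where ab: "\<And>c. c < 3 \<Longrightarrow> s c = ?y * a c + ?x * b c" by metis
  have "?x dvd h l - (\<Sum>c<3. B l c * a c)" if "l < 5" for l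
  proof -
    have "(\<Sum>c<3. B l c * s c) = ?y * (\<Sum>c<3. B l c * a c) + ?x * (\<Sum>c<3. B l c * b c)"
      using ab by (simp add: sum_lessThan_3 algebra_simps)
    then have "?y * (h l - (\<Sum>c<3. B l c * a c)) = ?x * (h' l + (\<Sum>c<3. B l c * b c))"
      using s[OF that] by (simp add: algebra_simps)
    then show ?thesis by (rule Var_powers_regular2) simp
  qed
  then obtain t where t: "\<And>l. l < 5 \<Longrightarrow> h l - (\<Sum>c<3. B l c * a c) = ?x * t l"
    unfolding dvd_def by metis
  have "q p = (\<Sum>m<5. cominor B p m * t m)" if "p < 5" for p
  proof -
    have "(\<Sum>m<5. cominor B p m * (\<Sum>c<3. B m c * a c)) = (\<Sum>c<3. a c * (\<Sum>m<5. cominor B p m * B m c))"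
      unfolding sum_distrib_left by (subst sum.swap) (simp add: algebra_simps)
    also have "\<dots> = 0" using that by (simp add: cominor_mult)
    finally have "(\<Sum>m<5. cominor B p m * (h m - (\<Sum>c<3. B m c * a c))) = ?x * q p"
      using h[OF that] by (simp add: right_diff_distrib sum_subtractf)
    moreover have "(\<Sum>m<5. cominor B p m * (h m - (\<Sum>c<3. B m c * a c)))
        = (\<Sum>m<5. cominor B p m * (?x * t m))"
      by (intro sum.cong refl) (simp add: t)
    ultimately have "?x * q p = ?x * (\<Sum>m<5. cominor B p m * t m)"
      by (simp add: sum_distrib_left mult.left_commute)
    then show ?thesis by simp
  qed
  then show ?thesis by blast
qed

end

section \<open>Presenting the Jacobian relations\<close>

definition AR_resolution ::
    "S \<Rightarrow> nat list \<Rightarrow> nat list \<Rightarrow> (nat \<Rightarrow> S^3) \<Rightarrow> (nat \<Rightarrow> nat \<Rightarrow> S) \<Rightarrow> bool" where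
  "AR_resolution f ds es g B \<longleftrightarrow>
     (\<forall>i<length ds. \<forall>c. homogeneous (ds ! i) (g i $ c)) \<and>
     AR f = range (\<lambda>t. \<Sum>i<length ds. t i *s g i) \<and>
     (\<forall>t. (\<Sum>i<length ds. t i *s g i) = 0 \<longleftrightarrow>
        (\<exists>s. \<forall>i<length ds. t i = (\<Sum>c<length es. B i c * s c))) \<and>
     (\<forall>s. (\<forall>i<length ds. (\<Sum>c<length es. B i c * s c) = 0) \<longrightarrow> (\<forall>c<length es. s c = 0)) \<and>
     (\<forall>i<length ds. \<forall>c<length es. homogeneous_int (int (es ! c) - int (ds ! i)) (B i c))"

lemma homogeneous_int_iff: "homogeneous_int d p \<longleftrightarrow> (if d < 0 then p = 0 else homogeneous (nat d) p)"
  by (auto simp: homogeneous_int_def homogeneous_iff in_keys_iff intro!: poly_mapping_eqI)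

lemma homogeneous_int_0 [simp]: "homogeneous_int d 0"
  by (simp add: homogeneous_int_def)

lemma homogeneous_int_int [simp]: "homogeneous_int (int d) p \<longleftrightarrow> homogeneous d p"
  by (simp add: homogeneous_int_iff)

lemma homogeneous_int_Var: "homogeneous_int 1 (Var i)"
  and homogeneous_int_Const: "homogeneous_int 0 (Const c)"
  using homogeneous_int_int[of 1 "Var i"] homogeneous_int_int[of 0 "Const c"] homogeneous_Var[of i] by simp_all

lemma homogeneous_int_mult:
  assumes "homogeneous_int d p" "homogeneous_int e q" "d + e = n"
  shows "homogeneous_int n (p * q)"
  using assms homogeneous_mult[of "nat d" p "nat e" q "nat n"]
  by (auto simp: homogeneous_int_iff nat_add_distrib split: if_splits)

lemma homogeneous_int_add: "homogeneous_int d p \<Longrightarrow> homogeneous_int d q \<Longrightarrow> homogeneous_int d (p + q)"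
  and homogeneous_int_diff: "homogeneous_int d p \<Longrightarrow> homogeneous_int d q \<Longrightarrow> homogeneous_int d (p - q)"
  and homogeneous_int_uminus: "homogeneous_int d p \<Longrightarrow> homogeneous_int d (- p)"
  by (auto simp: homogeneous_int_iff homogeneous_add homogeneous_diff homogeneous_uminus split: if_splits)

lemma homogeneous_int_sum: "(\<And>i. i \<in> A \<Longrightarrow> homogeneous_int d (g i)) \<Longrightarrow> homogeneous_int d (sum g A)"
  by (induction A rule: infinite_finite_induct) (auto intro: homogeneous_int_add)

lemma homogeneous_det3:
  assumes "\<And>c. c < 3 \<Longrightarrow> homogeneous_int (e c - a) (p c)" "\<And>c. c < 3 \<Longrightarrow> homogeneous_int (e c - b) (q c)"
    "\<And>c. c < 3 \<Longrightarrow> homogeneous_int (e c - d) (r c)" "n = e 0 + e 1 + e 2 - a - b - d"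
  shows "homogeneous_int n (det3 p q r)"
proof -
  note h = assms(1)[of 0] assms(1)[of 1] assms(1)[of 2] assms(2)[of 0] assms(2)[of 1] assms(2)[of 2]
    assms(3)[of 0] assms(3)[of 1] assms(3)[of 2]
  have *: "homogeneous_int n (p i * (q j * r k - q k * r j))"
    if "(i, j, k) \<in> {(0, 1, 2), (1, 0, 2), (2, 0, 1)}" for i j k :: nat
  proof (rule homogeneous_int_mult)
    show "homogeneous_int (e i - a) (p i)" using that h by auto
    show "homogeneous_int (e j - b + (e k - d)) (q j * r k - q k * r j)"
      by (intro homogeneous_int_diff; rule homogeneous_int_mult[OF assms(2) assms(3)]) (use that in auto)
    show "e i - a + (e j - b + (e k - d)) = n" using that assms(4) by auto
  qed
  show ?thesis
    unfolding det3_def using *[of 0 1 2] *[of 1 0 2] *[of 2 0 1]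
    by (intro homogeneous_int_add homogeneous_int_diff) auto
qed

text \<open>
  The Euler field is transversal to the relations, which makes the decomposition of a logarithmic
  field into a relation and a multiple of the Euler field unique.
\<close>

lemma der_eq_scaled_euler:
  assumes "f \<noteq> 0" "der euler f = of_nat n * f" "n > 0" "V *s euler \<in> AR f"
  shows "V = 0"
proof -
  have "V * (of_nat n * f) = 0" using assms by (simp add: AR_iff_der der_left_scale)
  then show ?thesis using assms(1,3) by simp
qed

text \<open>
  The lines through \<open>(1 : 0 : 0)\<close> and \<open>(0 : 1 : 0)\<close> are \<open>y\<close>, \<open>l9\<close>, \<open>z\<close> and
  \<open>l10\<close>, \<open>z\<close>. The degrees of \<open>v\<close> and \<open>w\<close> make the generators with coordinates \<open>M v\<close> and \<open>M w\<close>,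
  together with the factors \<open>P\<close> and \<open>Q\<close> of the two components, vector fields of the degrees \<open>ds\<close>. The
  assumption on tangency says that \<open>l\<^sub>x P v + l\<^sub>y Q w\<close> is a combination of the columns of \<open>B\<close>
  along the line \<open>l\<close>; the minors annihilate the columns, so the generators are tangent to \<open>l\<close>.
\<close>

locale fibred_arrangement =
  fixes six :: "(complex^3) list" and l9 l10 :: "complex^3"
    and ds es :: "nat list" and B :: "nat \<Rightarrow> nat \<Rightarrow> S" and v w :: "nat \<Rightarrow> S" and k :: nat and c0 :: complex
  assumes arr: "line_arrangement (vector [0, 1, 0] # six @ [l9, l10, vector [0, 0, 1]])"
    and six_x: "\<And>l. l \<in> set six \<Longrightarrow> l $ 1 \<noteq> 0"
    and l9_x: "l9 $ 1 = 0" and l10_y: "l10 $ 2 = 0"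
    and ds: "length ds = 5" and es: "length es = 3"
    and degs: "sum_list es = sum_list ds - 9" "sum_list ds \<ge> 9" "length six + 4 = 10"
    and powers: "\<And>i. in_minor_ideal B (Var i ^ k)"
    and disc: "(\<Sum>i<5. v i * (\<Sum>m<5. cominor B i m * w m)) = Const c0 * defining_poly six" "c0 \<noteq> 0"
    and tangent: "\<And>l. l \<in> set six \<Longrightarrow> \<exists>s r. \<forall>i<5.
        Const (l $ 1) * linear_form l10 * v i + Const (l $ 2) * (Var 2 * linear_form l9) * w i =
        (\<Sum>c<3. B i c * s c) + linear_form l * r i"
    and hom_B: "\<And>i c. i < 5 \<Longrightarrow> c < 3 \<Longrightarrow> homogeneous_int (int (es ! c) - int (ds ! i)) (B i c)"
    and hom_v: "\<And>i. i < 5 \<Longrightarrow> homogeneous_int (8 - int (ds ! i)) (v i)"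
    and hom_w: "\<And>i. i < 5 \<Longrightarrow> homogeneous_int (7 - int (ds ! i)) (w i)"
begin

abbreviation "M \<equiv> cominor B"

definition a where "a i = (\<Sum>m<5. M i m * v m)"
definition b where "b i = (\<Sum>m<5. M i m * w m)"
definition f where "f = defining_poly (vector [0, 1, 0] # six @ [l9, l10, vector [0, 0, 1]])"
definition P where "P = linear_form l10"
definition Q where "Q = Var 2 * linear_form l9"

definition tangential :: "S \<Rightarrow> S \<Rightarrow> bool" where
  "tangential p q \<longleftrightarrow> (\<forall>l\<in>set six. linear_form l dvd Const (l $ 1) * P * p + Const (l $ 2) * Q * q)"

lemma sum_swap_mult:
  "(\<Sum>i<5. x i * (\<Sum>m<5. G i m * y m)) = (\<Sum>m<5. y m * (\<Sum>i<5. x i * G i (m::nat) :: S))"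
proof -
  have "(\<Sum>i<5. x i * (\<Sum>m<5. G i m * y m)) = (\<Sum>m<5. \<Sum>i<5. x i * (G i m * y m))"
    unfolding sum_distrib_left by (rule sum.swap)
  then show ?thesis by (simp add: sum_distrib_left ac_simps)
qed

lemma antisym_sum: "(\<Sum>i<5. x i * (\<Sum>m<5. M i m * y m)) = - (\<Sum>m<5. y m * (\<Sum>i<5. M m i * x i))"
proof -
  have "(\<Sum>i<5. x i * M i m) = - (\<Sum>i<5. M m i * x i)" for m
    unfolding sum_negf[symmetric] by (intro sum.cong refl) (simp add: cominor_antisym[of B _ m])
  then show ?thesis by (simp add: sum_swap_mult sum_negf)
qed

definition D where "D = Const c0 * defining_poly six"

lemma arr_six: "line_arrangement six"
  using arr by (simp add: line_arrangement_Cons line_arrangement_append)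

lemma D_nonzero: "D \<noteq> 0"
  using disc(2) defining_poly_nonzero arr_six by (simp add: D_def line_arrangement_def)

lemma pairings:
  "(\<Sum>i<5. v i * b i) = D" "(\<Sum>i<5. w i * a i) = - D" "(\<Sum>i<5. v i * a i) = 0" "(\<Sum>i<5. w i * b i) = 0"
proof -
  show vb: "(\<Sum>i<5. v i * b i) = D" using disc by (simp add: b_def D_def)
  show "(\<Sum>i<5. w i * a i) = - D"
    using vb antisym_sum[of w v] by (simp add: a_def b_def)
  have zero: "x = 0" if "x = - x" for x :: S
  proof -
    have "2 * x = 0" using that by (metis add.right_inverse mult_2)
    then show ?thesis by simp
  qed
  show "(\<Sum>i<5. v i * a i) = 0" "(\<Sum>i<5. w i * b i) = 0"
    unfolding a_def b_def by (rule zero[OF antisym_sum])+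
qed

lemma cominor_left_kernel:
  assumes "c < 3"
  shows "(\<Sum>l<5. (\<Sum>m<5. M l m * y m) * B l c) = 0"
proof -
  have "(\<Sum>l<5. B l c * (\<Sum>m<5. M l m * y m)) = - (\<Sum>m<5. y m * (\<Sum>i<5. M m i * B i c))"
    by (rule antisym_sum)
  also have "\<dots> = 0" using assms by (simp add: cominor_mult)
  finally show ?thesis by (simp add: mult.commute)
qed

lemma tangential_generators:
  assumes "i < 5"
  shows "tangential (a i) (b i)"
  unfolding tangential_def
proof
  fix l assume l: "l \<in> set six"
  obtain s r where sr: "\<And>i. i < 5 \<Longrightarrow> Const (l $ 1) * P * v i + Const (l $ 2) * Q * w i =
        (\<Sum>c<3. B i c * s c) + linear_form l * r i"
    using tangent[OF l] unfolding P_def Q_def by blast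
  have "Const (l $ 1) * P * a i + Const (l $ 2) * Q * b i
      = (\<Sum>m<5. M i m * (Const (l $ 1) * P * v m + Const (l $ 2) * Q * w m))"
    by (simp add: a_def b_def sum_distrib_left sum.distrib algebra_simps)
  also have "\<dots> = (\<Sum>m<5. M i m * ((\<Sum>c<3. B m c * s c) + linear_form l * r m))"
    by (intro sum.cong refl) (simp add: sr)
  also have "\<dots> = (\<Sum>m<5. M i m * (\<Sum>c<3. B m c * s c)) + (\<Sum>m<5. M i m * (linear_form l * r m))"
    by (simp add: distrib_left sum.distrib)
  also have "(\<Sum>m<5. M i m * (linear_form l * r m)) = linear_form l * (\<Sum>m<5. M i m * r m)"
    by (simp add: sum_distrib_left mult.left_commute)
  also have "(\<Sum>m<5. M i m * (\<Sum>c<3. B m c * s c)) = (\<Sum>c<3. s c * (\<Sum>m<5. M i m * B m c))"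
    unfolding sum_distrib_left by (subst sum.swap) (simp add: ac_simps)
  also have "\<dots> = 0" using assms by (simp add: cominor_mult)
  finally show "linear_form l dvd Const (l $ 1) * P * a i + Const (l $ 2) * Q * b i" by simp
qed

text \<open>
  Two tangential fields are proportional along each of the six lines: eliminating the second
  coordinate shows that the line divides \<open>l\<^sub>x P\<close> times the determinant, and \<open>P\<close> is prime to it.
\<close>

lemma tangential_determinant:
  assumes "tangential p q" "tangential p' q'"
  shows "D dvd p * q' - q * p'"
proof -
  have "defining_poly six dvd p * q' - q * p'"
  proof (rule defining_poly_dvd[OF arr_six])
    fix l assume l: "l \<in> set six"
    have l0: "l \<noteq> 0" using l arr_six by (auto simp: line_arrangement_def)
    have "linear_form l dvd (Const (l $ 1) * P * p + Const (l $ 2) * Q * q) * q'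
        - (Const (l $ 1) * P * p' + Const (l $ 2) * Q * q') * q"
      using assms l unfolding tangential_def by (intro dvd_diff dvd_mult2) auto
    also have "\<dots> = Const (l $ 1) * (P * (p * q' - q * p'))" by (simp add: algebra_simps)
    finally have *: "linear_form l dvd Const (l $ 1) * (P * (p * q' - q * p'))" .
    have "Const (1 / l $ 1) * Const (l $ 1) = 1" using six_x[OF l] by (simp flip: Const_simps(6))
    then have "P * (p * q' - q * p') = Const (1 / l $ 1) * (Const (l $ 1) * (P * (p * q' - q * p')))"
      by (simp only: mult.assoc[symmetric] mult_1)
    then have "linear_form l dvd P * (p * q' - q * p')" using * by (metis dvd_mult)
    moreover have "\<not> linear_form l dvd P"
    proof -
      have "\<nexists>c. l10 = c *s l"
        using arr l by (simp add: line_arrangement_Cons line_arrangement_append)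
      then show ?thesis unfolding P_def using linear_form_dvdD by blast
    qed
    ultimately show "linear_form l dvd p * q' - q * p'" using linear_form_prime[OF l0] by blast
  qed
  moreover have eq: "Const (1 / c0) * D = defining_poly six"
  proof -
    have "Const (1 / c0) * Const c0 = 1" using disc(2) by (simp flip: Const_simps(6))
    then show ?thesis by (simp only: D_def mult.assoc[symmetric] mult_1)
  qed
  moreover have "D dvd defining_poly six"
    unfolding eq[symmetric] by simp
  ultimately show ?thesis by (meson dvd_trans)
qed

text \<open>
  The coordinates of a tangential pair in terms of the generators come from its determinants
  with them: divided by \<open>D\<close>, these form a vector orthogonal to the columns of \<open>B\<close>.
\<close>

lemma tangential_generated:
  assumes "tangential p q"
  shows "\<exists>t. p = (\<Sum>i<5. t i * a i) \<and> q = (\<Sum>i<5. t i * b i)"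
proof -
  have "\<exists>x. p * b i - q * a i = D * x" if "i < 5" for i
    using tangential_determinant[OF assms tangential_generators[OF that]] by (simp add: dvd_def)
  then obtain x where x: "\<And>i. i < 5 \<Longrightarrow> p * b i - q * a i = D * x i" by metis
  have lin: "D * (\<Sum>l<5. x l * y l) = p * (\<Sum>l<5. b l * y l) - q * (\<Sum>l<5. a l * y l)" for y
  proof -
    have "D * (\<Sum>l<5. x l * y l) = (\<Sum>l<5. (D * x l) * y l)" by (simp add: sum_distrib_left mult.assoc)
    also have "\<dots> = (\<Sum>l<5. (p * b l - q * a l) * y l)" using x by (intro sum.cong) auto
    finally show ?thesis by (simp add: sum_distrib_left sum_subtractf algebra_simps)
  qed
  have "(\<Sum>l<5. x l * B l c) = 0" if "c < 3" for c
    using lin[of "\<lambda>l. B l c"] cominor_left_kernel[OF that] D_nonzero by (simp add: a_def b_def)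
  from left_kernel[OF powers this]
  obtain t where t: "\<And>l. l < 5 \<Longrightarrow> x l = (\<Sum>m<5. M l m * t m)" by blast
  have pair: "(\<Sum>l<5. x l * y l) = - (\<Sum>m<5. t m * (\<Sum>i<5. M m i * y i))" for y
    using antisym_sum[of y t] by (simp add: t mult.commute)
  have "D * (\<Sum>l<5. x l * v l) = D * p" "D * (\<Sum>l<5. x l * w l) = D * q"
    using lin[of v] lin[of w] pairings by (simp_all add: mult.commute)
  then have "p = (\<Sum>l<5. x l * v l)" "q = (\<Sum>l<5. x l * w l)" using D_nonzero by simp_all
  then show ?thesis
    by (intro exI[of _ "\<lambda>i. - t i"]) (simp add: pair a_def b_def sum_negf)
qed

lemma tangential_syzygies:
  "(\<Sum>i<5. t i * a i) = 0 \<and> (\<Sum>i<5. t i * b i) = 0 \<longleftrightarrow> (\<exists>s. \<forall>i<5. t i = (\<Sum>c<3. B i c * s c))"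
proof
  assume "\<exists>s. \<forall>i<5. t i = (\<Sum>c<3. B i c * s c)"
  then obtain s where s: "\<And>i. i < 5 \<Longrightarrow> t i = (\<Sum>c<3. B i c * s c)" by blast
  have "(\<Sum>i<5. t i * (\<Sum>m<5. M i m * y m)) = 0" for y
  proof -
    have "(\<Sum>i<5. t i * (\<Sum>m<5. M i m * y m)) = (\<Sum>i<5. (\<Sum>c<3. B i c * s c) * (\<Sum>m<5. M i m * y m))"
      using s by (intro sum.cong) auto
    also have "\<dots> = (\<Sum>c<3. s c * (\<Sum>i<5. (\<Sum>m<5. M i m * y m) * B i c))"
    proof -
      have "(\<Sum>i<5. (\<Sum>c<3. B i c * s c) * Y i) = (\<Sum>c<3. s c * (\<Sum>i<5. Y i * B i c))" for Y
        unfolding sum_distrib_left sum_distrib_right by (subst sum.swap) (simp add: ac_simps)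
      then show ?thesis .
    qed
    also have "\<dots> = 0" by (simp add: cominor_left_kernel)
    finally show ?thesis .
  qed
  then show "(\<Sum>i<5. t i * a i) = 0 \<and> (\<Sum>i<5. t i * b i) = 0" by (simp add: a_def b_def)
next
  assume *: "(\<Sum>i<5. t i * a i) = 0 \<and> (\<Sum>i<5. t i * b i) = 0"
  define q where "q l = (\<Sum>m<5. M l m * t m)" for l
  have qv: "(\<Sum>l<5. v l * q l) = 0" and qw: "(\<Sum>l<5. w l * q l) = 0"
    using * antisym_sum[of v t] antisym_sum[of w t] by (simp_all add: q_def a_def b_def)
  have kernel: "M i j * q p = M p j * q i - M p i * q j" if "i < 5" "j < 5" "p < 5" for i j p
    by (rule left_kernel_cominor[OF _ that]) (simp add: q_def cominor_left_kernel)
  have "D * q p = 0" if p: "p < 5" for p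
  proof -
    have "D * q p = (\<Sum>i<5. \<Sum>j<5. v i * w j * (M i j * q p))"
      unfolding pairings(1)[symmetric] b_def
      by (simp add: sum_distrib_left sum_distrib_right ac_simps)
    also have "\<dots> = (\<Sum>i<5. \<Sum>j<5. (v i * q i) * (w j * M p j) - (v i * M p i) * (w j * q j))"
    proof (intro sum.cong refl)
      fix i j :: nat assume "i \<in> {..<5}" "j \<in> {..<5}"
      then have *: "M i j * q p = M p j * q i - M p i * q j" by (intro kernel) (use p in auto)
      show "v i * w j * (M i j * q p) = (v i * q i) * (w j * M p j) - (v i * M p i) * (w j * q j)"
        unfolding * by (simp add: algebra_simps)
    qed
    also have "\<dots> = (\<Sum>i<5. v i * q i) * (\<Sum>j<5. w j * M p j) - (\<Sum>i<5. v i * M p i) * (\<Sum>j<5. w j * q j)"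
      by (simp add: sum_subtractf sum_product)
    finally show ?thesis by (simp add: qv qw)
  qed
  then have "(\<Sum>m<5. M p m * t m) = 0" if "p < 5" for p
    using that D_nonzero by (simp add: q_def)
  then show "\<exists>s. \<forall>i<5. t i = (\<Sum>c<3. B i c * s c)" using cominor_kernel[OF powers] by blast
qed

subsection \<open>From tangential pairs to Jacobian relations\<close>

abbreviation "lines \<equiv> vector [0, 1, 0] # six @ [l9, l10, vector [0, 0, 1]]"

lemma vector_y: "linear_form (vector [0, 1, 0]) = Var 2"
  and vector_z: "linear_form (vector [0, 0, 1]) = Var 3"
  by (simp_all add: linear_form_def sum_3 vector_3)

lemma f_nonzero: "f \<noteq> 0"
  unfolding f_def using arr by (intro defining_poly_nonzero) (simp add: line_arrangement_def)

lemma der_euler_f: "der euler f = of_nat 10 * f"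
proof -
  have "length lines = 10" using degs(3) by simp
  then show ?thesis unfolding f_def by (metis der_euler_defining_poly)
qed

lemma homogeneous_f: "homogeneous 10 f"
proof -
  have "length lines = 10" using degs(3) by simp
  then show ?thesis unfolding f_def by (metis homogeneous_defining_poly)
qed

definition field :: "S \<Rightarrow> S \<Rightarrow> S^3" where
  "field p q = vector [P * p, Q * q, 0]"

lemma field_nth: "field p q $ 1 = P * p" "field p q $ 2 = Q * q" "field p q $ 3 = 0"
  by (simp_all add: field_def vector_3)

lemma tangential_field: "tangential p q \<longleftrightarrow> f dvd der (field p q) f"
proof -
  have form: "der (field p q) (linear_form l) = Const (l $ 1) * P * p + Const (l $ 2) * Q * q" for l
    by (simp add: der_linear_form sum_3 field_nth algebra_simps)
  have "linear_form l dvd der (field p q) (linear_form l)"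
    if "l \<in> {vector [0, 1, 0], l9, l10, vector [0, 0, 1]}" for l
    using that l9_x l10_y unfolding form
    by (auto simp: vector_3 vector_y vector_z P_def Q_def intro: dvd_mult)
  moreover have "set lines = set six \<union> {vector [0, 1, 0], l9, l10, vector [0, 0, 1]}" by auto
  ultimately have "(\<forall>l\<in>set lines. linear_form l dvd der (field p q) (linear_form l)) \<longleftrightarrow> tangential p q"
    unfolding tangential_def form[symmetric] by blast
  then show ?thesis
    using dvd_der_defining_poly[of lines] linear_form_dvd_der[OF arr] unfolding f_def by blast
qed

lemma homogeneous_cominor:
  assumes "i < 5" "j < 5"
  shows "homogeneous_int (int (ds ! i) + int (ds ! j) - 9) (M i j)"
proof -
  have sums: "int (es ! 0) + int (es ! 1) + int (es ! 2) =
    int (ds ! 0) + int (ds ! 1) + int (ds ! 2) + int (ds ! 3) + int (ds ! 4) - 9"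
    using degs(1,2) by (simp add: sum_list_sum_nth ds es atLeast0LessThan sum_lessThan_3 sum_lessThan_5)
  have *: "homogeneous_int n (det3 (B k) (B l) (B m))"
    if "k < 5" "l < 5" "m < 5" "n = int (es ! 0) + int (es ! 1) + int (es ! 2)
      - int (ds ! k) - int (ds ! l) - int (ds ! m)" for k l m n
    by (rule homogeneous_det3[OF hom_B hom_B hom_B]) (use that in auto)
  show ?thesis using assms unfolding less_5_cases
    by (elim disjE; simp add: cominor_def other_rows_def;
        intro homogeneous_int_uminus *; insert sums; simp)
qed

lemma homogeneous_a: "i < 5 \<Longrightarrow> homogeneous_int (int (ds ! i) - 1) (a i)"
  and homogeneous_b: "i < 5 \<Longrightarrow> homogeneous_int (int (ds ! i) - 2) (b i)"
  unfolding a_def b_def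
  by (auto intro!: homogeneous_int_sum homogeneous_int_mult[OF homogeneous_cominor hom_v]
      homogeneous_int_mult[OF homogeneous_cominor hom_w])

lemma homogeneous_P: "homogeneous_int 1 P" and homogeneous_Q: "homogeneous_int 2 Q"
proof -
  have "homogeneous 2 (Var 2 * linear_form l9)"
    by (rule homogeneous_mult[OF homogeneous_Var homogeneous_linear_form]) simp
  then show "homogeneous_int 1 P" "homogeneous_int 2 Q"
    using homogeneous_linear_form[of l10] by (simp_all add: P_def Q_def homogeneous_int_iff)
qed

lemma homogeneous_field:
  assumes "i < 5"
  shows "homogeneous_int (int (ds ! i)) (field (a i) (b i) $ c)"
proof -
  have "homogeneous_int (int (ds ! i)) (P * a i)" "homogeneous_int (int (ds ! i)) (Q * b i)"
    using assms by (auto intro!: homogeneous_int_mult[OF homogeneous_P homogeneous_a]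
        homogeneous_int_mult[OF homogeneous_Q homogeneous_b] simp del: homogeneous_int_int)
  then show ?thesis using exhaust_3[of c] by (auto simp: field_nth)
qed

text \<open>
  The three remaining lines force the shape of a relation: modulo a multiple of the Euler
  field its third component vanishes, since it is divisible by \<open>z\<close>, and then the first two
  are divisible by the forms of the lines through \<open>(0 : 1 : 0)\<close> and \<open>(1 : 0 : 0)\<close>.
\<close>

lemma AR_decomposition:
  assumes "u \<in> AR f"
  shows "\<exists>p q V. tangential p q \<and> u = field p q + V *s euler"
proof -
  have u: "linear_form l dvd der u (linear_form l)" if "l \<in> set lines" for l
    using linear_form_dvd_der[OF arr _ that, of u] assms by (simp add: AR_iff_der f_def)
  have "Var 3 dvd u $ 3" using u[of "vector [0, 0, 1]"] by (simp add: vector_z)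
  then obtain V where V: "u $ 3 = V * Var 3" by (metis dvdE mult.commute)
  define \<theta> where "\<theta> = u - V *s euler"
  have th3: "\<theta> $ 3 = 0" by (simp add: \<theta>_def euler_def V)
  have "der \<theta> f = - V * (of_nat 10 * f)"
    using assms by (simp add: \<theta>_def der_left_diff der_left_scale der_euler_f AR_iff_der)
  then have fth: "f dvd der \<theta> f" by simp
  have th: "linear_form l dvd der \<theta> (linear_form l)" if "l \<in> set lines" for l
    using linear_form_dvd_der[OF arr _ that, of \<theta>] fth by (simp add: f_def)
  have nz: "l9 \<noteq> 0" "l10 \<noteq> 0" using arr by (auto simp: line_arrangement_def)
  have "l9 $ 2 \<noteq> 0"
  proof
    assume "l9 $ 2 = 0"
    then have "l9 = (l9 $ 3) *s vector [0, 0, 1]" using l9_x by (simp add: vec_eq_iff forall_3 vector_3)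
    moreover have "\<nexists>c. vector [0, 0, 1] = c *s l9"
      using arr by (simp add: line_arrangement_Cons line_arrangement_append)
    ultimately show False using nonproportional_sym[of "vector [0, 0, 1]" l9] nz by blast
  qed
  have "l10 $ 1 \<noteq> 0"
  proof
    assume "l10 $ 1 = 0"
    then have "l10 = (l10 $ 3) *s vector [0, 0, 1]" using l10_y by (simp add: vec_eq_iff forall_3 vector_3)
    moreover have "\<nexists>c. vector [0, 0, 1] = c *s l10"
      using arr by (simp add: line_arrangement_Cons line_arrangement_append)
    ultimately show False using nonproportional_sym[of "vector [0, 0, 1]" l10] nz by blast
  qed
  have cancel: "l dvd p" if "l dvd Const c * p" "c \<noteq> 0" for l p c
  proof -
    have "Const (1 / c) * Const c = 1" using that by (simp flip: Const_simps(6))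
    then have "p = Const (1 / c) * (Const c * p)" by (simp only: mult.assoc[symmetric] mult_1)
    then show ?thesis using that(1) by (metis dvd_mult)
  qed
  have "P dvd \<theta> $ 1"
  proof (rule cancel[OF _ \<open>l10 $ 1 \<noteq> 0\<close>])
    show "P dvd Const (l10 $ 1) * \<theta> $ 1"
      using th[of l10] l10_y th3 by (simp add: P_def der_linear_form sum_3)
  qed
  then obtain p where p: "\<theta> $ 1 = P * p" by (auto elim: dvdE)
  have "Q dvd \<theta> $ 2"
  proof -
    have "defining_poly [vector [0, 1, 0], l9] dvd \<theta> $ 2"
    proof (rule defining_poly_dvd)
      show "line_arrangement [vector [0, 1, 0], l9]"
        using arr by (simp add: line_arrangement_Cons line_arrangement_append)
      show "linear_form l dvd \<theta> $ 2" if "l \<in> set [vector [0, 1, 0], l9]" for l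
      proof (cases "l = l9")
        case True
        show ?thesis
        proof (rule cancel[OF _ \<open>l9 $ 2 \<noteq> 0\<close>])
          show "linear_form l dvd Const (l9 $ 2) * \<theta> $ 2"
            using th[of l9] True l9_x th3 by (simp add: der_linear_form sum_3)
        qed
      next
        case False
        then show ?thesis using th[of "vector [0, 1, 0]"] that by (simp add: vector_y)
      qed
    qed
    then show ?thesis by (simp add: Q_def vector_y)
  qed
  then obtain q where q: "\<theta> $ 2 = Q * q" by (auto elim: dvdE)
  have "\<theta> = field p q" using p q th3 by (simp add: vec_eq_iff forall_3 field_nth)
  moreover have "u = \<theta> + V *s euler" by (simp add: \<theta>_def)
  ultimately show ?thesis using tangential_field fth by blast
qed

text \<open>
  Subtracting a tenth of the cofactor times the Euler field turns a logarithmic field into a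
  relation of the same degree, and no nonzero multiple of the Euler field is a relation.
\<close>

theorem AR_resolution_exists: "\<exists>g. AR_resolution f ds es g B"
proof -
  have "\<exists>h. der (field (a i) (b i)) f = f * h" if "i < 5" for i
    using tangential_field[of "a i" "b i"] tangential_generators[OF that] by (auto elim: dvdE)
  then obtain h where h: "\<And>i. i < 5 \<Longrightarrow> der (field (a i) (b i)) f = f * h i" by metis
  define g where "g i = field (a i) (b i) - (Const (1 / 10) * h i) *s euler" for i
  have ten: "Const (1 / 10) * of_nat 10 = 1" by (simp flip: Const_numeral Const_simps(6))
  have g_AR: "g i \<in> AR f" if "i < 5" for i
  proof -
    have "der (g i) f = f * h i - (Const (1 / 10) * of_nat 10) * (h i * f)"
      by (simp only: g_def der_left_diff der_left_scale der_euler_f h[OF that] ac_simps)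
    then show ?thesis by (simp only: ten AR_iff_der) (simp add: mult.commute)
  qed
  have field_sum: "(\<Sum>i<5. t i *s g i) = field (\<Sum>i<5. t i * a i) (\<Sum>i<5. t i * b i)
      - (Const (1 / 10) * (\<Sum>i<5. t i * h i)) *s euler" for t
    by (simp add: vec_eq_iff forall_3 field_nth g_def sum_distrib_left sum_subtractf algebra_simps)
  have sum_AR: "(\<Sum>i<5. t i *s g i) \<in> AR f" for t
  proof -
    have "der (\<Sum>i\<in>A. t i *s g i) f = 0" if "A \<subseteq> {..<5}" for A
      using finite_subset[OF that finite_lessThan] that
    proof (induction A rule: finite_induct)
      case empty
      show ?case by (simp add: der_def)
    next
      case (insert i A)
      then show ?case using g_AR[of i] by (simp add: der_left_add der_left_scale AR_iff_der)
    qed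
    then show ?thesis by (simp add: AR_iff_der)
  qed
  have euler_zero: "V = 0" if "V *s euler \<in> AR f" for V
    using der_eq_scaled_euler[OF f_nonzero der_euler_f _ that] by simp
  have AR: "u \<in> range (\<lambda>t. \<Sum>i<5. t i *s g i)" if u: "u \<in> AR f" for u
  proof -
    obtain p q V where pq: "tangential p q" "u = field p q + V *s euler"
      using AR_decomposition[OF u] by blast
    obtain t where t: "p = (\<Sum>i<5. t i * a i)" "q = (\<Sum>i<5. t i * b i)"
      using tangential_generated[OF pq(1)] by blast
    let ?V = "V + Const (1 / 10) * (\<Sum>i<5. t i * h i)"
    have eq: "u - (\<Sum>i<5. t i *s g i) = ?V *s euler"
      unfolding field_sum pq(2) t by (simp add: vec_eq_iff algebra_simps)
    have "u - (\<Sum>i<5. t i *s g i) \<in> AR f"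
      using u sum_AR[of t] by (simp add: AR_iff_der der_left_diff)
    then have "?V = 0" unfolding eq by (rule euler_zero)
    then have "u = (\<Sum>i<5. t i *s g i)" using eq by simp
    then show ?thesis by blast
  qed
  have field_0: "field 0 0 = 0" by (simp add: vec_eq_iff forall_3 field_nth)
  have syz: "(\<Sum>i<5. t i *s g i) = 0 \<longleftrightarrow> (\<exists>s. \<forall>i<5. t i = (\<Sum>c<3. B i c * s c))" for t
  proof -
    have "(\<Sum>i<5. t i *s g i) = 0 \<longleftrightarrow> (\<Sum>i<5. t i * a i) = 0 \<and> (\<Sum>i<5. t i * b i) = 0"
    proof
      assume *: "(\<Sum>i<5. t i *s g i) = 0"
      have "(\<Sum>i<5. t i *s g i) $ 3 = - (Const (1 / 10) * (\<Sum>i<5. t i * h i)) * Var 3"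
        unfolding field_sum by (simp add: field_nth euler_def)
      then have "Const (1 / 10) * (\<Sum>i<5. t i * h i) = 0" unfolding * by simp
      then have F: "field (\<Sum>i<5. t i * a i) (\<Sum>i<5. t i * b i) = 0" using * unfolding field_sum by simp
      have "P * (\<Sum>i<5. t i * a i) = 0" "Q * (\<Sum>i<5. t i * b i) = 0"
        using arg_cong[OF F, of "\<lambda>u. u $ 1"] arg_cong[OF F, of "\<lambda>u. u $ 2"]
        by (simp_all only: field_nth zero_index)
      moreover have "P \<noteq> 0" "Q \<noteq> 0"
        using arr by (auto simp: P_def Q_def line_arrangement_def)
      ultimately show "(\<Sum>i<5. t i * a i) = 0 \<and> (\<Sum>i<5. t i * b i) = 0" by simp
    next
      assume *: "(\<Sum>i<5. t i * a i) = 0 \<and> (\<Sum>i<5. t i * b i) = 0"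
      have eq: "(\<Sum>i<5. t i *s g i) = (- (Const (1 / 10) * (\<Sum>i<5. t i * h i))) *s euler"
        unfolding field_sum using * by (simp add: field_0 vec_eq_iff)
      have "(- (Const (1 / 10) * (\<Sum>i<5. t i * h i))) *s euler \<in> AR f"
        using sum_AR[of t] unfolding eq .
      then have z: "- (Const (1 / 10) * (\<Sum>i<5. t i * h i)) = 0" by (rule euler_zero)
      show "(\<Sum>i<5. t i *s g i) = 0" by (simp only: eq z vector_smult_lzero)
    qed
    then show ?thesis using tangential_syzygies by simp
  qed
  have hom: "homogeneous (ds ! i) (g i $ c)" if i: "i < 5" for i c
  proof -
    have fh: "homogeneous (ds ! i) (field (a i) (b i) $ c)" for c
      using homogeneous_field[OF i] by simp
    have "homogeneous (9 + ds ! i) (f * h i)"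
      unfolding h[OF i, symmetric] der_def using homogeneous_f
      by (intro homogeneous_sum homogeneous_mult[OF fh homogeneous_pd]) simp_all
    have "homogeneous_int (int (ds ! i) - 1) (h i)"
    proof (cases "ds ! i = 0")
      case True
      then have "hc 9 (f * h i) = f * h i"
        using \<open>homogeneous (9 + ds ! i) (f * h i)\<close> by (simp add: hc_homogeneous)
      then have "f * h i = 0" using hc_mult_left[OF homogeneous_f, of 9 "h i"] by simp
      then show ?thesis using f_nonzero by simp
    next
      case False
      then have "homogeneous (ds ! i - 1) (h i)"
        using homogeneous_cofactor[OF homogeneous_f \<open>homogeneous (9 + ds ! i) (f * h i)\<close> f_nonzero] by simp
      then show ?thesis using False by (simp add: homogeneous_int_iff nat_diff_distrib)
    qed
    then have "homogeneous_int (int (ds ! i)) (h i * Var c)"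
      by (rule homogeneous_int_mult[OF _ homogeneous_int_Var]) simp
    then have "homogeneous_int (int (ds ! i)) (Const (1 / 10) * (h i * Var c))"
      by (rule homogeneous_int_mult[OF homogeneous_int_Const]) simp
    then show ?thesis using fh[of c]
      by (simp add: g_def euler_def homogeneous_diff mult.assoc)
  qed
  have "AR f = range (\<lambda>t. \<Sum>i<5. t i *s g i)" using AR sum_AR by blast
  then have "AR_resolution f ds es g B"
    unfolding AR_resolution_def ds es using hom syz columns_independent[OF powers] hom_B by blast
  then show ?thesis by blast
qed

end

section \<open>Minimal generators and minimal resolutions\<close>

definition hcz :: "int \<Rightarrow> S \<Rightarrow> S" where
  "hcz d p = (if d < 0 then 0 else hc (nat d) p)"

lemma homogeneous_hcz [simp]: "homogeneous_int d (hcz d p)"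
  by (simp add: hcz_def homogeneous_int_iff)

lemma hcz_homogeneous: "homogeneous_int d p \<Longrightarrow> hcz d p = p"
  by (auto simp: hcz_def homogeneous_int_iff hc_homogeneous)

lemma hcz_sum: "hcz d (sum g A) = (\<Sum>i\<in>A. hcz d (g i))"
  by (simp add: hcz_def hc_sum)

lemma hcz_mult: "homogeneous_int e q \<Longrightarrow> hcz d (p * q) = hcz (d - e) p * q"
  by (auto simp: hcz_def homogeneous_int_iff hc_mult nat_diff_distrib nat_le_iff split: if_splits)

lemma lookup_0_hcz: "lookup (hcz 0 p) 0 = lookup p 0"
  by (simp add: hcz_def lookup_hc)

text \<open>Elements of \<open>S\<^sup>3\<close> are homogeneous of a possibly negative degree.\<close>

definition hom3 :: "int \<Rightarrow> S^3 \<Rightarrow> bool" where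
  "hom3 d x \<longleftrightarrow> (\<forall>c. homogeneous_int d (x $ c))"

text \<open>
  The homogeneous components of the coefficients of the right degrees already give the combination.
\<close>

lemma homogenize_combination:
  assumes "\<And>j. j < n \<Longrightarrow> hom3 (ds j) (g j)" "hom3 d (\<Sum>j<n. t j *s g j)"
  shows "(\<Sum>j<n. t j *s g j) = (\<Sum>j<n. hcz (d - ds j) (t j) *s g j)"
proof -
  have "(\<Sum>j<n. t j *s g j) $ c = (\<Sum>j<n. hcz (d - ds j) (t j) *s g j) $ c" for c
  proof -
    have "(\<Sum>j<n. t j *s g j) $ c = hcz d (\<Sum>j<n. t j * g j $ c)"
      using assms(2) by (simp add: hom3_def hcz_homogeneous)
    also have "\<dots> = (\<Sum>j<n. hcz (d - ds j) (t j) * g j $ c)"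
      unfolding hcz_sum using assms(1) by (intro sum.cong refl hcz_mult) (simp add: hom3_def)
    finally show ?thesis by simp
  qed
  then show ?thesis by (simp add: vec_eq_iff)
qed

lemma count_list_conv_sum: "of_nat (count_list xs d) = (\<Sum>j<length xs. if xs ! j = d then 1 else 0 :: complex)"
proof (induction xs)
  case (Cons x xs)
  have "(\<Sum>j<length (x # xs). if (x # xs) ! j = d then 1 else 0 :: complex)
      = (if x = d then 1 else 0) + (\<Sum>j<length xs. if xs ! j = d then 1 else 0)"
    unfolding length_Cons sum.lessThan_Suc_shift by simp
  then show ?case using Cons.IH by simp
qed simp

text \<open>
  Two mutually inverse graded matrices over a field of characteristic \<open>0\<close> have as many rows as
  columns in each degree: the trace of either product counts them.
\<close>

lemma count_list_eq_of_inverse: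
  fixes P Q :: "nat \<Rightarrow> nat \<Rightarrow> complex"
  assumes "\<And>j k. j < length ds \<Longrightarrow> k < length ds' \<Longrightarrow> ds ! j \<noteq> ds' ! k \<Longrightarrow> P j k = 0"
    and "\<And>j. j < length ds \<Longrightarrow> (\<Sum>k<length ds'. P j k * Q k j) = 1"
    and "\<And>k. k < length ds' \<Longrightarrow> (\<Sum>j<length ds. Q k j * P j k) = 1"
  shows "count_list ds d = count_list ds' d"
proof -
  have "of_nat (count_list ds d) = (\<Sum>j<length ds. if ds ! j = d then \<Sum>k<length ds'. P j k * Q k j else 0)"
    unfolding count_list_conv_sum using assms(2) by (intro sum.cong) auto
  also have "\<dots> = (\<Sum>j<length ds. \<Sum>k<length ds'. if ds' ! k = d then Q k j * P j k else 0)"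
  proof (intro sum.cong refl)
    fix j assume "j \<in> {..<length ds}"
    then have "(if ds ! j = d then P j k * Q k j else 0) = (if ds' ! k = d then Q k j * P j k else 0)"
      if "k < length ds'" for k
      using assms(1)[of j k] that by (cases "ds ! j = ds' ! k") auto
    then show "(if ds ! j = d then \<Sum>k<length ds'. P j k * Q k j else 0)
        = (\<Sum>k<length ds'. if ds' ! k = d then Q k j * P j k else 0)"
      by (cases "ds ! j = d") (auto intro!: sum.cong simp flip: sum.neutral_const)
  qed
  also have "\<dots> = (\<Sum>k<length ds'. if ds' ! k = d then \<Sum>j<length ds. Q k j * P j k else 0)"
    by (subst sum.swap) (intro sum.cong; simp)
  also have "\<dots> = of_nat (count_list ds' d)"
    unfolding count_list_conv_sum using assms(3) by (intro sum.cong) auto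
  finally show ?thesis by (simp only: of_nat_eq_iff)
qed

text \<open>
  Minimality in the form in which it is used: no relation has a nonzero constant coefficient. For
  homogeneous generators this says that none can be omitted (\<open>minimal_generators_minimal_family\<close>).
\<close>

definition minimal_family :: "nat \<Rightarrow> (nat \<Rightarrow> S^3) \<Rightarrow> bool" where
  "minimal_family n g \<longleftrightarrow> (\<forall>t. (\<Sum>j<n. t j *s g j) = 0 \<longrightarrow> (\<forall>j<n. lookup (t j) 0 = 0))"

lemma lookup_0_hom: "homogeneous_int d p \<Longrightarrow> d \<noteq> 0 \<Longrightarrow> lookup p 0 = 0"
  by (auto simp: homogeneous_int_iff lookup_0_homogeneous split: if_splits)

lemma graded_coefficients:
  assumes "\<And>j. j < length ds \<Longrightarrow> hom3 (ds ! j) (g j)" "\<And>k. k < n' \<Longrightarrow> hom3 (ds' k) (g' k)"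
    and "\<And>k. k < n' \<Longrightarrow> g' k \<in> range (\<lambda>t. \<Sum>j<length ds. t j *s g j)"
  shows "\<exists>P. (\<forall>j<length ds. \<forall>k<n'. homogeneous_int (ds' k - ds ! j) (P j k)) \<and>
    (\<forall>k<n'. g' k = (\<Sum>j<length ds. P j k *s g j))"
proof -
  have "\<exists>t. g' k = (\<Sum>j<length ds. t j *s g j)" if "k < n'" for k using assms(3)[OF that] by auto
  then obtain T where T: "\<And>k. k < n' \<Longrightarrow> g' k = (\<Sum>j<length ds. T k j *s g j)" by metis
  let ?P = "\<lambda>j k. hcz (ds' k - ds ! j) (T k j)"
  have "g' k = (\<Sum>j<length ds. ?P j k *s g j)" if "k < n'" for k
    using homogenize_combination[where g = g and t = "T k" and d = "ds' k" and ds = "(!) ds"] assms(1)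
      assms(2)[OF that] T[OF that] by simp
  then show ?thesis by (intro exI[of _ ?P]) simp
qed

text \<open>
  The graded form of Nakayama's lemma that is needed: the matrices that express two minimal
  families of homogeneous generators of the same module by each other are inverse to each
  other modulo \<open>(x, y, z)\<close>.
\<close>

lemma inverse_constants:
  assumes "minimal_family n g"
    and P: "\<And>k. k < n' \<Longrightarrow> g' k = (\<Sum>j<n. P j k *s g j)"
    and Q: "\<And>j. j < n \<Longrightarrow> g j = (\<Sum>k<n'. Q k j *s g' k)"
    and j: "i < n" "j < n"
  shows "lookup (\<Sum>k<n'. P i k * Q k j) 0 = (if i = j then 1 else 0)"
proof -
  let ?t = "\<lambda>i. (\<Sum>k<n'. P i k * Q k j) - (if i = j then 1 else 0)"
  have "(\<Sum>k<n'. Q k j *s g' k) = (\<Sum>k<n'. Q k j *s (\<Sum>i<n. P i k *s g i))"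
    using P by (intro sum.cong) auto
  also have "\<dots> = (\<Sum>i<n. (\<Sum>k<n'. P i k * Q k j) *s g i)"
  proof -
    have "(\<Sum>k<n'. Q k j *s (\<Sum>i<n. P i k *s g i)) = (\<Sum>k<n'. \<Sum>i<n. (P i k * Q k j) *s g i)"
      by (simp add: vec_eq_iff sum_distrib_left ac_simps)
    also have "\<dots> = (\<Sum>i<n. \<Sum>k<n'. (P i k * Q k j) *s g i)" by (rule sum.swap)
    finally show ?thesis by (simp add: vec_eq_iff sum_distrib_right)
  qed
  finally have "g j = (\<Sum>i<n. (\<Sum>k<n'. P i k * Q k j) *s g i)" using Q[OF j(2)] by simp
  moreover have "(\<Sum>i<n. (if i = j then 1 else 0) *s g i) = g j"
    using j by (simp add: vec_eq_iff mult_delta_left)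
  moreover have "(\<Sum>i<n. ?t i *s g i) = (\<Sum>i<n. (\<Sum>k<n'. P i k * Q k j) *s g i)
      - (\<Sum>i<n. (if i = j then 1 else 0) *s g i)"
    by (simp add: vec_eq_iff left_diff_distrib sum_subtractf)
  ultimately have "(\<Sum>i<n. ?t i *s g i) = 0" by simp
  then have "lookup (?t i) 0 = 0" by (rule assms(1)[unfolded minimal_family_def, rule_format, OF _ j(1)])
  then show ?thesis by (auto simp: lookup_minus)
qed

lemma minimal_families_same_degrees:
  assumes g: "\<And>j. j < length ds \<Longrightarrow> hom3 (ds ! j) (g j)" and g': "\<And>k. k < length ds' \<Longrightarrow> hom3 (ds' ! k) (g' k)"
    and gen: "\<And>k. k < length ds' \<Longrightarrow> g' k \<in> range (\<lambda>t. \<Sum>j<length ds. t j *s g j)"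
    and gen': "\<And>j. j < length ds \<Longrightarrow> g j \<in> range (\<lambda>t. \<Sum>k<length ds'. t k *s g' k)"
    and min: "minimal_family (length ds) g" and min': "minimal_family (length ds') g'"
  shows "count_list ds d = count_list ds' d"
proof -
  have "\<exists>P. (\<forall>j<length ds. \<forall>k<length ds'. homogeneous_int (ds' ! k - ds ! j) (P j k)) \<and>
      (\<forall>k<length ds'. g' k = (\<Sum>j<length ds. P j k *s g j))"
    by (rule graded_coefficients; (rule g g' gen)?; assumption)
  then obtain P where P: "\<forall>j<length ds. \<forall>k<length ds'. homogeneous_int (ds' ! k - ds ! j) (P j k)"
    "\<forall>k<length ds'. g' k = (\<Sum>j<length ds. P j k *s g j)" by blast
  have "\<exists>Q. (\<forall>k<length ds'. \<forall>j<length ds. homogeneous_int (ds ! j - ds' ! k) (Q k j)) \<and>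
      (\<forall>j<length ds. g j = (\<Sum>k<length ds'. Q k j *s g' k))"
    by (rule graded_coefficients; (rule g g' gen')?; assumption)
  then obtain Q where Q: "\<forall>j<length ds. g j = (\<Sum>k<length ds'. Q k j *s g' k)" by blast
  show ?thesis
  proof (rule count_list_eq_of_inverse[where P = "\<lambda>j k. lookup (P j k) 0" and Q = "\<lambda>k j. lookup (Q k j) 0"])
    show "lookup (P j k) 0 = 0" if "j < length ds" "k < length ds'" "ds ! j \<noteq> ds' ! k" for j k
      using P(1) that lookup_0_hom by fastforce
    show "(\<Sum>k<length ds'. lookup (P j k) 0 * lookup (Q k j) 0) = 1" if "j < length ds" for j
      using inverse_constants[OF min, of "length ds'" g' P Q j j] P(2) Q that
      by (simp add: lookup_sum lookup_0_mult)
    show "(\<Sum>j<length ds. lookup (Q k j) 0 * lookup (P j k) 0) = 1" if "k < length ds'" for k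
      using inverse_constants[OF min', of "length ds" g Q P k k] P(2) Q that
      by (simp add: lookup_sum lookup_0_mult)
  qed
qed

subsection \<open>The degree sequence\<close>

lemma AR_resolution_minimal:
  assumes "AR_resolution f ds es g B" "\<And>i c. i < length ds \<Longrightarrow> c < length es \<Longrightarrow> lookup (B i c) 0 = 0"
  shows "minimal_family (length ds) g"
  unfolding minimal_family_def
proof (intro allI impI)
  fix t j assume t: "(\<Sum>j<length ds. t j *s g j) = 0" and j: "j < length ds"
  then obtain s where "\<forall>i<length ds. t i = (\<Sum>c<length es. B i c * s c)"
    using assms(1) unfolding AR_resolution_def by blast
  then show "lookup (t j) 0 = 0" using assms(2) j by (simp add: lookup_sum lookup_0_mult)
qed

lemma span_list: "S3.span (set gs) \<subseteq> range (\<lambda>t. \<Sum>k<length gs. t k *s gs ! k)"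
proof
  fix x assume "x \<in> S3.span (set gs)"
  then obtain u where x: "x = (\<Sum>y\<in>set gs. u y *s y)" by (auto simp: S3.span_finite)
  have "y *s v \<in> range (\<lambda>t. \<Sum>k<length gs. t k *s gs ! k)" if v: "v \<in> set gs" for v y
  proof -
    obtain i where i: "i < length gs" "gs ! i = v" using v by (auto simp: in_set_conv_nth)
    have "(\<Sum>k<length gs. (if k = i then y else 0) *s gs ! k) = y *s v"
      using i by (simp add: vec_eq_iff mult_delta_left)
    then show ?thesis by (intro range_eqI[where x = "\<lambda>k. if k = i then y else 0"]) simp
  qed
  then have "\<forall>v\<in>set gs. \<exists>T. u v *s v = (\<Sum>k<length gs. T k *s gs ! k)" by blast
  from bchoice[OF this]
  obtain T where T: "\<forall>v\<in>set gs. u v *s v = (\<Sum>k<length gs. T v k *s gs ! k)" by blast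
  have "x = (\<Sum>v\<in>set gs. \<Sum>k<length gs. T v k *s gs ! k)" unfolding x using T by (intro sum.cong) auto
  also have "\<dots> = (\<Sum>k<length gs. (\<Sum>v\<in>set gs. T v k) *s gs ! k)"
    by (subst sum.swap) (simp add: vec_eq_iff sum_distrib_right)
  finally show "x \<in> range (\<lambda>t. \<Sum>k<length gs. t k *s gs ! k)"
    by (intro range_eqI[where x = "\<lambda>k. \<Sum>v\<in>set gs. T v k"])
qed

lemma combination_in_span: "(\<And>k. k < n \<Longrightarrow> g k \<in> S3.span A) \<Longrightarrow> (\<Sum>k<n. t k *s g k) \<in> S3.span A"
  by (intro S3.span_sum S3.span_scale) auto

lemma minimal_generators_minimal_family:
  assumes "minimal_generators N (set gs)" "distinct gs" "\<And>k. k < length gs \<Longrightarrow> hom3 (ds k) (gs ! k)"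
  shows "minimal_family (length gs) ((!) gs)"
  unfolding minimal_family_def
proof (intro allI impI, rule ccontr)
  fix t j assume t: "(\<Sum>k<length gs. t k *s gs ! k) = 0" and j: "j < length gs" and nz: "lookup (t j) 0 \<noteq> 0"
  let ?u = "\<lambda>k. hcz (ds j - ds k) (t k)" and ?c = "lookup (t j) 0"
  have uj: "?u j = Const ?c"
    using homogeneous_0_imp_Const[of "hcz 0 (t j)"] homogeneous_hcz[of 0 "t j"] lookup_0_hcz[of "t j"]
    by (simp add: homogeneous_int_iff)
  have "(\<Sum>k<length gs. ?u k *s gs ! k) = 0"
    using homogenize_combination[of "length gs" ds "(!) gs" "ds j" t] assms(3) t by (simp add: hom3_def)
  then have sum: "Const ?c *s gs ! j + (\<Sum>k\<in>{..<length gs} - {j}. ?u k *s gs ! k) = 0"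
    using j uj by (simp add: sum.remove[of "{..<length gs}" j])
  have "Const (1 / ?c) * Const ?c = 1" using nz by (simp flip: Const_simps(6))
  then have "gs ! j = Const (1 / ?c) *s (Const ?c *s gs ! j)" by (simp add: vec_eq_iff flip: mult.assoc)
  also have "Const ?c *s gs ! j = - (\<Sum>k\<in>{..<length gs} - {j}. ?u k *s gs ! k)"
    using sum by (simp add: eq_neg_iff_add_eq_0)
  finally have eq: "gs ! j = Const (1 / ?c) *s (- (\<Sum>k\<in>{..<length gs} - {j}. ?u k *s gs ! k))" .
  let ?G = "set gs - {gs ! j}"
  have "gs ! j \<in> S3.span ?G"
    unfolding eq
  proof (intro S3.span_scale S3.span_neg S3.span_sum S3.span_base)
    fix k assume "k \<in> {..<length gs} - {j}"
    then show "gs ! k \<in> set gs - {Const (1 / ?c) *s (- (\<Sum>k\<in>{..<length gs} - {j}. ?u k *s gs ! k))}"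
      unfolding eq[symmetric] using assms(2) j by (auto simp: nth_eq_iff_index_eq)
  qed
  then have "set gs \<subseteq> S3.span ?G" by (auto intro: S3.span_base)
  then have "S3.span (set gs) \<subseteq> S3.span ?G" by (rule S3.span_minimal[OF _ S3.subspace_span])
  moreover have "S3.span ?G \<subseteq> S3.span (set gs)" by (rule S3.span_mono) blast
  ultimately have eq: "S3.span ?G = S3.span (set gs)" by (rule equalityI[rotated])
  have N: "S3.span (set gs) = N" using assms(1) unfolding minimal_generators_def by blast
  have "?G \<subset> set gs" using nth_mem[OF j] by blast
  then have "S3.span ?G \<noteq> N" using assms(1) unfolding minimal_generators_def by blast
  then show False unfolding eq N by (rule notE) (rule refl)
qed

lemma degree_sequence_exists:
  assumes res: "AR_resolution f ds es g B" and min: "minimal_family (length ds) g" and "sorted ds"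
  shows "is_degree_sequence (AR f) ds"
proof -
  let ?n = "length ds" and ?gs = "map g [0..<length ds]"
  have single: "(\<Sum>k<?n. (if k = i then p else 0) *s g k) = p *s g i" if "i < ?n" for i p
    using that by (simp add: vec_eq_iff mult_delta_left)
  have independent: "i \<in> A" if A: "A \<subseteq> {..<?n}" and i: "i < ?n" and gi: "g i \<in> S3.span (g ` A)" for A i
  proof (rule ccontr)
    assume "i \<notin> A"
    obtain u where u: "g i = (\<Sum>y\<in>g ` A. u y *s y)"
      using gi finite_subset[OF A] by (auto simp: S3.span_finite)
    obtain A' where A': "A' \<subseteq> A" "inj_on g A'" "g ` A = g ` A'" by (metis subset_image_inj subset_refl)
    let ?t = "\<lambda>k. (if k = i then 1 else 0) - (if k \<in> A' then u (g k) else 0)"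
    have "(\<Sum>k<?n. (if k \<in> A' then u (g k) else 0) *s g k) = (\<Sum>k\<in>A'. u (g k) *s g k)"
      using A'(1) A by (intro sum.mono_neutral_cong_right) auto
    also have "\<dots> = g i" unfolding u A'(3) by (simp add: sum.reindex[OF A'(2)])
    finally have "(\<Sum>k<?n. ?t k *s g k) = 0"
      using single[OF i, of 1] by (simp add: vec_eq_iff left_diff_distrib sum_subtractf)
    then have "lookup (?t i) 0 = 0" by (rule min[unfolded minimal_family_def, rule_format, OF _ i])
    moreover have "i \<notin> A'" using \<open>i \<notin> A\<close> A'(1) by blast
    ultimately show False by simp
  qed
  have inj: "inj_on g {..<?n}"
  proof (rule inj_onI)
    fix i j assume "i \<in> {..<?n}" "j \<in> {..<?n}" "g i = g j"
    then show "i = j" using independent[of "{j}" i] S3.span_base[of "g j" "{g j}"] by auto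
  qed
  have AR: "AR f = range (\<lambda>t. \<Sum>i<?n. t i *s g i)" using res by (simp add: AR_resolution_def)
  have set: "set ?gs = g ` {..<?n}" by auto
  have span: "S3.span (set ?gs) = AR f"
  proof
    show "S3.span (set ?gs) \<subseteq> AR f"
    proof -
      have "(\<Sum>k<length ?gs. t k *s ?gs ! k) = (\<Sum>i<?n. t i *s g i)" for t by (intro sum.cong) auto
      then show ?thesis using span_list[of ?gs] unfolding AR by (simp only:)
    qed
    show "AR f \<subseteq> S3.span (set ?gs)"
      unfolding AR set
    proof (intro image_subsetI combination_in_span)
      show "g k \<in> S3.span (g ` {..<?n})" if "k < ?n" for k
        using that by (intro S3.span_base) simp
    qed
  qed
  have "minimal_generators (AR f) (set ?gs)"
    unfolding minimal_generators_def
  proof (intro conjI allI impI span notI)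
    fix G' assume G': "G' \<subset> set ?gs" "S3.span G' = AR f"
    then obtain i where i: "i < ?n" "g i \<notin> G'" unfolding set by blast
    define A where "A = {k. k < ?n \<and> g k \<in> G'}"
    have "G' = g ` A" using G'(1) unfolding set A_def by blast
    moreover have "g i \<in> AR f" unfolding span[symmetric] set using i by (intro S3.span_base) auto
    ultimately have "i \<in> A" using independent[of A i] i G'(2) by (auto simp: A_def)
    then show False using i by (simp add: A_def)
  qed
  moreover have "distinct ?gs" using inj by (simp add: distinct_map atLeast0LessThan)
  moreover have "list_all2 (\<lambda>d g. \<forall>i. homogeneous d (g $ i)) ds ?gs"
    using res by (auto simp: list_all2_conv_all_nth AR_resolution_def)
  ultimately show ?thesis unfolding is_degree_sequence_def using assms(3) by blast
qed

lemma degree_sequence_unique: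
  assumes "is_degree_sequence N ds" "is_degree_sequence N ds'"
  shows "ds = ds'"
proof -
  have family: "\<exists>gs. length gs = length ds \<and> minimal_family (length ds) ((!) gs) \<and>
      (\<forall>j<length ds. hom3 (map int ds ! j) (gs ! j)) \<and> (\<forall>j<length ds. gs ! j \<in> N) \<and>
      N \<subseteq> range (\<lambda>t. \<Sum>k<length ds. t k *s gs ! k)" if ds: "is_degree_sequence N ds" for ds
  proof -
    obtain gs where gs: "distinct gs" "minimal_generators N (set gs)"
      "list_all2 (\<lambda>d g. \<forall>i. homogeneous d (g $ i)) ds gs"
      using ds unfolding is_degree_sequence_def by blast
    have len: "length gs = length ds" using gs(3) by (simp add: list_all2_lengthD)
    have hom: "hom3 (map int ds ! j) (gs ! j)" if "j < length ds" for j
      using gs(3) that by (simp add: hom3_def list_all2_conv_all_nth)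
    have N: "S3.span (set gs) = N" using gs(2) by (simp add: minimal_generators_def)
    have "minimal_family (length ds) ((!) gs)"
      using minimal_generators_minimal_family[OF gs(2,1), of "(!) (map int ds)"] hom len by simp
    moreover have "gs ! j \<in> N" if "j < length ds" for j
      unfolding N[symmetric] using that len by (intro S3.span_base) simp
    moreover have "N \<subseteq> range (\<lambda>t. \<Sum>k<length ds. t k *s gs ! k)"
      using span_list[of gs] unfolding N len .
    ultimately show ?thesis using len hom by blast
  qed
  obtain gs where gs: "minimal_family (length ds) ((!) gs)" "\<forall>j<length ds. hom3 (map int ds ! j) (gs ! j)"
      "\<forall>j<length ds. gs ! j \<in> N" "N \<subseteq> range (\<lambda>t. \<Sum>k<length ds. t k *s gs ! k)"
    using family[OF assms(1)] by blast
  obtain gs' where gs': "minimal_family (length ds') ((!) gs')" "\<forall>j<length ds'. hom3 (map int ds' ! j) (gs' ! j)"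
      "\<forall>j<length ds'. gs' ! j \<in> N" "N \<subseteq> range (\<lambda>t. \<Sum>k<length ds'. t k *s gs' ! k)"
    using family[OF assms(2)] by blast
  have "count_list (map int ds) (int d) = count_list (map int ds') (int d)" for d
    by (rule minimal_families_same_degrees[where g = "(!) gs" and g' = "(!) gs'"])
      (use gs gs' in \<open>auto simp: subset_iff\<close>)
  moreover have "count_list (map int xs) (int d) = count_list xs d" for xs d
    by (induction xs) auto
  ultimately have "mset ds = mset ds'" by (intro multiset_eqI) (simp add: count_mset)
  moreover have "sorted ds" "sorted ds'" using assms by (auto simp: is_degree_sequence_def)
  ultimately show ?thesis by (metis properties_for_sort sorted_sort_id)
qed

subsection \<open>Resolving the Milnor algebra\<close>

definition idx :: "nat \<Rightarrow> 3" where
  "idx i = (if i = 0 then 1 else if i = 1 then 2 else 3)"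

definition vec3 :: "(nat \<Rightarrow> S) \<Rightarrow> S^3" where
  "vec3 v = vector [v 0, v 1, v 2]"

lemma vec3_nth: "i < 3 \<Longrightarrow> vec3 v $ idx i = v i"
  unfolding less_3_cases by (auto simp: vec3_def idx_def vector_3)

lemma sum_idx: "(\<Sum>i\<in>UNIV. h (i::3)) = (\<Sum>i<3. h (idx i))"
  by (simp add: sum_3 sum_lessThan_3 idx_def)

lemma all_idx: "(\<forall>c::3. R c) \<longleftrightarrow> (\<forall>i<3. R (idx i))"
  unfolding forall_3 less_3_cases by (auto simp: idx_def)

lemma vec3_cong_nth: "(\<And>i. i < 3 \<Longrightarrow> u $ idx i = w $ idx i) \<Longrightarrow> (u::S^3) = w"
  by (simp add: vec_eq_iff all_idx)

lemma AR_iff: "u \<in> AR f \<longleftrightarrow> (\<Sum>i<3. u $ idx i * pd (idx i) f) = 0"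
  by (simp add: AR_def sum_idx)

lemma jacobian_ideal_iff: "p \<in> jacobian_ideal f \<longleftrightarrow> (\<exists>t. p = (\<Sum>i<3. t i * pd (idx i) f))"
proof
  assume "p \<in> jacobian_ideal f"
  then obtain r where "p = (\<Sum>i\<in>UNIV. r i * pd i f)" by (auto simp: jacobian_ideal_def)
  then have "p = (\<Sum>i<3. r (idx i) * pd (idx i) f)" by (simp add: sum_idx)
  then show "\<exists>t. p = (\<Sum>i<3. t i * pd (idx i) f)" by (rule exI[of _ "\<lambda>i. r (idx i)"])
next
  assume "\<exists>t. p = (\<Sum>i<3. t i * pd (idx i) f)"
  then obtain t where t: "p = (\<Sum>i<3. t i * pd (idx i) f)" by blast
  have "p = (\<Sum>c\<in>UNIV. vec3 t $ c * pd c f)"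
    unfolding t sum_idx by (intro sum.cong refl) (simp add: vec3_nth)
  then show "p \<in> jacobian_ideal f" unfolding jacobian_ideal_def by (intro CollectI exI[of _ "($) (vec3 t)"]) simp
qed

lemma jacobian_ideal_mult: "p \<in> jacobian_ideal f \<Longrightarrow> p * q \<in> jacobian_ideal f"
proof -
  assume "p \<in> jacobian_ideal f"
  then obtain t where "p = (\<Sum>i<3. t i * pd (idx i) f)" unfolding jacobian_ideal_iff by blast
  then have "p * q = (\<Sum>i<3. (q * t i) * pd (idx i) f)" by (simp add: sum_distrib_left sum_distrib_right ac_simps)
  then show ?thesis unfolding jacobian_ideal_iff by (rule exI[of _ "\<lambda>i. q * t i"])
qed

lemma jacobian_ideal_0: "0 \<in> jacobian_ideal f"
  unfolding jacobian_ideal_iff by (rule exI[of _ "\<lambda>_. 0"]) simp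

lemma image_apply_matrix:
  "apply_matrix ds es A ` free_elems ds = range (apply_matrix ds es A)"
proof
  show "range (apply_matrix ds es A) \<subseteq> apply_matrix ds es A ` free_elems ds"
  proof
    fix w assume "w \<in> range (apply_matrix ds es A)"
    then obtain v where w: "w = apply_matrix ds es A v" by blast
    let ?v = "\<lambda>j. if j < length ds then v j else 0"
    have "w = apply_matrix ds es A ?v" unfolding w apply_matrix_def by (intro ext) simp
    moreover have "?v \<in> free_elems ds" by (simp add: free_elems_def)
    ultimately show "w \<in> apply_matrix ds es A ` free_elems ds" by (rule image_eqI)
  qed
qed blast

lemma apply_matrix_eq_0_iff:
  "apply_matrix ds es A v = (\<lambda>_. 0) \<longleftrightarrow> (\<forall>k<length es. (\<Sum>j<length ds. A k j * v j) = 0)"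
  by (auto simp: apply_matrix_def fun_eq_iff)

lemma in_range_apply_matrix:
  assumes "v \<in> free_elems es"
  shows "v \<in> range (apply_matrix ds es A) \<longleftrightarrow> (\<exists>t. \<forall>k<length es. v k = (\<Sum>j<length ds. A k j * t j))"
proof -
  have "v = apply_matrix ds es A t \<longleftrightarrow> (\<forall>k<length es. v k = (\<Sum>j<length ds. A k j * t j))" for t
    using assms by (auto simp: apply_matrix_def fun_eq_iff free_elems_def)
  then show ?thesis by auto
qed

lemma range_apply_matrix_subset: "range (apply_matrix ds es A) \<subseteq> free_elems es"
  by (auto simp: apply_matrix_def free_elems_def)

lemma exactI:
  assumes "\<And>v. v \<in> free_elems es \<Longrightarrow> R v \<longleftrightarrow> (\<exists>t. \<forall>k<length es. v k = (\<Sum>j<length ds. A k j * t j))"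
  shows "{v \<in> free_elems es. R v} = apply_matrix ds es A ` free_elems ds"
proof (rule set_eqI)
  fix v
  show "v \<in> {v \<in> free_elems es. R v} \<longleftrightarrow> v \<in> apply_matrix ds es A ` free_elems ds"
  proof (cases "v \<in> free_elems es")
    case True
    then show ?thesis using assms[OF True] in_range_apply_matrix[OF True, of ds A]
      by (simp add: image_apply_matrix)
  next
    case False
    then show ?thesis using range_apply_matrix_subset[of ds es A] unfolding image_apply_matrix by fast
  qed
qed

lemma AR_resolution_betti_table:
  assumes res: "AR_resolution f ds es g B"
    and min: "\<And>i c. i < length ds \<Longrightarrow> c < length es \<Longrightarrow> lookup (B i c) 0 = 0"
    and f: "homogeneous 10 f" and pos: "\<And>i. i < length ds \<Longrightarrow> 0 < ds ! i"
  shows "\<exists>\<beta>. is_betti_table (jacobian_ideal f) \<beta>"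
proof -
  define F :: "nat \<Rightarrow> int list" where
    "F i = (if i = 0 then [0] else if i = 1 then [9, 9, 9] else if i = 2 then map (\<lambda>d. int d + 9) ds
      else if i = 3 then map (\<lambda>d. int d + 9) es else [])" for i
  define A where "A i k j = (if i = 0 then pd (idx j) f else if i = 1 then g j $ idx k
      else if i = 2 then B k j else 0)" for i k j :: nat
  have F_simps: "F 0 = [0]" "F 1 = [9, 9, 9]" "F (Suc 0) = [9, 9, 9]" "F 2 = map (\<lambda>d. int d + 9) ds"
    "F (Suc (Suc 0)) = map (\<lambda>d. int d + 9) ds" "F 3 = map (\<lambda>d. int d + 9) es"
    "F (Suc 2) = map (\<lambda>d. int d + 9) es" "F (Suc (Suc (Suc 0))) = map (\<lambda>d. int d + 9) es"
    "\<And>i. F (Suc (Suc (Suc (Suc i)))) = []"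
    by (simp_all add: F_def)
  have cases4: "i = 0 \<or> i = 1 \<or> i = 2 \<or> (\<exists>m. i = Suc (Suc (Suc m)))" for i
    by (metis One_nat_def Suc_1 not0_implies_Suc)
  have pd9: "homogeneous 9 (pd c f)" for c using homogeneous_pd[of 9 f c] f by simp
  have nine: "[9, 9, 9] ! k = (9::int)" if "k < 3" for k using that unfolding less_3_cases by auto
  have graded: "graded_matrix (F (Suc i)) (F i) (A i)" for i
    using cases4[of i]
  proof (elim disjE exE)
    assume "i = 0"
    then show ?thesis using pd9 nine homogeneous_int_int[of 9]
      by (auto simp: graded_matrix_def F_simps A_def)
  next
    assume "i = 1"
    then show ?thesis using res nine
      by (auto simp: graded_matrix_def F_simps A_def AR_resolution_def)
  next
    assume "i = 2"
    then show ?thesis using res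
      by (auto simp: graded_matrix_def F_simps A_def AR_resolution_def)
  qed (auto simp: graded_matrix_def F_simps A_def)
  have ex0: "{v \<in> free_elems (F 0). (\<Sum>j<length (F 0). v j * 1) \<in> jacobian_ideal f} =
       apply_matrix (F 1) (F 0) (A 0) ` free_elems (F 1)"
    by (rule exactI) (simp add: F_simps jacobian_ideal_iff A_def mult.commute numeral_3_eq_3)
  have ex: "{v \<in> free_elems (F (Suc i)). apply_matrix (F (Suc i)) (F i) (A i) v = (\<lambda>_. 0)} =
       apply_matrix (F (Suc (Suc i))) (F (Suc i)) (A (Suc i)) ` free_elems (F (Suc (Suc i)))" for i
  proof (rule exactI)
    fix v assume v: "v \<in> free_elems (F (Suc i))"
    show "apply_matrix (F (Suc i)) (F i) (A i) v = (\<lambda>_. 0) \<longleftrightarrow>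
      (\<exists>t. \<forall>k<length (F (Suc i)). v k = (\<Sum>j<length (F (Suc (Suc i))). A (Suc i) k j * t j))"
      using cases4[of i]
    proof (elim disjE exE)
      assume i: "i = 0"
      have "apply_matrix (F (Suc i)) (F i) (A i) v = (\<lambda>_. 0) \<longleftrightarrow> vec3 v \<in> AR f"
        by (simp add: apply_matrix_eq_0_iff i F_simps A_def AR_iff vec3_nth mult.commute numeral_3_eq_3)
      also have "\<dots> \<longleftrightarrow> (\<exists>t. vec3 v = (\<Sum>j<length ds. t j *s g j))"
        using res unfolding AR_resolution_def by auto
      also have "\<dots> \<longleftrightarrow> (\<exists>t. \<forall>k<3. v k = (\<Sum>j<length ds. g j $ idx k * t j))"
        by (simp add: vec_eq_iff all_idx vec3_nth mult.commute)
      finally show ?thesis by (simp add: i F_simps A_def numeral_3_eq_3)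
    next
      assume i: "i = 1"
      have "apply_matrix (F (Suc i)) (F i) (A i) v = (\<lambda>_. 0) \<longleftrightarrow> (\<Sum>j<length ds. v j *s g j) = 0"
        by (simp add: apply_matrix_eq_0_iff i F_simps A_def vec_eq_iff all_idx mult.commute numeral_3_eq_3)
      then show ?thesis using res by (simp add: i F_simps A_def AR_resolution_def)
    next
      assume i: "i = 2"
      have "apply_matrix (F (Suc i)) (F i) (A i) v = (\<lambda>_. 0) \<longleftrightarrow>
          (\<forall>k<length ds. (\<Sum>c<length es. B k c * v c) = 0)"
        by (simp add: apply_matrix_eq_0_iff i F_simps A_def)
      also have "\<dots> \<longleftrightarrow> (\<forall>c<length es. v c = 0)"
        using res unfolding AR_resolution_def by auto
      finally show ?thesis by (simp add: i F_simps A_def)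
    qed (use v in \<open>auto simp: F_simps A_def apply_matrix_eq_0_iff\<close>)
  qed
  have "minimal_free_resolution (jacobian_ideal f) F A (\<lambda>_. 1)"
    unfolding minimal_free_resolution_def
  proof (intro conjI allI impI graded ex0 ex)
    show "homogeneous_int (F 0 ! j) 1" if "j < length (F 0)" for j
      using that homogeneous_int_Const[of 1] by (simp add: F_simps)
    show "\<exists>v\<in>free_elems (F 0). p - (\<Sum>j<length (F 0). v j * 1) \<in> jacobian_ideal f" for p
      by (rule bexI[of _ "\<lambda>j. if j = 0 then p else 0"])
        (simp_all add: F_simps free_elems_def jacobian_ideal_0)
    show "lookup (A i k j) 0 = 0" if "k < length (F i)" "j < length (F (Suc i))" for i k j
      using cases4[of i]
    proof (elim disjE exE)
      assume "i = 0"
      then show ?thesis using lookup_0_homogeneous[OF pd9] by (simp add: A_def)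
    next
      assume "i = 1"
      then show ?thesis
        using that res pos[of j] lookup_0_homogeneous[of "ds ! j" "g j $ idx k"]
        by (simp add: A_def F_simps AR_resolution_def)
    next
      assume "i = 2"
      then show ?thesis using that min by (simp add: A_def F_simps)
    qed (use that in \<open>simp add: F_simps\<close>)
  qed
  then show ?thesis unfolding is_betti_table_def by blast
qed

text \<open>
  In any minimal resolution of \<open>S / J\<close> the first two modules are forced: \<open>F\<^sub>0 = S\<close>, as a
  constant must be hit and one generator suffices, and \<open>F\<^sub>1 = S(-9)\<^sup>3\<close> as the three partial
  derivatives generate \<open>J\<close> minimally. All three have the same degree, so the two bases of
  \<open>F\<^sub>1\<close> differ by an invertible constant matrix. It carries the kernel of the next map to the
  module of Jacobian relations, and minimal generators to minimal generators.
\<close>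

lemma betti_numbers_2:
  assumes res: "AR_resolution f ds es g B"
    and min: "\<And>i c. i < length ds \<Longrightarrow> c < length es \<Longrightarrow> lookup (B i c) 0 = 0"
    and f: "homogeneous 10 f" and pos: "\<And>i. i < length ds \<Longrightarrow> 0 < ds ! i"
    and mfr: "minimal_free_resolution (jacobian_ideal f) F A e"
  shows "count_list (F 2) (int d + 9) = count_list ds d"
proof -
  let ?J = "jacobian_ideal f"
  have pd9: "homogeneous 9 (pd c f)" for c using homogeneous_pd[of 9 f c] f by simp
  have J0: "lookup p 0 = 0" if "p \<in> ?J" for p
    using that lookup_0_homogeneous[OF pd9] unfolding jacobian_ideal_iff
    by (auto simp: lookup_sum lookup_0_mult)
  have m1: "\<forall>i. graded_matrix (F (Suc i)) (F i) (A i)"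
    and m2: "\<forall>j<length (F 0). homogeneous_int (F 0 ! j) (e j)"
    and m3: "\<forall>p. \<exists>v\<in>free_elems (F 0). p - (\<Sum>j<length (F 0). v j * e j) \<in> ?J"
    and m4: "{v \<in> free_elems (F 0). (\<Sum>j<length (F 0). v j * e j) \<in> ?J} =
       apply_matrix (F 1) (F 0) (A 0) ` free_elems (F 1)"
    and m5: "\<forall>i. {v \<in> free_elems (F (Suc i)). apply_matrix (F (Suc i)) (F i) (A i) v = (\<lambda>_. 0)} =
       apply_matrix (F (Suc (Suc i))) (F (Suc i)) (A (Suc i)) ` free_elems (F (Suc (Suc i)))"
    and m6: "\<forall>i. \<forall>k<length (F i). \<forall>j<length (F (Suc i)). lookup (A i k j) 0 = 0"
    using mfr unfolding minimal_free_resolution_def by - (elim conjE; assumption)+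
  have graded: "homogeneous_int (F (Suc i) ! j - F i ! k) (A i k j)"
    if "k < length (F i)" "j < length (F (Suc i))" for i k j
    using m1[unfolded graded_matrix_def, rule_format, OF that] .
  have const_free: "lookup (A i k j) 0 = 0" if "k < length (F i)" "j < length (F (Suc i))" for i k j
    using m6[rule_format, OF that] .
  have hom_e: "homogeneous_int (F 0 ! j) (e j)" if "j < length (F 0)" for j
    using m2[rule_format, OF that] .
  have surj: "\<exists>v\<in>free_elems (F 0). p - (\<Sum>j<length (F 0). v j * e j) \<in> ?J" for p
    using m3 by (rule spec)
  have exact0: "(\<Sum>j<length (F 0). v j * e j) \<in> ?J \<longleftrightarrow>
      (\<exists>t. \<forall>k<length (F 0). v k = (\<Sum>j<length (F 1). A 0 k j * t j))" if "v \<in> free_elems (F 0)" for v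
  proof -
    have "{v \<in> free_elems (F 0). (\<Sum>j<length (F 0). v j * e j) \<in> ?J} = range (apply_matrix (F 1) (F 0) (A 0))"
      using m4 unfolding image_apply_matrix .
    then have "(\<Sum>j<length (F 0). v j * e j) \<in> ?J \<longleftrightarrow> v \<in> range (apply_matrix (F 1) (F 0) (A 0))"
      using that by fast
    then show ?thesis unfolding in_range_apply_matrix[OF that] .
  qed
  have exact: "(\<forall>k<length (F i). (\<Sum>j<length (F (Suc i)). A i k j * v j) = 0) \<longleftrightarrow>
      (\<exists>t. \<forall>k<length (F (Suc i)). v k = (\<Sum>j<length (F (Suc (Suc i))). A (Suc i) k j * t j))" for v i
  proof -
    let ?v = "\<lambda>j. if j < length (F (Suc i)) then v j else 0"
    have free: "?v \<in> free_elems (F (Suc i))" by (simp add: free_elems_def)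
    have "{v \<in> free_elems (F (Suc i)). apply_matrix (F (Suc i)) (F i) (A i) v = (\<lambda>_. 0)} =
       range (apply_matrix (F (Suc (Suc i))) (F (Suc i)) (A (Suc i)))"
      using m5[rule_format, of i] unfolding image_apply_matrix .
    then have "apply_matrix (F (Suc i)) (F i) (A i) ?v = (\<lambda>_. 0) \<longleftrightarrow>
      ?v \<in> range (apply_matrix (F (Suc (Suc i))) (F (Suc i)) (A (Suc i)))"
      using free by fast
    then have "apply_matrix (F (Suc i)) (F i) (A i) ?v = (\<lambda>_. 0) \<longleftrightarrow>
      (\<exists>t. \<forall>k<length (F (Suc i)). ?v k = (\<Sum>j<length (F (Suc (Suc i))). A (Suc i) k j * t j))"
      unfolding in_range_apply_matrix[OF free] .
    then show ?thesis by (simp add: apply_matrix_eq_0_iff)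
  qed
  have minimal: "lookup (v k) 0 = 0"
    if v: "\<forall>k<length (F i). (\<Sum>j<length (F (Suc i)). A i k j * v j) = 0" and k: "k < length (F (Suc i))" for v i k
  proof -
    obtain t where "\<forall>k<length (F (Suc i)). v k = (\<Sum>j<length (F (Suc (Suc i))). A (Suc i) k j * t j)"
      using v[unfolded exact] by (elim exE)
    then show ?thesis using k const_free by (simp add: lookup_sum lookup_0_mult)
  qed
  obtain v where "1 - (\<Sum>j<length (F 0). v j * e j) \<in> ?J" using surj[of 1] by blast
  from J0[OF this] have one: "(\<Sum>j<length (F 0). lookup (v j) 0 * lookup (e j) 0) = 1"
    by (simp add: lookup_minus lookup_sum lookup_0_mult)
  have "\<exists>j<length (F 0). lookup (e j) 0 \<noteq> 0"
  proof (rule ccontr)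
    assume "\<not> (\<exists>j<length (F 0). lookup (e j) 0 \<noteq> 0)"
    then have "(\<Sum>j<length (F 0). lookup (v j) 0 * lookup (e j) 0) = 0" by (intro sum.neutral) auto
    then show False using one by simp
  qed
  then obtain j0 where j0: "j0 < length (F 0)" "lookup (e j0) 0 \<noteq> 0" by auto
  then have "F 0 ! j0 = 0" using lookup_0_hom hom_e by blast
  define c where "c = lookup (e j0) 0"
  have ej0: "e j0 = Const c" and "c \<noteq> 0"
    using homogeneous_0_imp_Const[of "e j0"] hom_e[OF j0(1)] \<open>F 0 ! j0 = 0\<close> j0(2)
    by (simp_all add: homogeneous_int_iff c_def)
  have only: "j = j0" if j: "j < length (F 0)" for j
  proof (rule ccontr)
    assume "j \<noteq> j0"
    let ?v = "\<lambda>k. (if k = j then Const c else 0) - (if k = j0 then e j else 0)"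
    have "(\<Sum>k<length (F 0). ?v k * e k) = (\<Sum>k<length (F 0). (if k = j then Const c * e j else 0)
        - (if k = j0 then e j * e j0 else 0))"
      by (intro sum.cong refl) (auto simp: left_diff_distrib)
    also have "\<dots> = 0" using j j0(1) by (simp add: sum_subtractf ej0)
    finally have "(\<Sum>k<length (F 0). ?v k * e k) \<in> ?J" using jacobian_ideal_0 by simp
    moreover have "?v \<in> free_elems (F 0)" using j j0(1) by (auto simp: free_elems_def)
    ultimately obtain t where "\<forall>k<length (F 0). ?v k = (\<Sum>j<length (F 1). A 0 k j * t j)"
      using exact0 by blast
    then have "?v j = (\<Sum>i<length (F 1). A 0 j i * t i)" using j by blast
    then have "lookup (?v j) 0 = 0" using j const_free[of j 0] by (simp add: lookup_sum lookup_0_mult)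
    then show False using \<open>j \<noteq> j0\<close> \<open>c \<noteq> 0\<close> by (simp add: lookup_Const)
  qed
  have len0: "length (F 0) = 1"
  proof (rule ccontr)
    assume "length (F 0) \<noteq> 1"
    then have "0 < length (F 0)" "1 < length (F 0)" using j0(1) by linarith+
    then show False using only[of 0] only[of 1] by simp
  qed
  then have j00: "j0 = 0" and F00: "F 0 ! 0 = 0" using j0(1) \<open>F 0 ! j0 = 0\<close> by simp_all
  let ?n1 = "length (F 1)" and ?\<alpha> = "\<lambda>j. A 0 0 j"
  have J_iff: "p \<in> ?J \<longleftrightarrow> (\<exists>t. p = (\<Sum>j<?n1. ?\<alpha> j * t j))" for p
  proof -
    let ?v = "\<lambda>k::nat. if k = 0 then p else 0"
    have "?v \<in> free_elems (F 0)" by (simp add: free_elems_def len0)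
    from exact0[OF this] have "p * Const c \<in> ?J \<longleftrightarrow> (\<exists>t. p = (\<Sum>j<?n1. ?\<alpha> j * t j))"
      using ej0 by (simp add: len0 j00)
    moreover have "p = p * Const c * Const (1 / c)" using \<open>c \<noteq> 0\<close> by (simp add: mult.assoc flip: Const_simps(6))
    ultimately show ?thesis using jacobian_ideal_mult by metis
  qed
  let ?\<gamma> = "\<lambda>j. vec3 (\<lambda>i. if i = 0 then ?\<alpha> j else 0)"
  let ?\<delta> = "\<lambda>j. vec3 (\<lambda>i. if i = 0 then pd (idx j) f else 0)"
  have nine: "[9, 9, 9] ! k = (9::int)" if "k < 3" for k using that unfolding less_3_cases by auto
  have vec3_sum: "(\<Sum>j<n. t j *s vec3 (\<lambda>i. if i = 0 then x j else 0)) = vec3 (\<lambda>i. if i = 0 then \<Sum>j<n. x j * t j else 0)"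
    for n :: nat and t x
    by (rule vec3_cong_nth) (simp add: vec3_nth mult.commute)
  have vec3_inj: "vec3 (\<lambda>i. if i = 0 then p else 0) = vec3 (\<lambda>i. if i = 0 then q else 0) \<longleftrightarrow> p = q" for p q
  proof
    assume "vec3 (\<lambda>i. if i = 0 then p else 0) = vec3 (\<lambda>i. if i = 0 then q else 0)"
    from arg_cong[OF this, of "\<lambda>u. u $ idx 0"] show "p = q" by (simp add: vec3_nth)
  qed (simp only:)
  have vec3_0: "vec3 (\<lambda>i. if i = 0 then 0 else 0) = 0"
    by (rule vec3_cong_nth) (simp add: vec3_nth)
  have hom_\<gamma>: "hom3 (F 1 ! j) (?\<gamma> j)" if "j < ?n1" for j
    using graded[of 0 0 j] that by (simp add: hom3_def all_idx vec3_nth len0 F00)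
  have hom_\<delta>: "hom3 ([9, 9, 9] ! j) (?\<delta> j)" if "j < 3" for j
    using pd9 homogeneous_int_int[of 9] that by (simp add: hom3_def all_idx vec3_nth nine)
  have min_\<gamma>: "minimal_family ?n1 ?\<gamma>"
    unfolding minimal_family_def
  proof (intro allI impI)
    fix t j assume "(\<Sum>j<?n1. t j *s ?\<gamma> j) = 0" and j: "j < ?n1"
    then have "vec3 (\<lambda>i. if i = 0 then \<Sum>j<?n1. ?\<alpha> j * t j else 0) = vec3 (\<lambda>i. if i = 0 then 0 else 0)"
      unfolding vec3_sum vec3_0 by simp
    then have "(\<Sum>j<?n1. ?\<alpha> j * t j) = 0" unfolding vec3_inj .
    then show "lookup (t j) 0 = 0" using minimal[of 0 t j] j len0 by simp
  qed
  have min_pd: "lookup (t k) 0 = 0" if t: "(\<Sum>k<3. pd (idx k) f * t k) = 0" and k: "k < 3" for t k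
  proof -
    have "vec3 t \<in> AR f" unfolding AR_iff using t by (simp add: vec3_nth mult.commute)
    then obtain u where "vec3 t = (\<Sum>j<length ds. u j *s g j)" using res unfolding AR_resolution_def by auto
    from arg_cong[OF this, of "\<lambda>x. x $ idx k"] have "t k = (\<Sum>j<length ds. u j * g j $ idx k)"
      using k by (simp add: vec3_nth)
    moreover have "lookup (g j $ idx k) 0 = 0" if "j < length ds" for j
      using res pos[OF that] that lookup_0_homogeneous[of "ds ! j" "g j $ idx k"] unfolding AR_resolution_def by simp
    ultimately show ?thesis by (simp add: lookup_sum lookup_0_mult)
  qed
  have min_\<delta>: "minimal_family 3 ?\<delta>"
    unfolding minimal_family_def
  proof (intro allI impI)
    fix t j assume "(\<Sum>j<3. t j *s ?\<delta> j) = 0" and j: "j < (3::nat)"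
    then have "vec3 (\<lambda>i. if i = 0 then \<Sum>j<3. pd (idx j) f * t j else 0) = vec3 (\<lambda>i. if i = 0 then 0 else 0)"
      unfolding vec3_sum vec3_0 by simp
    then have "(\<Sum>j<3. pd (idx j) f * t j) = 0" unfolding vec3_inj .
    then show "lookup (t j) 0 = 0" using j by (rule min_pd)
  qed
  have \<delta>_gen: "?\<delta> k \<in> range (\<lambda>t. \<Sum>j<?n1. t j *s ?\<gamma> j)" if "k < 3" for k
  proof -
    have "pd (idx k) f = (\<Sum>i<3. (if i = k then 1 else 0) * pd (idx i) f)" using that by (simp add: mult_delta_left)
    then have "pd (idx k) f \<in> ?J" unfolding jacobian_ideal_iff
      by (rule exI[of _ "\<lambda>i. if i = k then 1 else 0"])
    then obtain t where "pd (idx k) f = (\<Sum>j<?n1. ?\<alpha> j * t j)" unfolding J_iff by (elim exE)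
    then have "?\<delta> k = (\<Sum>j<?n1. t j *s ?\<gamma> j)" unfolding vec3_sum vec3_inj .
    then show ?thesis by (intro range_eqI[where x = t])
  qed
  have \<gamma>_gen: "?\<gamma> k \<in> range (\<lambda>t. \<Sum>j<3. t j *s ?\<delta> j)" if "k < ?n1" for k
  proof -
    have "?\<alpha> k = (\<Sum>i<?n1. ?\<alpha> i * (if i = k then 1 else 0))" using that by (simp add: mult_delta_right)
    then have "?\<alpha> k \<in> ?J" unfolding J_iff
      by (rule exI[of _ "\<lambda>i. if i = k then 1 else 0"])
    then obtain t where "?\<alpha> k = (\<Sum>j<3. t j * pd (idx j) f)" unfolding jacobian_ideal_iff by (elim exE)
    then have "?\<alpha> k = (\<Sum>j<3. pd (idx j) f * t j)" by (simp add: mult.commute)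
    then have "?\<gamma> k = (\<Sum>j<3. t j *s ?\<delta> j)" unfolding vec3_sum vec3_inj .
    then show ?thesis by (intro range_eqI[where x = t])
  qed
  have len3: "length [9, 9, 9 :: int] = 3" by simp
  have "count_list (F 1) d = count_list [9, 9, 9] d" for d
    by (rule minimal_families_same_degrees[of "F 1" ?\<gamma> "[9, 9, 9]" ?\<delta>, unfolded len3])
      (intro hom_\<gamma> hom_\<delta> \<delta>_gen \<gamma>_gen min_\<gamma> min_\<delta>; assumption)+
  then have ms: "mset (F 1) = mset [9, 9, 9]" by (intro multiset_eqI) (simp only: count_mset)
  have F1: "?n1 = 3" "set (F 1) = {9}"
    using mset_eq_length[OF ms] mset_eq_setD[OF ms] by simp_all
  then have F1_nth: "F 1 ! j = 9" if "j < 3" for j using that nth_mem[of j "F 1"] by simp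
  have "\<exists>P. (\<forall>j<?n1. \<forall>k<3. homogeneous_int ([9, 9, 9] ! k - F 1 ! j) (P j k)) \<and>
      (\<forall>k<3. ?\<delta> k = (\<Sum>j<?n1. P j k *s ?\<gamma> j))"
    by (rule graded_coefficients; (rule hom_\<gamma> hom_\<delta> \<delta>_gen)?; assumption)
  then obtain P where P0: "\<forall>j<?n1. \<forall>k<3. homogeneous_int ([9, 9, 9] ! k - F 1 ! j) (P j k)"
      and P2: "\<forall>k<3. ?\<delta> k = (\<Sum>j<?n1. P j k *s ?\<gamma> j)" by (elim exE conjE)
  have P1: "homogeneous_int 0 (P j k)" if "j < 3" "k < 3" for j k
    using P0[rule_format, of j k] that F1(1) F1_nth[OF that(1)] nine[OF that(2)] by simp
  note P = P1 P2[unfolded F1(1)]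
  have "\<exists>Q. (\<forall>j<length [9, 9, 9 :: int]. \<forall>k<?n1. homogeneous_int (F 1 ! k - [9, 9, 9] ! j) (Q j k)) \<and>
      (\<forall>k<?n1. ?\<gamma> k = (\<Sum>j<length [9, 9, 9 :: int]. Q j k *s ?\<delta> j))"
    by (rule graded_coefficients; (unfold len3)?; (rule hom_\<gamma> hom_\<delta> \<gamma>_gen)?; assumption)
  then obtain Q where Q0: "\<forall>j<3. \<forall>k<?n1. homogeneous_int (F 1 ! k - [9, 9, 9] ! j) (Q j k)"
      and Q2: "\<forall>k<?n1. ?\<gamma> k = (\<Sum>j<3. Q j k *s ?\<delta> j)"
    unfolding len3 by (elim exE conjE)
  have Q1: "homogeneous_int 0 (Q j k)" if "j < 3" "k < 3" for j k
    using Q0[rule_format, of j k] that F1(1) F1_nth[OF that(2)] nine[OF that(1)] by simp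
  note Q = Q1 Q2[unfolded F1(1)]
  have pd_P: "pd (idx k) f = (\<Sum>j<3. ?\<alpha> j * P j k)" if "k < 3" for k
    using P(2)[unfolded vec3_sum vec3_inj, rule_format, OF that] .
  have \<alpha>_Q: "?\<alpha> k = (\<Sum>j<3. pd (idx j) f * Q j k)" if "k < 3" for k
    using Q(2)[unfolded vec3_sum vec3_inj, rule_format, OF that] .
  have hom0: "p = (if b then 1 else 0)" if "homogeneous_int 0 p" "lookup p 0 = (if b then 1 else 0)" for p :: S and b
    using homogeneous_0_imp_Const[of p] that by (auto simp: homogeneous_int_iff)
  have PQ: "(\<Sum>k<3. P i k * Q k j) = (if i = j then 1 else 0)" if "i < 3" "j < 3" for i j
  proof (rule hom0)
    show "homogeneous_int 0 (\<Sum>k<3. P i k * Q k j)"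
      by (intro homogeneous_int_sum; rule homogeneous_int_mult[OF P(1) Q(1)]; use that in simp)
    show "lookup (\<Sum>k<3. P i k * Q k j) 0 = (if i = j then 1 else 0)"
      by (rule inverse_constants[OF min_\<gamma>[unfolded F1(1)], of 3 ?\<delta> P Q];
          (rule P(2)[rule_format] Q(2)[rule_format] that)?; assumption?)
  qed
  have QP: "(\<Sum>k<3. Q i k * P k j) = (if i = j then 1 else 0)" if "i < 3" "j < 3" for i j
  proof (rule hom0)
    show "homogeneous_int 0 (\<Sum>k<3. Q i k * P k j)"
      by (intro homogeneous_int_sum; rule homogeneous_int_mult[OF Q(1) P(1)]; use that in simp)
    show "lookup (\<Sum>k<3. Q i k * P k j) 0 = (if i = j then 1 else 0)"
      by (rule inverse_constants[OF min_\<delta>, of 3 ?\<gamma> Q P];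
          (rule P(2)[rule_format] Q(2)[rule_format] that)?; assumption?)
  qed
  have inv: "(\<Sum>j<3. X i j * (\<Sum>k<3. Y j k * w k)) = w i"
    if "\<And>i j. i < 3 \<Longrightarrow> j < 3 \<Longrightarrow> (\<Sum>k<3. X i k * Y k j) = (if i = j then 1 else (0::S))" "i < 3" for X Y :: "nat \<Rightarrow> nat \<Rightarrow> S" and w and i :: nat
  proof -
    have "(\<Sum>j<3. X i j * (\<Sum>k<3. Y j k * w k)) = (\<Sum>k<3. (\<Sum>j<3. X i j * Y j k) * w k)"
      by (simp add: sum_lessThan_3 algebra_simps)
    also have "\<dots> = (\<Sum>k<3. (if i = k then 1 else 0) * w k)" using that by (intro sum.cong refl) simp
    finally show ?thesis using that(2) by (simp add: mult_delta_left)
  qed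
  let ?n2 = "length (F 2)"
  let ?\<epsilon> = "\<lambda>l. vec3 (\<lambda>i. \<Sum>j<3. Q i j * A 1 j l)"
  let ?y = "\<lambda>t j. \<Sum>l<?n2. A 1 j l * t l"
  have \<epsilon>_sum: "(\<Sum>l<?n2. t l *s ?\<epsilon> l) $ idx i = (\<Sum>j<3. Q i j * ?y t j)" if "i < 3" for t i
    using that by (simp add: vec3_nth sum_lessThan_3 sum_distrib_left sum.distrib algebra_simps)
  have hom_\<epsilon>: "hom3 (map (\<lambda>x. x - 9) (F 2) ! l) (?\<epsilon> l)" if "l < ?n2" for l
  proof -
    have "homogeneous_int (F 2 ! l - 9) (Q i j * A 1 j l)" if "i < 3" "j < 3" for i j
      using graded[of j 1 l] that \<open>l < ?n2\<close> F1 F1_nth by (intro homogeneous_int_mult[OF Q(1)]) (auto simp: numeral_2_eq_2)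
    then have "homogeneous_int (F 2 ! l - 9) (\<Sum>j<3. Q i j * A 1 j l)" if "i < 3" for i
      using that by (intro homogeneous_int_sum) simp
    then show ?thesis using \<open>l < ?n2\<close> by (simp add: hom3_def all_idx vec3_nth)
  qed
  have AR_Q: "(\<Sum>i<3. (\<Sum>j<3. Q i j * w j) * pd (idx i) f) = (\<Sum>j<3. ?\<alpha> j * w j)" for w
    by (simp add: \<alpha>_Q sum_lessThan_3 algebra_simps)
  have \<epsilon>_AR: "?\<epsilon> l \<in> AR f" if l: "l < ?n2" for l
  proof -
    have "\<exists>t. \<forall>k<length (F (Suc 0)). A 1 k l = (\<Sum>j<length (F (Suc (Suc 0))). A (Suc 0) k j * t j)"
      using l by (intro exI[of _ "\<lambda>j. if j = l then 1 else 0"]) (simp add: numeral_2_eq_2 mult_delta_right)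
    then have "(\<Sum>j<3. ?\<alpha> j * A 1 j l) = 0"
      using exact[of 0 "\<lambda>k. A 1 k l"] len0 F1(1) by (simp add: numeral_2_eq_2)
    then have "(\<Sum>i<3. (\<Sum>j<3. Q i j * A 1 j l) * pd (idx i) f) = 0" unfolding AR_Q .
    then show ?thesis unfolding AR_iff by (simp add: vec3_nth)
  qed
  have AR_range: "AR f = range (\<lambda>t. \<Sum>i<length ds. t i *s g i)"
    using res by (simp add: AR_resolution_def)
  have min_\<epsilon>: "minimal_family ?n2 ?\<epsilon>"
    unfolding minimal_family_def
  proof (intro allI impI)
    fix t l assume t: "(\<Sum>l<?n2. t l *s ?\<epsilon> l) = 0" and l: "l < ?n2"
    have "(\<Sum>j<3. Q i j * ?y t j) = 0" if "i < 3" for i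
      using \<epsilon>_sum[OF that, of t] unfolding t by simp
    then have "?y t j = 0" if "j < 3" for j
      using inv[OF PQ that, of "?y t"] by simp
    then show "lookup (t l) 0 = 0" using minimal[of 1 t l] l F1(1) by (simp add: numeral_2_eq_2)
  qed
  have g_gen: "g k \<in> range (\<lambda>t. \<Sum>l<?n2. t l *s ?\<epsilon> l)" if k: "k < length ds" for k
  proof -
    have "g k = (\<Sum>i<length ds. (if i = k then 1 else 0) *s g i)"
      using k by (simp add: vec_eq_iff mult_delta_left)
    then have gk: "g k \<in> AR f" unfolding AR_range
      by (rule range_eqI[where x = "\<lambda>i. if i = k then 1 else 0"])
    let ?w = "\<lambda>j. \<Sum>i<3. P j i * g k $ idx i"
    have "(\<Sum>j<3. ?\<alpha> j * ?w j) = (\<Sum>i<3. g k $ idx i * (\<Sum>j<3. ?\<alpha> j * P j i))"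
      by (simp add: sum_lessThan_3 algebra_simps)
    also have "\<dots> = (\<Sum>i<3. g k $ idx i * pd (idx i) f)" by (intro sum.cong refl) (simp add: pd_P)
    also have "\<dots> = 0" using gk by (simp add: AR_iff)
    finally have "\<forall>k<length (F 0). (\<Sum>j<length (F (Suc 0)). A 0 k j * ?w j) = 0"
      using len0 F1(1) by (simp add: numeral_2_eq_2)
    then obtain t where t: "\<forall>k<3. ?w k = ?y t k" using exact[of 0 ?w] F1(1) by (auto simp: numeral_2_eq_2)
    have "g k = (\<Sum>l<?n2. t l *s ?\<epsilon> l)"
    proof (rule vec3_cong_nth)
      fix i :: nat assume i: "i < 3"
      have "(\<Sum>j<3. Q i j * ?y t j) = (\<Sum>j<3. Q i j * ?w j)" by (intro sum.cong refl) (simp add: t)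
      then show "g k $ idx i = (\<Sum>l<?n2. t l *s ?\<epsilon> l) $ idx i"
        unfolding \<epsilon>_sum[OF i] using inv[OF QP i, of "\<lambda>i. g k $ idx i"] by simp
    qed
    then show ?thesis by (intro range_eqI[where x = t])
  qed
  have len_maps: "length (map (\<lambda>x. x - 9) (F 2)) = ?n2" "length (map int ds) = length ds" by simp_all
  have hom_g: "hom3 (map int ds ! k) (g k)" if "k < length ds" for k
    using res that by (simp add: hom3_def AR_resolution_def)
  have \<epsilon>_gen: "?\<epsilon> l \<in> range (\<lambda>t. \<Sum>i<length ds. t i *s g i)" if "l < ?n2" for l
    using \<epsilon>_AR[OF that] unfolding AR_range .
  have "count_list (map (\<lambda>x. x - 9) (F 2)) (int d) = count_list (map int ds) (int d)"
    by (rule minimal_families_same_degrees[of "map (\<lambda>x. x - 9) (F 2)" ?\<epsilon> "map int ds" g, unfolded len_maps])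
      (intro hom_\<epsilon> hom_g \<epsilon>_gen g_gen min_\<epsilon> AR_resolution_minimal[OF res min]; assumption)+
  moreover have "count_list (map (\<lambda>x. x - 9) xs) (int d) = count_list xs (int d + 9)" for xs :: "int list"
    by (induction xs) auto
  moreover have "count_list (map int xs) (int d) = count_list xs d" for xs by (induction xs) auto
  ultimately show ?thesis by simp
qed

section \<open>Hilbert functions\<close>

text \<open>
  The dimension of a subspace in the domain, of its image and of the kernel on it, for the
  \<open>dim\<close> of vector space locales with scalar multiplications that do not come from a type class.
\<close>

lemma rank_nullity:
  fixes s1 :: "'a::field \<Rightarrow> 'b::ab_group_add \<Rightarrow> 'b" and s2 :: "'a \<Rightarrow> 'c::ab_group_add \<Rightarrow> 'c"
  assumes "Vector_Spaces.linear s1 s2 h" "module.subspace s1 U" "finite W" "U \<subseteq> module.span s1 W"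
  shows "vector_space.dim s1 U = vector_space.dim s1 {x \<in> U. h x = 0} + vector_space.dim s2 (h ` U)"
proof -
  interpret Vector_Spaces.linear s1 s2 h by fact
  let ?K = "{x \<in> U. h x = 0}"
  obtain C where C: "C \<subseteq> ?K" "vs1.independent C" "?K \<subseteq> vs1.span C" "card C = vs1.dim ?K"
    using vs1.basis_exists[of ?K] by blast
  obtain E where E: "C \<subseteq> E" "E \<subseteq> U" "vs1.independent E" "U \<subseteq> vs1.span E"
    using vs1.maximal_independent_subset_extend[of C U] C by blast
  have fin: "finite E" using vs1.independent_span_bound[OF assms(3) E(3)] E(2) assms(4) by blast
  let ?D = "E - C"
  have zero: "u d = 0" if u: "(\<Sum>d\<in>?D. s2 (u d) (h d)) = 0" and d: "d \<in> ?D" for u d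
  proof -
    let ?x = "\<Sum>d\<in>?D. s1 (u d) d"
    have "h ?x = 0" using u by (simp add: sum scale)
    moreover have "?x \<in> U"
      using E(2) by (intro vs1.subspace_sum[OF assms(2)] vs1.subspace_scale[OF assms(2)]) auto
    ultimately have "?x \<in> vs1.span C" using C(3) by blast
    then obtain w where w: "?x = (\<Sum>c\<in>C. s1 (w c) c)"
      using finite_subset[OF E(1) fin] by (auto simp: vs1.span_finite)
    have "(\<Sum>e\<in>E. s1 (if e \<in> C then - w e else u e) e)
        = (\<Sum>e\<in>?D. s1 (u e) e) + (\<Sum>e\<in>C. s1 (- w e) e)"
      using fin E(1) by (subst sum.subset_diff[OF E(1) fin]) (auto intro!: arg_cong2[where f = "(+)"] sum.cong)
    also have "\<dots> = 0" by (simp add: w sum_negf)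
    finally have "(if d \<in> C then - w d else u d) = 0"
      using vs1.independentD[OF E(3) fin subset_refl, of "\<lambda>e. if e \<in> C then - w e else u e" d] d by blast
    then show ?thesis using d by simp
  qed
  have inj: "inj_on h ?D"
  proof (rule inj_onI, rule ccontr)
    fix x y assume xy: "x \<in> ?D" "y \<in> ?D" "h x = h y" "x \<noteq> y"
    let ?u = "\<lambda>d. (if d = x then 1 else 0) - (if d = y then 1 else 0) :: 'a"
    have "(\<Sum>d\<in>?D. s2 (?u d) (h d)) = (\<Sum>d\<in>?D. (if d = x then h x else 0) - (if d = y then h y else 0))"
      by (intro sum.cong refl) (auto simp: vs2.scale_left_diff_distrib)
    also have "\<dots> = 0" using xy fin by (simp add: sum_subtractf)
    finally have "?u x = 0" using zero[of ?u x] xy(1) by blast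
    then show False using xy by simp
  qed
  have ind: "vs2.independent (h ` ?D)"
  proof (rule vs2.independent_if_scalars_zero)
    fix u y assume "(\<Sum>y\<in>h ` ?D. s2 (u y) y) = 0" "y \<in> h ` ?D"
    then show "u y = 0" using zero[of "\<lambda>d. u (h d)"] by (auto simp: sum.reindex[OF inj])
  qed (use fin in simp)
  have "h ` U \<subseteq> h ` vs1.span E" using E(4) by blast
  also have "\<dots> = vs2.span (h ` E)" by (simp add: span_image)
  also have "\<dots> \<subseteq> vs2.span (h ` ?D)"
  proof (rule vs2.span_minimal[OF _ vs2.subspace_span])
    show "h ` E \<subseteq> vs2.span (h ` ?D)"
    proof
      fix y assume "y \<in> h ` E"
      then obtain x where x: "x \<in> E" "y = h x" by blast
      show "y \<in> vs2.span (h ` ?D)"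
      proof (cases "x \<in> C")
        case True
        then show ?thesis using C(1) x vs2.span_zero by auto
      next
        case False
        then show ?thesis using x by (intro vs2.span_base) auto
      qed
    qed
  qed
  finally have "card (h ` ?D) = vs2.dim (h ` U)"
    using E(2) ind by (intro vs2.basis_card_eq_dim) auto
  moreover have "card E = vs1.dim U" by (rule vs1.basis_card_eq_dim[OF E(2) E(4) E(3)])
  moreover have "card (h ` ?D) = card E - card C"
    using card_image[OF inj] card_Diff_subset[OF finite_subset[OF E(1) fin] E(1)] by simp
  moreover have "card C \<le> card E" by (rule card_mono[OF fin E(1)])
  ultimately show ?thesis using C(4) by simp
qed

interpretation SV: vector_space "\<lambda>c (p::S). Const c * p"
  by unfold_locales (simp_all add: algebra_simps)

interpretation FV: vector_space "\<lambda>c (t::nat \<Rightarrow> S) i. Const c * t i"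
  by unfold_locales (simp_all add: fun_eq_iff algebra_simps)

lemma sum_fun_apply: "(\<Sum>x\<in>A. g x) i = (\<Sum>x\<in>A. g x (i::nat) :: S)"
  by (induction A rule: infinite_finite_induct) auto

definition homs :: "int \<Rightarrow> S set" where
  "homs d = {p. homogeneous_int d p}"

lemma finite_monomials: "finite {m :: 3 \<Rightarrow>\<^sub>0 nat. mdeg m \<le> k}"
proof (rule finite_subset)
  let ?g = "\<lambda>(a, b, c). single (1::3) a + single 2 b + single 3 (c::nat)"
  show "{m. mdeg m \<le> k} \<subseteq> ?g ` ({..k} \<times> {..k} \<times> {..k})"
  proof
    fix m :: "3 \<Rightarrow>\<^sub>0 nat" assume "m \<in> {m. mdeg m \<le> k}"
    then have "lookup m 1 + lookup m 2 + lookup m 3 \<le> k" by (simp add: mdeg_def sum_3)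
    moreover have "m = ?g (lookup m 1, lookup m 2, lookup m 3)"
    proof (rule poly_mapping_eqI)
      fix i :: 3
      show "lookup m i = lookup (?g (lookup m 1, lookup m 2, lookup m 3)) i"
        using exhaust_3[of i] by (auto simp: lookup_add lookup_single when_def)
    qed
    ultimately show "m \<in> ?g ` ({..k} \<times> {..k} \<times> {..k})" by (intro image_eqI[where x = "(lookup m 1, lookup m 2, lookup m 3)"]) auto
  qed
qed simp

lemma Const_mult_single: "Const c * single m 1 = single m c"
  by (simp add: Const_def mult_single)

lemma homs_finite_dim: "homs d \<subseteq> SV.span ((\<lambda>m. single m 1) ` {m. mdeg m \<le> nat d})"
proof
  fix p assume "p \<in> homs d"
  then have "mdeg m \<le> nat d" if "m \<in> keys p" for m
    using that by (auto simp: homs_def homogeneous_int_def)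
  then have "(\<Sum>m\<in>keys p. Const (lookup p m) * single m 1) \<in> SV.span ((\<lambda>m. single m 1) ` {m. mdeg m \<le> nat d})"
    by (intro SV.span_sum SV.span_scale SV.span_base) auto
  then show "p \<in> SV.span ((\<lambda>m. single m 1) ` {m. mdeg m \<le> nat d})"
    by (simp add: Const_mult_single flip: S_monomials)
qed

definition graded_tuples :: "nat \<Rightarrow> (nat \<Rightarrow> int) \<Rightarrow> int \<Rightarrow> (nat \<Rightarrow> S) set" where
  "graded_tuples n e d = {t. (\<forall>i<n. homogeneous_int (d - e i) (t i)) \<and> (\<forall>i\<ge>n. t i = 0)}"

lemma graded_tuples_subspace: "FV.subspace (graded_tuples n e d)"
  by (auto simp: FV.subspace_def graded_tuples_def intro: homogeneous_int_add
      homogeneous_int_mult[OF homogeneous_int_Const])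

lemma graded_tuples_finite_dim: "\<exists>W. finite W \<and> graded_tuples n e d \<subseteq> FV.span W"
proof -
  let ?emb = "\<lambda>i m j. if j = i then single m 1 else 0 :: S"
  let ?W = "\<Union>i\<in>{..<n}. ?emb i ` {m. mdeg m \<le> nat (d - e i)}"
  have "t \<in> FV.span ?W" if t: "t \<in> graded_tuples n e d" for t
  proof -
    have deg: "mdeg m \<le> nat (d - e i)" if "i < n" "m \<in> keys (t i)" for i m
    proof -
      have "int (mdeg m) = d - e i" using t that unfolding graded_tuples_def homogeneous_int_def by blast
      then show ?thesis by simp
    qed
    have "t = (\<Sum>i<n. \<Sum>m\<in>keys (t i). (\<lambda>j. Const (lookup (t i) m) * ?emb i m j))"
    proof
      fix j
      have "(\<Sum>i<n. \<Sum>m\<in>keys (t i). (\<lambda>j. Const (lookup (t i) m) * ?emb i m j)) j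
          = (\<Sum>i<n. \<Sum>m\<in>keys (t i). Const (lookup (t i) m) * ?emb i m j)"
        by (simp only: sum_fun_apply)
      also have "\<dots> = (\<Sum>i<n. if j = i then t i else 0)"
      proof (intro sum.cong refl)
        fix i
        have "t i = (\<Sum>m\<in>keys (t i). Const (lookup (t i) m) * single m 1)"
          unfolding Const_mult_single by (rule S_monomials)
        then show "(\<Sum>m\<in>keys (t i). Const (lookup (t i) m) * ?emb i m j) = (if j = i then t i else 0)"
          by (cases "j = i") simp_all
      qed
      also have "\<dots> = t j" using t by (auto simp: graded_tuples_def)
      finally show "t j = (\<Sum>i<n. \<Sum>m\<in>keys (t i). (\<lambda>j. Const (lookup (t i) m) * ?emb i m j)) j" by simp
    qed
    moreover have "(\<Sum>i<n. \<Sum>m\<in>keys (t i). (\<lambda>j. Const (lookup (t i) m) * ?emb i m j)) \<in> FV.span ?W"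
      using deg by (intro FV.span_sum FV.span_scale FV.span_base) auto
    ultimately show ?thesis by simp
  qed
  moreover have "finite ?W" using finite_monomials by auto
  ultimately show ?thesis by blast
qed

lemma graded_tuples_rank_nullity:
  assumes "Vector_Spaces.linear (\<lambda>c (t::nat \<Rightarrow> S) i. Const c * t i) s2 h"
  shows "FV.dim (graded_tuples n e d) = FV.dim {t \<in> graded_tuples n e d. h t = 0}
    + vector_space.dim s2 (h ` graded_tuples n e d)"
  using graded_tuples_finite_dim[of n e d] rank_nullity[OF assms graded_tuples_subspace] by blast

definition matrix_map :: "nat \<Rightarrow> nat \<Rightarrow> (nat \<Rightarrow> nat \<Rightarrow> S) \<Rightarrow> (nat \<Rightarrow> S) \<Rightarrow> nat \<Rightarrow> S" where
  "matrix_map n m A t = (\<lambda>i. if i < n then \<Sum>c<m. A i c * t c else 0)"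

lemma matrix_map_linear:
  "Vector_Spaces.linear (\<lambda>c (t::nat \<Rightarrow> S) i. Const c * t i) (\<lambda>c (t::nat \<Rightarrow> S) i. Const c * t i) (matrix_map n m A)"
  by unfold_locales
    (auto simp: matrix_map_def fun_eq_iff algebra_simps sum.distrib sum_distrib_left)

text \<open>
  Exactness on the level of modules passes to the graded pieces, because the homogeneous components
  of a preimage have the homogeneous components as images.
\<close>

lemma matrix_map_image:
  assumes A: "\<And>i c. i < n \<Longrightarrow> c < m \<Longrightarrow> homogeneous_int (e' c - e i) (A i c)"
  shows "matrix_map n m A ` graded_tuples m e' d = {t \<in> graded_tuples n e d. \<exists>s. \<forall>i<n. t i = (\<Sum>c<m. A i c * s c)}"
proof (intro equalityI subsetI)
  fix t assume "t \<in> matrix_map n m A ` graded_tuples m e' d"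
  then obtain s where s: "s \<in> graded_tuples m e' d" "t = matrix_map n m A s" by blast
  have "homogeneous_int (d - e i) (\<Sum>c<m. A i c * s c)" if "i < n" for i
    using s(1) that by (intro homogeneous_int_sum homogeneous_int_mult[OF A]) (auto simp: graded_tuples_def)
  then show "t \<in> {t \<in> graded_tuples n e d. \<exists>s. \<forall>i<n. t i = (\<Sum>c<m. A i c * s c)}"
    unfolding s(2) matrix_map_def by (auto simp: graded_tuples_def intro: exI[of _ s])
next
  fix t assume "t \<in> {t \<in> graded_tuples n e d. \<exists>s. \<forall>i<n. t i = (\<Sum>c<m. A i c * s c)}"
  then obtain s where t: "t \<in> graded_tuples n e d" and s: "\<And>i. i < n \<Longrightarrow> t i = (\<Sum>c<m. A i c * s c)" by blast
  define s' where "s' c = (if c < m then hcz (d - e' c) (s c) else 0)" for c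
  have "t i = (\<Sum>c<m. A i c * s' c)" if i: "i < n" for i
  proof -
    have "t i = hcz (d - e i) (t i)" using t i by (simp add: graded_tuples_def hcz_homogeneous)
    also have "\<dots> = (\<Sum>c<m. hcz (d - e i) (s c * A i c))" using s[OF i] by (simp add: hcz_sum mult.commute)
    also have "\<dots> = (\<Sum>c<m. A i c * s' c)"
      using i by (intro sum.cong refl) (simp add: hcz_mult[OF A] s'_def mult.commute)
    finally show ?thesis .
  qed
  then have "t = matrix_map n m A s'" using t by (auto simp: matrix_map_def fun_eq_iff graded_tuples_def)
  moreover have "s' \<in> graded_tuples m e' d" by (simp add: s'_def graded_tuples_def)
  ultimately show "t \<in> matrix_map n m A ` graded_tuples m e' d" by blast
qed

definition ideal_part :: "S \<Rightarrow> int \<Rightarrow> S set" where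
  "ideal_part f d = {p \<in> jacobian_ideal f. homogeneous_int d p}"

lemma FV_dim_0: "FV.dim {0} = 0"
  using FV.dim_le_card[of "{0}" "{}"] by simp

text \<open>
  Rank and nullity along the resolution, one degree at a time. The partial derivatives have degree
  \<open>9\<close>, which shifts the ideal; the degree is an integer so that no case of small degrees arises.
\<close>

lemma dim_ideal_part:
  assumes res: "AR_resolution f ds es g B" and f: "homogeneous 10 f"
  shows "SV.dim (ideal_part f (d + 9)) + FV.dim (graded_tuples (length ds) (\<lambda>i. int (ds ! i)) d)
    = FV.dim (graded_tuples 3 (\<lambda>_. 0) d) + FV.dim (graded_tuples (length es) (\<lambda>i. int (es ! i)) d)"
proof -
  let ?n = "length ds" and ?m = "length es"
  let ?ds = "\<lambda>i. int (ds ! i)" and ?es = "\<lambda>i. int (es ! i)"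
  let ?G = "\<lambda>k i. g i $ idx k"
  let ?\<phi> = "\<lambda>t. \<Sum>k<3. t k * pd (idx k) f"
  have pd9: "homogeneous_int 9 (pd c f)" for c
    using homogeneous_pd[of 9 f c] f homogeneous_int_int[of 9] by simp
  have syz: "(\<Sum>i<?n. t i *s g i) = 0 \<longleftrightarrow> (\<exists>s. \<forall>i<?n. t i = (\<Sum>c<?m. B i c * s c))" for t
    using res unfolding AR_resolution_def by simp
  have inj: "\<forall>c<?m. s c = 0" if "\<forall>i<?n. (\<Sum>c<?m. B i c * s c) = 0" for s
    using res that unfolding AR_resolution_def by simp
  have homB: "homogeneous_int (?es c - ?ds i) (B i c)" if "i < ?n" "c < ?m" for i c
    using res that unfolding AR_resolution_def by simp
  have homG: "homogeneous_int (?ds i - 0) (?G k i)" if "k < 3" "i < ?n" for k i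
    using res that unfolding AR_resolution_def by simp
  have AR: "AR f = range (\<lambda>t. \<Sum>i<?n. t i *s g i)" using res unfolding AR_resolution_def by simp
  have G0: "matrix_map 3 ?n ?G t = 0 \<longleftrightarrow> (\<Sum>i<?n. t i *s g i) = 0" for t
    by (auto simp: matrix_map_def fun_eq_iff vec_eq_iff all_idx mult.commute)
  have kerB: "{t \<in> graded_tuples ?m ?es d. matrix_map ?n ?m B t = 0} = {0}"
  proof -
    have "t = 0" if "t \<in> graded_tuples ?m ?es d" "matrix_map ?n ?m B t = 0" for t
    proof -
      have "(\<Sum>c<?m. B i c * t c) = 0" if "i < ?n" for i
        using fun_cong[OF \<open>matrix_map ?n ?m B t = 0\<close>, of i] that by (simp add: matrix_map_def)
      then have "\<forall>c<?m. t c = 0" using inj by blast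
      moreover have "\<forall>c\<ge>?m. t c = 0" using \<open>t \<in> _\<close> unfolding graded_tuples_def by blast
      ultimately have "t c = 0" for c by (cases "c < ?m") simp_all
      then show ?thesis by (simp add: fun_eq_iff)
    qed
    then show ?thesis by (auto simp: graded_tuples_def matrix_map_def fun_eq_iff)
  qed
  have imB: "matrix_map ?n ?m B ` graded_tuples ?m ?es d = {t \<in> graded_tuples ?n ?ds d. matrix_map 3 ?n ?G t = 0}"
  proof -
    have "matrix_map ?n ?m B ` graded_tuples ?m ?es d
        = {t \<in> graded_tuples ?n ?ds d. \<exists>s. \<forall>i<?n. t i = (\<Sum>c<?m. B i c * s c)}"
      by (rule matrix_map_image; rule homB; assumption)
    then show ?thesis unfolding G0 syz .
  qed
  have imG: "matrix_map 3 ?n ?G ` graded_tuples ?n ?ds d = {t \<in> graded_tuples 3 (\<lambda>_. 0) d. ?\<phi> t = 0}"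
  proof -
    have "?\<phi> t = 0 \<longleftrightarrow> vec3 t \<in> AR f" for t unfolding AR_iff by (simp add: vec3_nth)
    moreover have "vec3 t = (\<Sum>i<?n. s i *s g i) \<longleftrightarrow> (\<forall>k<3. t k = (\<Sum>i<?n. ?G k i * s i))" for t s
      by (simp add: vec_eq_iff all_idx vec3_nth mult.commute)
    ultimately have "?\<phi> t = 0 \<longleftrightarrow> (\<exists>s. \<forall>k<3. t k = (\<Sum>i<?n. ?G k i * s i))" for t
      unfolding AR by auto
    moreover have "matrix_map 3 ?n ?G ` graded_tuples ?n ?ds d
        = {t \<in> graded_tuples 3 (\<lambda>_. 0) d. \<exists>s. \<forall>k<3. t k = (\<Sum>i<?n. ?G k i * s i)}"
      by (rule matrix_map_image; rule homG; assumption)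
    ultimately show ?thesis by simp
  qed
  have im\<phi>: "?\<phi> ` graded_tuples 3 (\<lambda>_. 0) d = ideal_part f (d + 9)"
  proof (intro equalityI subsetI)
    fix p assume "p \<in> ?\<phi> ` graded_tuples 3 (\<lambda>_. 0) d"
    then obtain t where t: "t \<in> graded_tuples 3 (\<lambda>_. 0) d" "p = ?\<phi> t" by blast
    have "homogeneous_int (d + 9) p" unfolding t(2)
      using t(1) by (intro homogeneous_int_sum homogeneous_int_mult[OF _ pd9]) (auto simp: graded_tuples_def)
    then show "p \<in> ideal_part f (d + 9)" using t(2) unfolding ideal_part_def jacobian_ideal_iff by blast
  next
    fix p assume p: "p \<in> ideal_part f (d + 9)"
    then obtain t where t: "p = ?\<phi> t" unfolding ideal_part_def jacobian_ideal_iff by blast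
    define t' where "t' k = (if k < 3 then hcz d (t k) else 0)" for k :: nat
    have "p = hcz (d + 9) (?\<phi> t)" using p t by (simp add: ideal_part_def hcz_homogeneous)
    also have "\<dots> = ?\<phi> t'"
      unfolding hcz_sum by (intro sum.cong refl) (simp add: hcz_mult[OF pd9] t'_def)
    finally have "p = ?\<phi> t'" .
    moreover have "t' \<in> graded_tuples 3 (\<lambda>_. 0) d" by (simp add: graded_tuples_def t'_def)
    ultimately show "p \<in> ?\<phi> ` graded_tuples 3 (\<lambda>_. 0) d" by blast
  qed
  have lin\<phi>: "Vector_Spaces.linear (\<lambda>c (t::nat \<Rightarrow> S) i. Const c * t i) (\<lambda>c p. Const c * p) ?\<phi>"
    by unfold_locales (simp_all add: algebra_simps sum.distrib sum_distrib_left)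
  have "FV.dim (graded_tuples ?m ?es d) = FV.dim {t \<in> graded_tuples ?n ?ds d. matrix_map 3 ?n ?G t = 0}"
    using graded_tuples_rank_nullity[OF matrix_map_linear[of ?n ?m B], of ?m ?es d] FV_dim_0
    unfolding kerB imB by simp
  moreover have "FV.dim (graded_tuples ?n ?ds d) = FV.dim {t \<in> graded_tuples ?n ?ds d. matrix_map 3 ?n ?G t = 0}
      + FV.dim {t \<in> graded_tuples 3 (\<lambda>_. 0) d. ?\<phi> t = 0}"
    using graded_tuples_rank_nullity[OF matrix_map_linear[of 3 ?n ?G], of ?n ?ds d] unfolding imG .
  moreover have "FV.dim (graded_tuples 3 (\<lambda>_. 0) d) = FV.dim {t \<in> graded_tuples 3 (\<lambda>_. 0) d. ?\<phi> t = 0}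
      + SV.dim (ideal_part f (d + 9))"
    using graded_tuples_rank_nullity[OF lin\<phi>, of 3 "\<lambda>_. 0" d] unfolding im\<phi> .
  ultimately show ?thesis by simp
qed

text \<open>
  A basis modulo \<open>J\<close> in one degree together with a basis of that piece of \<open>J\<close> is a basis of the
  whole piece of the polynomial ring.
\<close>

lemma basis_mod_card:
  assumes J: "SV.subspace J" and B: "basis_mod J k B"
  shows "card B + SV.dim {p \<in> J. homogeneous k p} = SV.dim {p. homogeneous k p}"
proof -
  let ?U = "{p. homogeneous k p}" and ?J = "{p \<in> J. homogeneous k p}"
  have U: "?U = homs (int k)" by (simp add: homs_def)
  note B' = B[unfolded basis_mod_def]
  note finB = conjunct1[OF B'] and homB = conjunct1[OF conjunct2[OF B'], rule_format]
    and ex1 = conjunct2[OF conjunct2[OF B'], rule_format]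
  obtain C where C: "C \<subseteq> ?J" "SV.independent C" "?J \<subseteq> SV.span C" "card C = SV.dim ?J"
    using SV.basis_exists[of ?J] by blast
  have finC: "finite C"
  proof -
    have "C \<subseteq> SV.span ((\<lambda>m. single m 1) ` {m. mdeg m \<le> nat (int k)})"
      using C(1) U homs_finite_dim[of "int k"] by blast
    then show ?thesis using SV.independent_span_bound[OF _ C(2)] finite_monomials by blast
  qed
  have zero: "c b = 0" if c: "(\<Sum>b\<in>B. Const (c b) * b) \<in> J" and b: "b \<in> B" for c b
  proof -
    let ?c = "\<lambda>b. if b \<in> B then - c b else 0"
    have "(\<Sum>b\<in>B. Const (?c b) * b) = - (\<Sum>b\<in>B. Const (c b) * b)" by (simp add: sum_negf)
    then have f1: "(\<forall>b. b \<notin> B \<longrightarrow> ?c b = 0) \<and> 0 - (\<Sum>b\<in>B. Const (?c b) * b) \<in> J" using c by simp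
    have f2: "(\<forall>b. b \<notin> B \<longrightarrow> (\<lambda>_. 0) b = (0::complex)) \<and> 0 - (\<Sum>b\<in>B. Const ((\<lambda>_. 0) b) * b) \<in> J"
      using SV.subspace_0[OF J] by simp
    have unique: "c1 = c2" if "\<exists>!c. R c" "R c1" "R c2" for R and c1 c2 :: "S \<Rightarrow> complex"
      using that by blast
    have "?c = (\<lambda>_. 0)" by (rule unique[OF ex1[OF homogeneous_0]]) (fact f1, fact f2)
    from fun_cong[OF this, of b] show ?thesis using b by simp
  qed
  have disj: "B \<inter> C = {}"
  proof (rule ccontr)
    assume "B \<inter> C \<noteq> {}"
    then obtain x where x: "x \<in> B" "x \<in> J" using C(1) by blast
    have "(\<Sum>b\<in>B. Const (if b = x then 1 else 0) * b) = (\<Sum>b\<in>B. if b = x then x else 0)"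
      by (intro sum.cong) auto
    also have "\<dots> = x" using x(1) finB by simp
    finally have "(if x = x then 1 else 0) = (0::complex)" using zero[of "\<lambda>b. if b = x then 1 else 0" x] x by simp
    then show False by simp
  qed
  have ind: "SV.independent (B \<union> C)"
  proof (rule SV.independent_if_scalars_zero)
    fix u x assume u: "(\<Sum>x\<in>B \<union> C. Const (u x) * x) = 0" and x: "x \<in> B \<union> C"
    then have sum: "(\<Sum>b\<in>B. Const (u b) * b) + (\<Sum>c\<in>C. Const (u c) * c) = 0"
      unfolding sum.union_disjoint[OF finB finC disj] by simp
    have "(\<Sum>c\<in>C. Const (u c) * c) \<in> J"
      using C(1) by (intro SV.subspace_sum[OF J] SV.subspace_scale[OF J]) auto
    moreover have "(\<Sum>b\<in>B. Const (u b) * b) = - (\<Sum>c\<in>C. Const (u c) * c)"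
      using sum by (simp add: eq_neg_iff_add_eq_0)
    ultimately have "(\<Sum>b\<in>B. Const (u b) * b) \<in> J" using SV.subspace_neg[OF J] by simp
    then have ub: "u b = 0" if "b \<in> B" for b using zero that by blast
    then have "(\<Sum>c\<in>C. Const (u c) * c) = 0" using sum by simp
    then have "u c = 0" if "c \<in> C" for c
      using SV.independentD[OF C(2) finC subset_refl] that by blast
    then show "u x = 0" using ub x by blast
  qed (use finB finC in simp)
  have "?U \<subseteq> SV.span (B \<union> C)"
  proof
    fix p assume p: "p \<in> ?U"
    then obtain c where c: "p - (\<Sum>b\<in>B. Const (c b) * b) \<in> J" using ex1[of p] by blast
    have s: "(\<Sum>b\<in>B. Const (c b) * b) \<in> SV.span (B \<union> C)"
      by (intro SV.span_sum SV.span_scale SV.span_base) auto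
    have "homogeneous k (\<Sum>b\<in>B. Const (c b) * b)"
      by (intro homogeneous_sum homogeneous_mult[OF homogeneous_Const homB]) auto
    then have "p - (\<Sum>b\<in>B. Const (c b) * b) \<in> ?J" using c p by (simp add: homogeneous_diff)
    then have "p - (\<Sum>b\<in>B. Const (c b) * b) \<in> SV.span (B \<union> C)"
      using C(3) SV.span_mono[of C "B \<union> C"] by blast
    from SV.span_add[OF this s] show "p \<in> SV.span (B \<union> C)" by simp
  qed
  then have "card (B \<union> C) = SV.dim ?U"
    using C(1) homB ind by (intro SV.basis_card_eq_dim) auto
  then show ?thesis using card_Un_disjoint[OF finB finC disj] C(4) by simp
qed

lemma basis_mod_exists:
  assumes J: "SV.subspace J"
  shows "\<exists>B. basis_mod J k B"
proof -
  let ?U = "{p. homogeneous k p}" and ?J = "{p \<in> J. homogeneous k p}"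
  have U: "?U = homs (int k)" by (simp add: homs_def)
  obtain C where C: "C \<subseteq> ?J" "SV.independent C" "?J \<subseteq> SV.span C" "card C = SV.dim ?J"
    using SV.basis_exists[of ?J] by blast
  obtain E where E: "C \<subseteq> E" "E \<subseteq> ?U" "SV.independent E" "?U \<subseteq> SV.span E"
    using SV.maximal_independent_subset_extend[of C ?U] C(1,2) by blast
  have fin: "finite E"
  proof -
    have "E \<subseteq> SV.span ((\<lambda>m. single m 1) ` {m. mdeg m \<le> nat (int k)})"
      using E(2) U homs_finite_dim[of "int k"] by blast
    then show ?thesis using SV.independent_span_bound[OF _ E(3)] finite_monomials by blast
  qed
  have finC: "finite C" using finite_subset[OF E(1) fin] .
  let ?B = "E - C"
  have hom: "homogeneous k (\<Sum>b\<in>A. Const (c b) * b)" if "A \<subseteq> E" for c A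
    using that E(2) by (intro homogeneous_sum homogeneous_mult[OF homogeneous_Const]) auto
  have zero: "c b = 0" if c: "(\<Sum>b\<in>?B. Const (c b) * b) \<in> J" and b: "b \<in> ?B" for c b
  proof -
    have "(\<Sum>b\<in>?B. Const (c b) * b) \<in> SV.span C" using C(3) c hom[of ?B c] by blast
    then obtain w where w: "(\<Sum>b\<in>?B. Const (c b) * b) = (\<Sum>x\<in>C. Const (w x) * x)"
      using finC by (auto simp: SV.span_finite)
    have "(\<Sum>e\<in>E. Const (if e \<in> C then - w e else c e) * e)
        = (\<Sum>e\<in>?B. Const (c e) * e) + (\<Sum>e\<in>C. Const (- w e) * e)"
      by (subst sum.subset_diff[OF E(1) fin]) (auto intro!: arg_cong2[where f = "(+)"] sum.cong)
    also have "\<dots> = 0" by (simp add: w sum_negf)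
    finally have "(if b \<in> C then - w b else c b) = 0"
      using SV.independentD[OF E(3) fin subset_refl, of "\<lambda>e. if e \<in> C then - w e else c e" b] b by blast
    then show ?thesis using b by simp
  qed
  have "basis_mod J k ?B"
    unfolding basis_mod_def
  proof (intro conjI ballI allI impI)
    show "finite ?B" using fin by simp
    show "homogeneous k b" if "b \<in> ?B" for b using that E(2) by blast
    fix p assume "homogeneous k p"
    then have "p \<in> SV.span E" using E(4) by blast
    then obtain w where w: "p = (\<Sum>e\<in>E. Const (w e) * e)" using fin by (auto simp: SV.span_finite)
    let ?c = "\<lambda>b. if b \<in> ?B then w b else 0"
    have "p = (\<Sum>e\<in>?B. Const (w e) * e) + (\<Sum>e\<in>C. Const (w e) * e)"
      unfolding w by (rule sum.subset_diff[OF E(1) fin])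
    moreover have "(\<Sum>e\<in>?B. Const (?c e) * e) = (\<Sum>e\<in>?B. Const (w e) * e)" by (intro sum.cong) auto
    moreover have "(\<Sum>e\<in>C. Const (w e) * e) \<in> J"
      using C(1) by (intro SV.subspace_sum[OF J] SV.subspace_scale[OF J]) auto
    ultimately have c: "p - (\<Sum>b\<in>?B. Const (?c b) * b) \<in> J" by simp
    show "\<exists>!c. (\<forall>b. b \<notin> ?B \<longrightarrow> c b = 0) \<and> p - (\<Sum>b\<in>?B. Const (c b) * b) \<in> J"
    proof (rule ex1I[of _ ?c])
      show "(\<forall>b. b \<notin> ?B \<longrightarrow> ?c b = 0) \<and> p - (\<Sum>b\<in>?B. Const (?c b) * b) \<in> J" using c by simp
      fix c' assume c': "(\<forall>b. b \<notin> ?B \<longrightarrow> c' b = 0) \<and> p - (\<Sum>b\<in>?B. Const (c' b) * b) \<in> J"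
      have "(\<Sum>b\<in>?B. Const (?c b - c' b) * b) = (p - (\<Sum>b\<in>?B. Const (c' b) * b)) - (p - (\<Sum>b\<in>?B. Const (?c b) * b))"
        by (simp only: Const_simps left_diff_distrib sum_subtractf) simp
      also have "\<dots> \<in> J" using SV.subspace_diff[OF J] c c' by blast
      finally have "?c b - c' b = 0" if "b \<in> ?B" for b using zero[of "\<lambda>b. ?c b - c' b"] that by blast
      then show "c' = ?c"
      proof (intro ext)
        fix b
        show "c' b = ?c b" if d: "\<And>b. b \<in> ?B \<Longrightarrow> ?c b - c' b = 0"
          using d[of b] c' by (cases "b \<in> ?B") auto
      qed
    qed
  qed
  then show ?thesis by blast
qed

lemma hilbert_function_eq_dim:
  assumes J: "SV.subspace J"
  shows "hilbert_function J k = SV.dim {p. homogeneous k p} - SV.dim {p \<in> J. homogeneous k p}"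
proof -
  obtain B where B: "basis_mod J k B" using basis_mod_exists[OF J] by blast
  show ?thesis
    unfolding hilbert_function_def
  proof (rule the_equality)
    show "\<exists>B. basis_mod J k B \<and> card B = SV.dim {p. homogeneous k p} - SV.dim {p \<in> J. homogeneous k p}"
      using B basis_mod_card[OF J B] by (intro exI[of _ B]) simp
    show "n = SV.dim {p. homogeneous k p} - SV.dim {p \<in> J. homogeneous k p}"
      if "\<exists>B. basis_mod J k B \<and> card B = n" for n
      using that basis_mod_card[OF J] by fastforce
  qed
qed

lemma jacobian_ideal_subspace: "SV.subspace (jacobian_ideal f)"
  unfolding SV.subspace_def
proof (intro conjI allI ballI jacobian_ideal_0)
  show "p + q \<in> jacobian_ideal f" if pq: "p \<in> jacobian_ideal f" "q \<in> jacobian_ideal f" for p q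
  proof -
    obtain t u where "p = (\<Sum>i<3. t i * pd (idx i) f)" "q = (\<Sum>i<3. u i * pd (idx i) f)"
      using pq unfolding jacobian_ideal_iff by blast
    then have "p + q = (\<Sum>i<3. (t i + u i) * pd (idx i) f)" by (simp add: distrib_right sum.distrib)
    then show ?thesis unfolding jacobian_ideal_iff by (rule exI[of _ "\<lambda>i. t i + u i"])
  qed
  show "Const c * p \<in> jacobian_ideal f" if "p \<in> jacobian_ideal f" for c p
    using jacobian_ideal_mult[OF that, of "Const c"] by (simp add: mult.commute)
qed

theorem same_hilbert_function:
  assumes "AR_resolution f ds es g B" "homogeneous 10 f" "AR_resolution f' ds es g' B'" "homogeneous 10 f'"
  shows "hilbert_function (jacobian_ideal f) = hilbert_function (jacobian_ideal f')"
proof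
  fix k
  have "{p \<in> jacobian_ideal h. homogeneous k p} = ideal_part h ((int k - 9) + 9)" for h
    by (simp add: ideal_part_def)
  then show "hilbert_function (jacobian_ideal f) k = hilbert_function (jacobian_ideal f') k"
    unfolding hilbert_function_eq_dim[OF jacobian_ideal_subspace]
    using dim_ideal_part[OF assms(1,2), of "int k - 9"] dim_ideal_part[OF assms(3,4), of "int k - 9"] by simp
qed

section \<open>The combinatorics of a line arrangement\<close>

definition dot :: "complex^3 \<Rightarrow> complex^3 \<Rightarrow> complex" where
  "dot u v = u $ 1 * v $ 1 + u $ 2 * v $ 2 + u $ 3 * v $ 3"

definition vcross :: "complex^3 \<Rightarrow> complex^3 \<Rightarrow> complex^3" where
  "vcross u v = vector [u $ 2 * v $ 3 - u $ 3 * v $ 2, u $ 3 * v $ 1 - u $ 1 * v $ 3, u $ 1 * v $ 2 - u $ 2 * v $ 1]"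

lemma vcross_nth: "vcross u v $ 1 = u $ 2 * v $ 3 - u $ 3 * v $ 2" "vcross u v $ 2 = u $ 3 * v $ 1 - u $ 1 * v $ 3"
  "vcross u v $ 3 = u $ 1 * v $ 2 - u $ 2 * v $ 1"
  by (simp_all add: vcross_def vector_3)

lemma plane_iff: "v \<in> plane l \<longleftrightarrow> dot l v = 0"
  by (simp add: plane_def sum_3 dot_def)

lemma dot_vcross [simp]: "dot u (vcross u v) = 0" "dot v (vcross u v) = 0"
  by (simp_all add: dot_def vcross_nth algebra_simps)

lemma dot_scale: "dot u (c *s v) = c * dot u v" "dot (c *s u) v = c * dot u v"
  by (simp_all add: dot_def algebra_simps)

lemma parallel_if_vcross_eq_0:
  assumes "vcross v p = 0" "p \<noteq> 0"
  shows "\<exists>c. v = c *s p"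
proof -
  have eqs: "v $ 2 * p $ 3 = v $ 3 * p $ 2" "v $ 3 * p $ 1 = v $ 1 * p $ 3" "v $ 1 * p $ 2 = v $ 2 * p $ 1"
    using arg_cong[OF assms(1), of "\<lambda>u. u $ 1"] arg_cong[OF assms(1), of "\<lambda>u. u $ 2"]
      arg_cong[OF assms(1), of "\<lambda>u. u $ 3"] by (simp_all add: vcross_nth)
  have "p $ 1 \<noteq> 0 \<or> p $ 2 \<noteq> 0 \<or> p $ 3 \<noteq> 0" using assms(2) by (auto simp: vec_eq_iff forall_3)
  then show ?thesis
  proof (elim disjE)
    assume "p $ 1 \<noteq> 0"
    then show ?thesis using eqs
      by (intro exI[of _ "v $ 1 / p $ 1"]) (simp add: vec_eq_iff forall_3 field_simps)
  next
    assume "p $ 2 \<noteq> 0"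
    then show ?thesis using eqs
      by (intro exI[of _ "v $ 2 / p $ 2"]) (simp add: vec_eq_iff forall_3 field_simps)
  next
    assume "p $ 3 \<noteq> 0"
    then show ?thesis using eqs
      by (intro exI[of _ "v $ 3 / p $ 3"]) (simp add: vec_eq_iff forall_3 field_simps)
  qed
qed

lemma meet_of_two_planes:
  assumes "dot a v = 0" "dot b v = 0" "vcross a b \<noteq> 0"
  shows "\<exists>c. v = c *s vcross a b"
proof (rule parallel_if_vcross_eq_0)
  have "vcross v (vcross a b) $ i = a $ i * dot b v - b $ i * dot a v" for i
    using exhaust_3[of i] by (auto simp: vcross_nth dot_def algebra_simps)
  then show "vcross v (vcross a b) = 0" using assms by (simp add: vec_eq_iff)
qed fact

lemma separating_point:
  assumes "vcross a b \<noteq> 0"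
  shows "\<exists>v. dot a v = 0 \<and> dot b v \<noteq> 0"
proof -
  obtain i where i: "vcross a b $ i \<noteq> 0" using assms by (auto simp: vec_eq_iff)
  have "dot b (vcross a (axis i 1)) = - vcross a b $ i"
    using exhaust_3[of i] by (auto simp: dot_def vcross_nth axis_def algebra_simps)
  then show ?thesis using i by (intro exI[of _ "vcross a (axis i 1)"]) simp
qed

locale indexed_arrangement =
  fixes ls :: "(complex^3) list"
  assumes general: "\<And>i j. i < length ls \<Longrightarrow> j < length ls \<Longrightarrow> i \<noteq> j \<Longrightarrow> vcross (ls ! i) (ls ! j) \<noteq> 0"
    and nonempty: "1 < length ls"
begin

definition "concurrent i j k \<longleftrightarrow> dot (ls ! k) (vcross (ls ! i) (ls ! j)) = 0"
definition "flat I = {v. \<forall>i\<in>I. dot (ls ! i) v = 0}"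
definition "lines_above I = {k. k < length ls \<and> flat I \<subseteq> plane (ls ! k)}"

text \<open>
  Which lines contain a flat depends only on the triples of concurrent lines: a flat is the
  whole space, a plane, a line (determined by any two of the planes) or the origin.
\<close>

lemma lines_above_iff:
  assumes "I \<subseteq> {..<length ls}" "k < length ls"
  shows "k \<in> lines_above I \<longleftrightarrow> k \<in> I \<or> (\<exists>i\<in>I. \<exists>j\<in>I. i \<noteq> j \<and> concurrent i j k) \<or>
    (\<exists>i\<in>I. \<exists>j\<in>I. \<exists>m\<in>I. i \<noteq> j \<and> \<not> concurrent i j m)"
proof
  assume "k \<in> I \<or> (\<exists>i\<in>I. \<exists>j\<in>I. i \<noteq> j \<and> concurrent i j k) \<or>
    (\<exists>i\<in>I. \<exists>j\<in>I. \<exists>m\<in>I. i \<noteq> j \<and> \<not> concurrent i j m)"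
  then have "dot (ls ! k) v = 0" if v: "\<forall>i\<in>I. dot (ls ! i) v = 0" for v
  proof (elim disjE bexE conjE)
    fix i j assume ij: "i \<in> I" "j \<in> I" "i \<noteq> j" "concurrent i j k"
    then obtain c where "v = c *s vcross (ls ! i) (ls ! j)"
      using meet_of_two_planes[of "ls ! i" v "ls ! j"] v general assms(1) by blast
    then show ?thesis using ij(4) by (simp add: dot_scale concurrent_def)
  next
    fix i j m assume ij: "i \<in> I" "j \<in> I" "m \<in> I" "i \<noteq> j" "\<not> concurrent i j m"
    then obtain c where c: "v = c *s vcross (ls ! i) (ls ! j)"
      using meet_of_two_planes[of "ls ! i" v "ls ! j"] v general assms(1) by blast
    moreover have "dot (ls ! m) v = 0" using v ij by blast
    ultimately have "c = 0" using ij(5) by (simp add: dot_scale concurrent_def)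
    then show ?thesis using c by (simp add: dot_def)
  qed (use v in auto)
  then show "k \<in> lines_above I" using assms(2) by (auto simp: lines_above_def flat_def plane_iff)
next
  assume k: "k \<in> lines_above I"
  then have cl: "dot (ls ! k) v = 0" if "\<forall>i\<in>I. dot (ls ! i) v = 0" for v
    using that by (auto simp: lines_above_def flat_def plane_iff)
  show "k \<in> I \<or> (\<exists>i\<in>I. \<exists>j\<in>I. i \<noteq> j \<and> concurrent i j k) \<or>
    (\<exists>i\<in>I. \<exists>j\<in>I. \<exists>m\<in>I. i \<noteq> j \<and> \<not> concurrent i j m)"
  proof (rule ccontr)
    assume *: "\<not> ?thesis"
    consider "I = {}" | i where "I = {i}" | i j where "i \<in> I" "j \<in> I" "i \<noteq> j" by blast
    then show False
    proof cases
      case 1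
      obtain j where "j < length ls" "j \<noteq> k" using nonempty by (metis less_trans zero_less_one less_numeral_extra(4))
      then show False using separating_point[OF general[of j k]] cl 1 assms(2) by auto
    next
      case (2 i)
      then have "i \<noteq> k" "i < length ls" using * assms(1) by auto
      then show False using separating_point[OF general[of i k]] cl 2 assms(2) by auto
    next
      case (3 i j)
      have "\<forall>m\<in>I. dot (ls ! m) (vcross (ls ! i) (ls ! j)) = 0"
        using * 3 unfolding concurrent_def by blast
      then have "concurrent i j k" using cl unfolding concurrent_def by blast
      then show False using * 3 by blast
    qed
  qed
qed

lemma flat_lines_above: "I \<subseteq> {..<length ls} \<Longrightarrow> flat (lines_above I) = flat I"
  by (auto simp: lines_above_def flat_def plane_iff subset_iff)

lemma flat_subset_iff:
  assumes "I \<subseteq> {..<length ls}" "J \<subseteq> {..<length ls}"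
  shows "flat J \<subseteq> flat I \<longleftrightarrow> lines_above I \<subseteq> lines_above J"
proof
  assume "lines_above I \<subseteq> lines_above J"
  then have "flat (lines_above J) \<subseteq> flat (lines_above I)" by (auto simp: flat_def)
  then show "flat J \<subseteq> flat I" using assms by (simp add: flat_lines_above)
qed (auto simp: lines_above_def)

lemma intersection_lattice_eq: "intersection_lattice ls = flat ` Pow {..<length ls}"
proof -
  have flat: "flat I = \<Inter> ((\<lambda>i. plane (ls ! i)) ` I)" for I by (auto simp: flat_def plane_iff)
  have "plane ` set ls = (\<lambda>i. plane (ls ! i)) ` {..<length ls}"
    by (auto simp: set_conv_nth)
  then show ?thesis
    unfolding intersection_lattice_def flat by (auto simp: subset_image_iff)
qed

lemma plane_inj: "inj_on (\<lambda>i. plane (ls ! i)) {..<length ls}"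
proof (rule inj_onI, rule ccontr)
  fix i j assume *: "i \<in> {..<length ls}" "j \<in> {..<length ls}" "plane (ls ! i) = plane (ls ! j)" "i \<noteq> j"
  then show False using separating_point[OF general[of i j]] plane_iff by auto
qed

lemma card_planes: "card (plane ` set ls) = length ls"
proof -
  have "plane ` set ls = (\<lambda>i. plane (ls ! i)) ` {..<length ls}" by (auto simp: set_conv_nth)
  then show ?thesis using card_image[OF plane_inj] by simp
qed

definition "incidence P = {i. i < length ls \<and> P \<subseteq> plane (ls ! i)}"

lemma multiplicity_at_eq: "multiplicity_at ls P = card (incidence P)"
proof -
  have "{H \<in> plane ` set ls. P \<subseteq> H} = (\<lambda>i. plane (ls ! i)) ` incidence P"
    by (auto simp: set_conv_nth incidence_def)
  moreover have "inj_on (\<lambda>i. plane (ls ! i)) (incidence P)"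
    by (rule inj_on_subset[OF plane_inj]) (auto simp: incidence_def)
  ultimately show ?thesis unfolding multiplicity_at_def by (simp add: card_image)
qed

definition "block i j = {k. k < length ls \<and> concurrent i j k}"

lemma span_subset_plane: "vec.span {v} \<subseteq> plane l \<longleftrightarrow> dot l v = 0"
proof
  assume "vec.span {v} \<subseteq> plane l"
  then have "v \<in> plane l" using vec.span_base[of v "{v}"] by blast
  then show "dot l v = 0" by (simp add: plane_iff)
qed (auto simp: vec.span_singleton plane_iff dot_scale)

abbreviation "meet i j \<equiv> vec.span {vcross (ls ! i) (ls ! j)}"

lemma incidence_meet: "incidence (meet i j) = block i j"
  by (auto simp: incidence_def block_def span_subset_plane concurrent_def)

text \<open>
  A point on at least two of the lines is the meeting point of these two, so it is determined by
  the set of lines through it.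
\<close>

lemma multiple_point:
  assumes P: "P \<in> points_of_mult ls m" and "2 \<le> m"
  shows "\<exists>j<length ls. \<exists>i<j. P = meet i j"
proof -
  obtain v where v: "P = vec.span {v}" "v \<noteq> 0" and card: "card (incidence P) = m"
    using P by (auto simp: points_of_mult_def proj_plane_def multiplicity_at_eq)
  have fin: "finite (incidence P)" by (simp add: incidence_def)
  have "\<exists>i\<in>incidence P. \<exists>j\<in>incidence P. i < j"
  proof (rule ccontr)
    assume "\<not> ?thesis"
    then have "\<forall>i\<in>incidence P. \<forall>j\<in>incidence P. i = j" by (meson linorder_neqE_nat)
    then have "card (incidence P) \<le> 1" by (metis card_le_Suc0_iff_eq fin One_nat_def)
    then show False using card assms(2) by simp
  qed
  then obtain i j where ij: "i \<in> incidence P" "j \<in> incidence P" "i < j" by blast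
  then have lt: "i < length ls" "j < length ls" by (auto simp: incidence_def)
  have "dot (ls ! i) v = 0" "dot (ls ! j) v = 0" using ij by (auto simp: incidence_def v span_subset_plane)
  then obtain c where c: "v = c *s vcross (ls ! i) (ls ! j)"
    using meet_of_two_planes general[OF lt] ij(3) by (metis less_irrefl)
  then have "c \<noteq> 0" using v(2) by auto
  then have inv: "vcross (ls ! i) (ls ! j) = (1 / c) *s v" by (simp add: c vec_eq_iff)
  have "P = meet i j" unfolding v(1)
  proof
    show "vec.span {v} \<subseteq> meet i j"
      by (rule vec.span_minimal[OF _ vec.subspace_span]) (simp add: c vec.span_scale vec.span_base)
    show "meet i j \<subseteq> vec.span {v}"
      by (rule vec.span_minimal[OF _ vec.subspace_span]) (simp add: inv vec.span_scale vec.span_base)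
  qed
  then show ?thesis using ij lt by blast
qed

lemma card_points_of_mult:
  assumes "2 \<le> m"
  shows "card (points_of_mult ls m) =
    card {b. (\<exists>j<length ls. \<exists>i<j. b = block i j) \<and> card b = m}"
proof -
  note inc = incidence_meet and point = multiple_point[OF _ assms]
  have "bij_betw incidence (points_of_mult ls m) {b. (\<exists>j<length ls. \<exists>i<j. b = block i j) \<and> card b = m}"
    unfolding bij_betw_def
  proof
    show "inj_on incidence (points_of_mult ls m)"
    proof (rule inj_onI)
      fix P P' assume P: "P \<in> points_of_mult ls m" and P': "P' \<in> points_of_mult ls m"
        and eq: "incidence P = incidence P'"
      obtain i j where ij: "j < length ls" "i < j" "P = meet i j" using point[OF P] by blast
      obtain i' j' where ij': "j' < length ls" "i' < j'" "P' = meet i' j'" using point[OF P'] by blast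
      have "{i, j} \<subseteq> incidence P'"
        using ij unfolding eq[symmetric] ij(3) inc by (auto simp: block_def concurrent_def)
      then have "dot (ls ! i) (vcross (ls ! i') (ls ! j')) = 0" "dot (ls ! j) (vcross (ls ! i') (ls ! j')) = 0"
        unfolding ij'(3) inc by (auto simp: block_def concurrent_def)
      then obtain c where c: "vcross (ls ! i') (ls ! j') = c *s vcross (ls ! i) (ls ! j)"
        using meet_of_two_planes general[of i j] ij by fastforce
      have "c \<noteq> 0" using c general[of i' j'] ij' by auto
      then have inv: "vcross (ls ! i) (ls ! j) = (1 / c) *s vcross (ls ! i') (ls ! j')" by (simp add: c vec_eq_iff)
      show "P = P'" unfolding ij(3) ij'(3)
      proof
        show "meet i j \<subseteq> meet i' j'"
          by (rule vec.span_minimal[OF _ vec.subspace_span]) (simp add: inv vec.span_scale vec.span_base)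
        show "meet i' j' \<subseteq> meet i j"
          by (rule vec.span_minimal[OF _ vec.subspace_span]) (simp add: c vec.span_scale vec.span_base)
      qed
    qed
    show "incidence ` points_of_mult ls m = {b. (\<exists>j<length ls. \<exists>i<j. b = block i j) \<and> card b = m}"
    proof (intro equalityI subsetI)
      fix b assume "b \<in> incidence ` points_of_mult ls m"
      then obtain P where P: "P \<in> points_of_mult ls m" "b = incidence P" by blast
      moreover have "card b = m" using P by (simp add: points_of_mult_def multiplicity_at_eq)
      ultimately show "b \<in> {b. (\<exists>j<length ls. \<exists>i<j. b = block i j) \<and> card b = m}"
      proof -
        obtain i j where ij: "j < length ls" "i < j" "P = meet i j" using point[OF P(1)] by blast
        then have "b = block i j" using P(2) inc by simp
        then show ?thesis using ij \<open>card b = m\<close> by blast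
      qed
    next
      fix b assume "b \<in> {b. (\<exists>j<length ls. \<exists>i<j. b = block i j) \<and> card b = m}"
      then obtain i j where ij: "j < length ls" "i < j" "b = block i j" "card b = m" by blast
      have "meet i j \<in> points_of_mult ls m"
        using ij general[of i j] by (auto simp: points_of_mult_def proj_plane_def multiplicity_at_eq inc)
      then show "b \<in> incidence ` points_of_mult ls m" using inc ij(3) by blast
    qed
  qed
  then show ?thesis by (rule bij_betw_same_card)
qed

end

text \<open>Isomorphic lattices from equal sets of concurrent triples.\<close>

lemma isomorphic_lattices_if_same_concurrency:
  assumes "indexed_arrangement ls" "indexed_arrangement ls'" "length ls' = length ls"
    and "\<And>i j k. i < length ls \<Longrightarrow> j < length ls \<Longrightarrow> k < length ls \<Longrightarrow>
      indexed_arrangement.concurrent ls i j k \<longleftrightarrow> indexed_arrangement.concurrent ls' i j k"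
  shows "isomorphic_lattices ls ls'"
proof -
  interpret A: indexed_arrangement ls by fact
  interpret A': indexed_arrangement ls' by fact
  let ?N = "{..<length ls}"
  have cl: "A.lines_above I = A'.lines_above I" if I: "I \<subseteq> ?N" for I
  proof (rule set_eqI)
    fix k
    have I': "I \<subseteq> {..<length ls'}" using I assms(3) by simp
    have in_I: "i < length ls" if "i \<in> I" for i using that I by auto
    show "k \<in> A.lines_above I \<longleftrightarrow> k \<in> A'.lines_above I"
    proof (cases "k < length ls")
      case True
      then have k': "k < length ls'" using assms(3) by simp
      show ?thesis unfolding A.lines_above_iff[OF I True] A'.lines_above_iff[OF I' k']
        using assms(4) in_I True by (intro arg_cong2[where f = "(\<or>)"] bex_cong refl conj_cong arg_cong[where f = Not]) auto
    qed (use assms(3) in \<open>auto simp: A.lines_above_def A'.lines_above_def\<close>)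
  qed
  have sub: "A.flat J \<subseteq> A.flat I \<longleftrightarrow> A'.flat J \<subseteq> A'.flat I" if "I \<subseteq> ?N" "J \<subseteq> ?N" for I J
    using A.flat_subset_iff[OF that] A'.flat_subset_iff[of I J] cl[OF that(1)] cl[OF that(2)] that assms(3) by simp
  define \<phi> where "\<phi> X = A'.flat {k. k < length ls \<and> X \<subseteq> plane (ls ! k)}" for X
  have \<phi>: "\<phi> (A.flat I) = A'.flat I" if "I \<subseteq> ?N" for I
  proof -
    have "\<phi> (A.flat I) = A'.flat (A'.lines_above I)" by (simp add: \<phi>_def cl[OF that, symmetric] A.lines_above_def)
    then show ?thesis using A'.flat_lines_above[of I] that assms(3) by simp
  qed
  have lat: "intersection_lattice ls = A.flat ` Pow ?N" "intersection_lattice ls' = A'.flat ` Pow ?N"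
    using A.intersection_lattice_eq A'.intersection_lattice_eq assms(3) by simp_all
  show ?thesis
    unfolding isomorphic_lattices_def
  proof (intro exI[of _ \<phi>] conjI ballI)
    show "bij_betw \<phi> (intersection_lattice ls) (intersection_lattice ls')"
      unfolding bij_betw_def
    proof
      show "inj_on \<phi> (intersection_lattice ls)"
        unfolding lat
      proof (rule inj_onI)
        fix X Y assume "X \<in> A.flat ` Pow ?N" "Y \<in> A.flat ` Pow ?N" and eq: "\<phi> X = \<phi> Y"
        then obtain I J where IJ: "I \<subseteq> ?N" "J \<subseteq> ?N" "X = A.flat I" "Y = A.flat J" by blast
        then have "A'.flat I = A'.flat J" using eq \<phi> by simp
        then show "X = Y" using sub[OF IJ(1,2)] sub[OF IJ(2,1)] IJ(3,4) by blast
      qed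
      show "\<phi> ` intersection_lattice ls = intersection_lattice ls'"
        unfolding lat image_image by (intro image_cong refl) (auto simp: \<phi>)
    qed
    fix X Y assume "X \<in> intersection_lattice ls" "Y \<in> intersection_lattice ls"
    then obtain I J where "I \<subseteq> ?N" "J \<subseteq> ?N" "X = A.flat I" "Y = A.flat J" unfolding lat by blast
    then show "X \<supseteq> Y \<longleftrightarrow> \<phi> X \<supseteq> \<phi> Y" using sub \<phi> by simp
  qed
qed

subsection \<open>Integer coordinates\<close>

type_synonym ivec = "int \<times> int \<times> int"

definition cvec :: "ivec \<Rightarrow> complex^3" where
  "cvec = (\<lambda>(a, b, c). vector [of_int a, of_int b, of_int c])"

definition icross :: "ivec \<Rightarrow> ivec \<Rightarrow> ivec" where
  "icross = (\<lambda>(a, b, c) (d, e, f). (b * f - c * e, c * d - a * f, a * e - b * d))"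

definition idot :: "ivec \<Rightarrow> ivec \<Rightarrow> int" where
  "idot = (\<lambda>(a, b, c) (d, e, f). a * d + b * e + c * f)"

lemma vcross_cvec: "vcross (cvec u) (cvec v) = cvec (icross u v)"
  by (cases u; cases v) (simp add: vec_eq_iff forall_3 vcross_nth cvec_def icross_def vector_3)

lemma dot_cvec: "dot (cvec u) (cvec v) = of_int (idot u v)"
  by (cases u; cases v) (simp add: dot_def cvec_def idot_def vector_3)

lemma cvec_eq_0_iff: "cvec u = 0 \<longleftrightarrow> u = (0, 0, 0)"
  by (cases u) (simp add: vec_eq_iff forall_3 cvec_def vector_3)

definition block_list :: "ivec list \<Rightarrow> nat \<Rightarrow> nat \<Rightarrow> nat list" where
  "block_list L i j = filter (\<lambda>k. idot (L ! k) (icross (L ! i) (L ! j)) = 0) [0..<length L]"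

text \<open>
  Every multiple point appears once for each pair of lines through it, which is why duplicates are
  removed before the points are counted.
\<close>

definition all_blocks :: "ivec list \<Rightarrow> nat list list" where
  "all_blocks L = concat (map (\<lambda>j. map (\<lambda>i. block_list L i j) [0..<j]) [0..<length L])"

definition pairwise_general :: "ivec list \<Rightarrow> bool" where
  "pairwise_general L \<longleftrightarrow> list_all (\<lambda>j. list_all (\<lambda>i. icross (L ! i) (L ! j) \<noteq> (0, 0, 0)) [0..<j]) [0..<length L]"

lemma indexed_arrangement_cvec:
  assumes "pairwise_general L" "1 < length L"
  shows "indexed_arrangement (map cvec L)"
proof
  have lt: "icross (L ! i) (L ! j) \<noteq> (0, 0, 0)" if "i < j" "j < length L" for i j
    using assms(1) that by (auto simp: pairwise_general_def list_all_iff)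
  have anti: "icross u v = (0, 0, 0) \<longleftrightarrow> icross v u = (0, 0, 0)" for u v
    by (cases u; cases v) (auto simp: icross_def algebra_simps)
  show "vcross (map cvec L ! i) (map cvec L ! j) \<noteq> 0"
    if "i < length (map cvec L)" "j < length (map cvec L)" "i \<noteq> j" for i j
    using that lt[of i j] lt[of j i] anti by (cases "i < j") (auto simp: vcross_cvec cvec_eq_0_iff)
qed (use assms in simp)

lemma block_cvec:
  assumes "pairwise_general L" "1 < length L" "i < length L" "j < length L"
  shows "indexed_arrangement.block (map cvec L) i j = set (block_list L i j)"
proof -
  interpret indexed_arrangement "map cvec L" by (rule indexed_arrangement_cvec) fact+
  show ?thesis using assms(3,4)
    by (auto simp: block_def concurrent_def block_list_def vcross_cvec dot_cvec)
qed

lemma card_points_cvec: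
  assumes "pairwise_general L" "1 < length L" "2 \<le> m"
  shows "card (points_of_mult (map cvec L) m) = length (remdups (filter (\<lambda>b. length b = m) (all_blocks L)))"
proof -
  interpret indexed_arrangement "map cvec L" by (rule indexed_arrangement_cvec) fact+
  have sorted: "sorted_wrt (<) (block_list L i j)" for i j
    unfolding block_list_def by (rule sorted_wrt_filter) (simp add: sorted_wrt_upt)
  then have len: "card (set (block_list L i j)) = length (block_list L i j)" for i j
    by (simp add: distinct_card strict_sorted_iff)
  let ?bs = "filter (\<lambda>b. length b = m) (all_blocks L)"
  have "{b. (\<exists>j<length (map cvec L). \<exists>i<j. b = block i j) \<and> card b = m} = set ` set ?bs"
  proof -
    have "{b. (\<exists>j<length (map cvec L). \<exists>i<j. b = block i j) \<and> card b = m}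
        = {b. (\<exists>j<length L. \<exists>i<j. b = set (block_list L i j)) \<and> card b = m}"
      using block_cvec[OF assms(1,2)] by (auto; metis less_trans)
    also have "\<dots> = set ` set ?bs"
      by (auto simp: all_blocks_def len image_iff) (metis atLeastLessThan_iff len zero_le)+
    finally show ?thesis .
  qed
  moreover have "inj_on set (set ?bs)"
  proof (rule inj_onI)
    fix b b' assume "b \<in> set ?bs" "b' \<in> set ?bs" "set b = set b'"
    moreover have "sorted_wrt (<) b" if "b \<in> set ?bs" for b using that sorted by (auto simp: all_blocks_def)
    ultimately show "b = b'" by (metis strict_sorted_equal)
  qed
  ultimately show ?thesis
    using card_points_of_mult[OF assms(3)] by (simp only: card_image) (simp add: length_remdups_card_conv)
qed

lemma no_points_cvec:
  assumes "pairwise_general L" "1 < length L" "list_all (\<lambda>b. length b \<le> n) (all_blocks L)" "n < m" "1 \<le> n"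
  shows "points_of_mult (map cvec L) m = {}"
proof -
  interpret indexed_arrangement "map cvec L" by (rule indexed_arrangement_cvec) fact+
  have False if P: "P \<in> points_of_mult (map cvec L) m" for P
  proof -
    obtain i j where ij: "j < length L" "i < j" "P = meet i j"
      using multiple_point[OF P] assms(4,5) by auto
    then have "incidence P = set (block_list L i j)"
      unfolding ij(3) incidence_meet using block_cvec[OF assms(1,2), of i j] by simp
    then have "m \<le> length (block_list L i j)"
      using P card_length[of "block_list L i j"] by (simp add: points_of_mult_def multiplicity_at_eq)
    moreover have "block_list L i j \<in> set (all_blocks L)" using ij by (auto simp: all_blocks_def intro!: bexI[of _ j])
    ultimately show False using assms(3,4) by (auto simp: list_all_iff)
  qed
  then show ?thesis by blast
qed

lemma isomorphic_lattices_cvec: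
  assumes "pairwise_general L" "pairwise_general L'" "1 < length L" "length L' = length L"
    and "list_all (\<lambda>i. list_all (\<lambda>j. block_list L i j = block_list L' i j) [0..<length L]) [0..<length L]"
  shows "isomorphic_lattices (map cvec L) (map cvec L')"
proof (rule isomorphic_lattices_if_same_concurrency)
  have 1: "1 < length L'" using assms by simp
  show A: "indexed_arrangement (map cvec L)" and A': "indexed_arrangement (map cvec L')"
    using indexed_arrangement_cvec[OF assms(1,3)] indexed_arrangement_cvec[OF assms(2) 1] by simp_all
  fix i j k assume ijk: "i < length (map cvec L)" "j < length (map cvec L)" "k < length (map cvec L)"
  then have "set (block_list L i j) = set (block_list L' i j)" using assms(5) by (simp add: list_all_iff)
  then have "indexed_arrangement.block (map cvec L) i j = indexed_arrangement.block (map cvec L') i j"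
    using block_cvec[OF assms(1,3)] block_cvec[OF assms(2) 1] ijk assms(4) by simp
  then show "indexed_arrangement.concurrent (map cvec L) i j k \<longleftrightarrow> indexed_arrangement.concurrent (map cvec L') i j k"
    using ijk assms(4) unfolding indexed_arrangement.block_def[OF A] indexed_arrangement.block_def[OF A'] by auto
qed (use assms in simp)

subsection \<open>Rescaling the forms\<close>

definition rescaled :: "(complex^3) list \<Rightarrow> (complex^3) list \<Rightarrow> bool" where
  "rescaled ls ks \<longleftrightarrow> list_all2 (\<lambda>l k. \<exists>c. c \<noteq> 0 \<and> l = c *s k) ls ks"

lemma rescaled_planes: "rescaled ls ks \<Longrightarrow> plane ` set ls = plane ` set ks"
  unfolding rescaled_def
proof (induction rule: list_all2_induct)
  case (Cons l ls k ks)
  then have "plane l = plane k" by (auto simp: plane_iff dot_scale)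
  then show ?case using Cons by simp
qed simp

lemma rescaled_defining_poly:
  "rescaled ls ks \<Longrightarrow> \<exists>c. c \<noteq> 0 \<and> defining_poly ls = Const c * defining_poly ks"
  unfolding rescaled_def
proof (induction rule: list_all2_induct)
  case Nil
  show ?case by (intro exI[of _ 1]) simp
next
  case (Cons l ls k ks)
  obtain c where c: "c \<noteq> 0" "defining_poly ls = Const c * defining_poly ks" using Cons.IH by blast
  obtain d where d: "d \<noteq> 0" "l = d *s k" using Cons.hyps by blast
  have "defining_poly (l # ls) = Const (d * c) * defining_poly (k # ks)"
    unfolding defining_poly_Cons c(2) d(2) linear_form_scale Const_simps(6) by (simp only: ac_simps)
  then show ?case using c(1) d(1) by (intro exI[of _ "d * c"]) simp
qed

lemma rescaled_indexed_arrangement: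
  assumes "rescaled ls ks" "indexed_arrangement ks"
  shows "indexed_arrangement ls"
proof
  interpret indexed_arrangement ks by fact
  have len: "length ls = length ks" using assms(1) by (simp add: rescaled_def list_all2_lengthD)
  show "1 < length ls" using len nonempty by simp
  fix i j assume ij: "i < length ls" "j < length ls" "i \<noteq> j"
  have "\<exists>c. c \<noteq> 0 \<and> ls ! k = c *s ks ! k" if "k < length ls" for k
    using assms(1) that by (simp add: rescaled_def list_all2_conv_all_nth)
  then obtain c d where cd: "c \<noteq> 0" "ls ! i = c *s ks ! i" "d \<noteq> 0" "ls ! j = d *s ks ! j"
    using ij by blast
  have "vcross (ls ! i) (ls ! j) = (c * d) *s vcross (ks ! i) (ks ! j)"
    by (simp add: cd vec_eq_iff forall_3 vcross_nth algebra_simps)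
  then show "vcross (ls ! i) (ls ! j) \<noteq> 0" using general[of i j] ij len cd by simp
qed

lemma indexed_arrangement_line_arrangement:
  assumes "indexed_arrangement ls"
  shows "line_arrangement ls"
proof -
  interpret indexed_arrangement ls by fact
  have nz: "ls ! i \<noteq> 0" if "i < length ls" for i
  proof
    assume z: "ls ! i = 0"
    obtain j where "j < length ls" "j \<noteq> i" using nonempty by (metis less_trans zero_less_one less_numeral_extra(4))
    then have "vcross (ls ! i) (ls ! j) \<noteq> 0" using general that by simp
    then show False using z by (simp add: vec_eq_iff forall_3 vcross_nth)
  qed
  have "\<nexists>c. ls ! j = c *s ls ! i" if "i < j" "j < length ls" for i j
  proof
    assume "\<exists>c. ls ! j = c *s ls ! i"
    then have "vcross (ls ! i) (ls ! j) = 0" by (auto simp: vec_eq_iff forall_3 vcross_nth)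
    then show False using general[of i j] that by simp
  qed
  then show ?thesis using nz by (auto simp: line_arrangement_def sorted_wrt_iff_nth_less in_set_conv_nth)
qed

lemma points_of_mult_cong: "plane ` set ls = plane ` set ks \<Longrightarrow> points_of_mult ls = points_of_mult ks"
  by (intro ext) (simp add: points_of_mult_def multiplicity_at_def)

lemma isomorphic_lattices_cong:
  "plane ` set ls = plane ` set ks \<Longrightarrow> plane ` set ls' = plane ` set ks' \<Longrightarrow>
    isomorphic_lattices ks ks' \<Longrightarrow> isomorphic_lattices ls ls'"
  by (simp add: isomorphic_lattices_def intersection_lattice_def)

text \<open>
  Multiples of the given forms with integer coefficients, so that concurrency is decided by
  computation in the integers.
\<close>

definition Lq :: "ivec list" where
  "Lq = [(0, 1, 0), (1, 1, 1), (1, 31, - 510), (8, 263, - 4080), (8, 263, 8), (1, 31, 31), (1, 1, 0),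
     (0, 1, - 16), (1, 0, 17), (0, 0, 1)]"

definition Lp :: "ivec list" where
  "Lp = [(0, 1, 0), (1, 1, 1), (10, 3, 2), (- 25, - 32, - 5), (- 25, - 32, - 25), (10, 3, 3), (1, 1, 0),
     (0, 7, 5), (7, 0, 2), (0, 0, 1)]"

lemma general_Lq: "pairwise_general Lq" and general_Lp: "pairwise_general Lp"
  by code_simp+

lemma same_blocks:
  "list_all (\<lambda>i. list_all (\<lambda>j. block_list Lq i j = block_list Lp i j) [0..<length Lq]) [0..<length Lq]"
  by code_simp

lemma blocks_Lq:
  "length (remdups (filter (\<lambda>b. length b = 2) (all_blocks Lq))) = 15"
  "length (remdups (filter (\<lambda>b. length b = 3) (all_blocks Lq))) = 10"
  "list_all (\<lambda>b. length b \<le> 3) (all_blocks Lq)"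
  by code_simp+

lemma blocks_Lp:
  "length (remdups (filter (\<lambda>b. length b = 2) (all_blocks Lp))) = 15"
  "length (remdups (filter (\<lambda>b. length b = 3) (all_blocks Lp))) = 10"
  "list_all (\<lambda>b. length b \<le> 3) (all_blocks Lp)"
  by code_simp+

lemma rescaledI:
  assumes "ls = map2 (*s) cs ks" "length cs = length ks" "0 \<notin> set cs"
  shows "rescaled ls ks"
  unfolding rescaled_def list_all2_conv_all_nth
proof (intro conjI allI impI)
  show "length ls = length ks" using assms by simp
  fix i assume "i < length ls"
  then show "\<exists>c. c \<noteq> 0 \<and> ls ! i = c *s ks ! i"
    using assms by (intro exI[of _ "cs ! i"]) (auto simp: in_set_conv_nth)
qed

lemma ten_lines_q: "rescaled (ten_lines 31 17) (map cvec Lq)"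
  by (rule rescaledI[of _ "[1, 1, 1, 2, 2, 1, 1, 1, 1, 1]"])
    (simp_all add: ten_lines_def Lq_def cvec_def vec_eq_iff forall_3 vector_3)

lemma ten_lines_p: "rescaled (ten_lines (3 / 10) (2 / 7)) (map cvec Lp)"
  by (rule rescaledI[of _ "[1, 1, 1 / 10, 1 / 35, 1 / 35, 1 / 10, 1, 1 / 7, 1 / 7, 1]"])
    (simp_all add: ten_lines_def Lp_def cvec_def vec_eq_iff forall_3 vector_3)


section \<open>The two arrangements\<close>

text \<open>
  The identities between polynomials with explicit integer coefficients below are checked on
  coefficient lists: \<open>form d cs\<close> has the coefficients \<open>cs\<close> at the monomials of degree \<open>d\<close> in
  lexicographic order, and its arithmetic is done by the rewrite rules \<open>form_arith\<close>, which never
  expand a product into monomials. The variables are elements of an arbitrary ring.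
\<close>

definition monomial_exponents :: "nat \<Rightarrow> (nat \<times> nat) list" where
  "monomial_exponents d = concat (map (\<lambda>i. map (\<lambda>j. (i, j)) (rev [0..<Suc (d - i)])) (rev [0..<Suc d]))"

definition form :: "'a \<Rightarrow> 'a \<Rightarrow> 'a \<Rightarrow> nat \<Rightarrow> int list \<Rightarrow> 'a::comm_ring_1" where
  "form x y z d cs = sum_list (map2 (\<lambda>c (i, j). of_int c * (x ^ i * y ^ j * z ^ (d - i - j))) cs (monomial_exponents d))"

definition lin :: "'a \<Rightarrow> 'a \<Rightarrow> 'a \<Rightarrow> ivec \<Rightarrow> 'a::comm_ring_1" where
  "lin x y z = (\<lambda>(a, b, c). of_int a * x + of_int b * y + of_int c * z)"

lemma homogeneous_form: "homogeneous d (form (Var 1) (Var 2) (Var 3) d cs)"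
proof -
  let ?t = "\<lambda>c (i, j). of_int c * (Var 1 ^ i * Var 2 ^ j * Var 3 ^ (d - i - j)) :: S"
  have hom: "homogeneous d (?t c (i, j))" if "i + j \<le> d" for c i j
  proof -
    have "homogeneous (i * 1 + j * 1 + (d - i - j) * 1) (Var 1 ^ i * Var 2 ^ j * Var 3 ^ (d - i - j) :: S)"
      by (intro homogeneous_mult[OF _ _ refl] homogeneous_power homogeneous_Var)
    then have "homogeneous d (Var 1 ^ i * Var 2 ^ j * Var 3 ^ (d - i - j) :: S)" using that by simp
    then show ?thesis
      using homogeneous_mult[OF homogeneous_Const[of "of_int c"]] by simp
  qed
  have "homogeneous d p" if p: "p \<in> set (map2 ?t cs (monomial_exponents d))" for p
  proof -
    obtain c i j where cij: "(c, i, j) \<in> set (zip cs (monomial_exponents d))" "p = ?t c (i, j)" using p by auto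
    have "i + j \<le> d" using set_zip_rightD[OF cij(1)] by (auto simp: monomial_exponents_def)
    then show ?thesis unfolding cij(2) by (rule hom)
  qed
  moreover have "homogeneous d (sum_list ps)" if "\<And>p. p \<in> set ps \<Longrightarrow> homogeneous d p" for ps
    using that by (induction ps) (auto intro: homogeneous_add)
  ultimately show ?thesis unfolding form_def by blast
qed

lemma monomial_exponents_simps:
  "monomial_exponents 0 = [(0, 0)]"
  "monomial_exponents (Suc 0) = [(1, 0), (0, 1), (0, 0)]"
  "monomial_exponents 2 = [(2, 0), (1, 1), (1, 0), (0, 2), (0, 1), (0, 0)]"
  "monomial_exponents 3 = [(3, 0), (2, 1), (2, 0), (1, 2), (1, 1), (1, 0), (0, 3), (0, 2), (0, 1), (0, 0)]"
  "monomial_exponents 4 = [(4, 0), (3, 1), (3, 0), (2, 2), (2, 1), (2, 0), (1, 3), (1, 2), (1, 1), (1, 0),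
     (0, 4), (0, 3), (0, 2), (0, 1), (0, 0)]"
  "monomial_exponents 5 = [(5, 0), (4, 1), (4, 0), (3, 2), (3, 1), (3, 0), (2, 3), (2, 2), (2, 1), (2, 0),
     (1, 4), (1, 3), (1, 2), (1, 1), (1, 0), (0, 5), (0, 4), (0, 3), (0, 2), (0, 1), (0, 0)]"
  "monomial_exponents 6 = [(6, 0), (5, 1), (5, 0), (4, 2), (4, 1), (4, 0), (3, 3), (3, 2), (3, 1), (3,
     0), (2, 4), (2, 3), (2, 2), (2, 1), (2, 0), (1, 5), (1, 4), (1, 3), (1, 2), (1, 1), (1, 0), (0, 6),
     (0, 5), (0, 4), (0, 3), (0, 2), (0, 1), (0, 0)]"
  by code_simp+

lemma form_simps:
  "form x y z 0 [c0] = of_int c0"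
  "form x y z (Suc 0) [c0, c1, c2] = of_int c0 * (x) + of_int c1 * (y) + of_int c2 * (z)"
  "form x y z 2 [c0, c1, c2, c3, c4, c5] = of_int c0 * (x ^ 2) + of_int c1 * (x * y) + of_int c2 * (x *
    z) + of_int c3 * (y ^ 2) + of_int c4 * (y * z) + of_int c5 * (z ^ 2)"
  "form x y z 3 [c0, c1, c2, c3, c4, c5, c6, c7, c8, c9] = of_int c0 * (x ^ 3) + of_int c1 * (x ^ 2 * y)
    + of_int c2 * (x ^ 2 * z) + of_int c3 * (x * y ^ 2) + of_int c4 * (x * y * z) + of_int c5 * (x * z ^
    2) + of_int c6 * (y ^ 3) + of_int c7 * (y ^ 2 * z) + of_int c8 * (y * z ^ 2) + of_int c9 * (z ^ 3)"
  "form x y z 4 [c0, c1, c2, c3, c4, c5, c6, c7, c8, c9, c10, c11, c12, c13, c14] = of_int c0 * (x ^ 4) +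
    of_int c1 * (x ^ 3 * y) + of_int c2 * (x ^ 3 * z) + of_int c3 * (x ^ 2 * y ^ 2) + of_int c4 * (x ^ 2
    * y * z) + of_int c5 * (x ^ 2 * z ^ 2) + of_int c6 * (x * y ^ 3) + of_int c7 * (x * y ^ 2 * z) +
    of_int c8 * (x * y * z ^ 2) + of_int c9 * (x * z ^ 3) + of_int c10 * (y ^ 4) + of_int c11 * (y ^ 3 *
    z) + of_int c12 * (y ^ 2 * z ^ 2) + of_int c13 * (y * z ^ 3) + of_int c14 * (z ^ 4)"
  "form x y z 5 [c0, c1, c2, c3, c4, c5, c6, c7, c8, c9, c10, c11, c12, c13, c14, c15, c16, c17, c18,
    c19, c20] = of_int c0 * (x ^ 5) + of_int c1 * (x ^ 4 * y) + of_int c2 * (x ^ 4 * z) + of_int c3 * (x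
    ^ 3 * y ^ 2) + of_int c4 * (x ^ 3 * y * z) + of_int c5 * (x ^ 3 * z ^ 2) + of_int c6 * (x ^ 2 * y ^
    3) + of_int c7 * (x ^ 2 * y ^ 2 * z) + of_int c8 * (x ^ 2 * y * z ^ 2) + of_int c9 * (x ^ 2 * z ^ 3)
    + of_int c10 * (x * y ^ 4) + of_int c11 * (x * y ^ 3 * z) + of_int c12 * (x * y ^ 2 * z ^ 2) + of_int
    c13 * (x * y * z ^ 3) + of_int c14 * (x * z ^ 4) + of_int c15 * (y ^ 5) + of_int c16 * (y ^ 4 * z) +
    of_int c17 * (y ^ 3 * z ^ 2) + of_int c18 * (y ^ 2 * z ^ 3) + of_int c19 * (y * z ^ 4) + of_int c20 *
    (z ^ 5)"
  "form x y z 6 [c0, c1, c2, c3, c4, c5, c6, c7, c8, c9, c10, c11, c12, c13, c14, c15, c16, c17, c18,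
    c19, c20, c21, c22, c23, c24, c25, c26, c27] = of_int c0 * (x ^ 6) + of_int c1 * (x ^ 5 * y) + of_int
    c2 * (x ^ 5 * z) + of_int c3 * (x ^ 4 * y ^ 2) + of_int c4 * (x ^ 4 * y * z) + of_int c5 * (x ^ 4 * z
    ^ 2) + of_int c6 * (x ^ 3 * y ^ 3) + of_int c7 * (x ^ 3 * y ^ 2 * z) + of_int c8 * (x ^ 3 * y * z ^
    2) + of_int c9 * (x ^ 3 * z ^ 3) + of_int c10 * (x ^ 2 * y ^ 4) + of_int c11 * (x ^ 2 * y ^ 3 * z) +
    of_int c12 * (x ^ 2 * y ^ 2 * z ^ 2) + of_int c13 * (x ^ 2 * y * z ^ 3) + of_int c14 * (x ^ 2 * z ^
    4) + of_int c15 * (x * y ^ 5) + of_int c16 * (x * y ^ 4 * z) + of_int c17 * (x * y ^ 3 * z ^ 2) +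
    of_int c18 * (x * y ^ 2 * z ^ 3) + of_int c19 * (x * y * z ^ 4) + of_int c20 * (x * z ^ 5) + of_int
    c21 * (y ^ 6) + of_int c22 * (y ^ 5 * z) + of_int c23 * (y ^ 4 * z ^ 2) + of_int c24 * (y ^ 3 * z ^
    3) + of_int c25 * (y ^ 2 * z ^ 4) + of_int c26 * (y * z ^ 5) + of_int c27 * (z ^ 6)"
  by (simp_all add: form_def monomial_exponents_simps)

lemma form_add:
  assumes "length cs = length cs'"
  shows "form x y z d cs + form x y z d cs' = form x y z d (map2 (+) cs cs')"
    and "form x y z d cs - form x y z d cs' = form x y z d (map2 (-) cs cs')"
proof -
  let ?h = "\<lambda>c (i, j). of_int c * (x ^ i * y ^ j * z ^ (d - i - j))"
  have "sum_list (map2 ?h cs es) + sum_list (map2 ?h cs' es) = sum_list (map2 ?h (map2 (+) cs cs') es) \<and>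
      sum_list (map2 ?h cs es) - sum_list (map2 ?h cs' es) = sum_list (map2 ?h (map2 (-) cs cs') es)" for es
    using assms
  proof (induction cs cs' arbitrary: es rule: list_induct2)
    case (Cons c cs c' cs')
    show ?case
    proof (cases es)
      case (Cons e es')
      then show ?thesis using Cons.IH[of es'] by (auto simp: algebra_simps split: prod.split)
    qed simp
  qed simp
  then show "form x y z d cs + form x y z d cs' = form x y z d (map2 (+) cs cs')"
    "form x y z d cs - form x y z d cs' = form x y z d (map2 (-) cs cs')"
    unfolding form_def by blast+
qed

lemma form_scale: "of_int k * form x y z d cs = form x y z d (map ((*) k) cs)"
proof -
  let ?h = "\<lambda>c (i, j). of_int c * (x ^ i * y ^ j * z ^ (d - i - j))"
  have "of_int k * sum_list (map2 ?h cs es) = sum_list (map2 ?h (map ((*) k) cs) es)" for es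
  proof (induction cs arbitrary: es)
    case (Cons c cs)
    then show ?case by (cases es) (auto simp: algebra_simps)
  qed simp
  then show ?thesis unfolding form_def by blast
qed

lemma form_scale_simps:
  "numeral k * form x y z d cs = form x y z d (map ((*) (numeral k)) cs)"
  "form x y z d cs * numeral k = form x y z d (map ((*) (numeral k)) cs)"
  "- form x y z d cs = form x y z d (map ((*) (- 1)) cs)"
  using form_scale[of "numeral k" x y z d cs] form_scale[of "- 1" x y z d cs] by (simp_all add: mult.commute)

lemma form_constant: "form x y z 0 [c] = of_int c"
  by (simp add: form_def monomial_exponents_simps)

lemma form_mult:
  "form x y z (Suc 0) [a0, a1, a2] * form x y z (Suc 0) [b0, b1, b2] = form x y z 2 [a0 * b0, a0 * b1 +
    a1 * b0, a0 * b2 + a2 * b0, a1 * b1, a1 * b2 + a2 * b1, a2 * b2]"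
  "form x y z (Suc 0) [a0, a1, a2] * form x y z 2 [b0, b1, b2, b3, b4, b5] = form x y z 3 [a0 * b0, a0 *
    b1 + a1 * b0, a0 * b2 + a2 * b0, a0 * b3 + a1 * b1, a0 * b4 + a1 * b2 + a2 * b1, a0 * b5 + a2 * b2,
    a1 * b3, a1 * b4 + a2 * b3, a1 * b5 + a2 * b4, a2 * b5]"
  "form x y z 2 [a0, a1, a2, a3, a4, a5] * form x y z (Suc 0) [b0, b1, b2] = form x y z 3 [a0 * b0, a0 *
    b1 + a1 * b0, a0 * b2 + a2 * b0, a1 * b1 + a3 * b0, a1 * b2 + a2 * b1 + a4 * b0, a2 * b2 + a5 * b0,
    a3 * b1, a3 * b2 + a4 * b1, a4 * b2 + a5 * b1, a5 * b2]"
  "form x y z 2 [a0, a1, a2, a3, a4, a5] * form x y z 2 [b0, b1, b2, b3, b4, b5] = form x y z 4 [a0 * b0,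
    a0 * b1 + a1 * b0, a0 * b2 + a2 * b0, a0 * b3 + a1 * b1 + a3 * b0, a0 * b4 + a1 * b2 + a2 * b1 + a4 *
    b0, a0 * b5 + a2 * b2 + a5 * b0, a1 * b3 + a3 * b1, a1 * b4 + a2 * b3 + a3 * b2 + a4 * b1, a1 * b5 +
    a2 * b4 + a4 * b2 + a5 * b1, a2 * b5 + a5 * b2, a3 * b3, a3 * b4 + a4 * b3, a3 * b5 + a4 * b4 + a5 *
    b3, a4 * b5 + a5 * b4, a5 * b5]"
  "form x y z (Suc 0) [a0, a1, a2] * form x y z 3 [b0, b1, b2, b3, b4, b5, b6, b7, b8, b9] = form x y z 4
    [a0 * b0, a0 * b1 + a1 * b0, a0 * b2 + a2 * b0, a0 * b3 + a1 * b1, a0 * b4 + a1 * b2 + a2 * b1, a0 *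
    b5 + a2 * b2, a0 * b6 + a1 * b3, a0 * b7 + a1 * b4 + a2 * b3, a0 * b8 + a1 * b5 + a2 * b4, a0 * b9 +
    a2 * b5, a1 * b6, a1 * b7 + a2 * b6, a1 * b8 + a2 * b7, a1 * b9 + a2 * b8, a2 * b9]"
  "form x y z (Suc 0) [a0, a1, a2] * form x y z 4 [b0, b1, b2, b3, b4, b5, b6, b7, b8, b9, b10, b11, b12,
    b13, b14] = form x y z 5 [a0 * b0, a0 * b1 + a1 * b0, a0 * b2 + a2 * b0, a0 * b3 + a1 * b1, a0 * b4 +
    a1 * b2 + a2 * b1, a0 * b5 + a2 * b2, a0 * b6 + a1 * b3, a0 * b7 + a1 * b4 + a2 * b3, a0 * b8 + a1 *
    b5 + a2 * b4, a0 * b9 + a2 * b5, a0 * b10 + a1 * b6, a0 * b11 + a1 * b7 + a2 * b6, a0 * b12 + a1 * b8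
    + a2 * b7, a0 * b13 + a1 * b9 + a2 * b8, a0 * b14 + a2 * b9, a1 * b10, a1 * b11 + a2 * b10, a1 * b12
    + a2 * b11, a1 * b13 + a2 * b12, a1 * b14 + a2 * b13, a2 * b14]"
  "form x y z 2 [a0, a1, a2, a3, a4, a5] * form x y z 3 [b0, b1, b2, b3, b4, b5, b6, b7, b8, b9] = form x
    y z 5 [a0 * b0, a0 * b1 + a1 * b0, a0 * b2 + a2 * b0, a0 * b3 + a1 * b1 + a3 * b0, a0 * b4 + a1 * b2
    + a2 * b1 + a4 * b0, a0 * b5 + a2 * b2 + a5 * b0, a0 * b6 + a1 * b3 + a3 * b1, a0 * b7 + a1 * b4 + a2
    * b3 + a3 * b2 + a4 * b1, a0 * b8 + a1 * b5 + a2 * b4 + a4 * b2 + a5 * b1, a0 * b9 + a2 * b5 + a5 *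
    b2, a1 * b6 + a3 * b3, a1 * b7 + a2 * b6 + a3 * b4 + a4 * b3, a1 * b8 + a2 * b7 + a3 * b5 + a4 * b4 +
    a5 * b3, a1 * b9 + a2 * b8 + a4 * b5 + a5 * b4, a2 * b9 + a5 * b5, a3 * b6, a3 * b7 + a4 * b6, a3 *
    b8 + a4 * b7 + a5 * b6, a3 * b9 + a4 * b8 + a5 * b7, a4 * b9 + a5 * b8, a5 * b9]"
  "form x y z 2 [a0, a1, a2, a3, a4, a5] * form x y z 4 [b0, b1, b2, b3, b4, b5, b6, b7, b8, b9, b10,
    b11, b12, b13, b14] = form x y z 6 [a0 * b0, a0 * b1 + a1 * b0, a0 * b2 + a2 * b0, a0 * b3 + a1 * b1
    + a3 * b0, a0 * b4 + a1 * b2 + a2 * b1 + a4 * b0, a0 * b5 + a2 * b2 + a5 * b0, a0 * b6 + a1 * b3 + a3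
    * b1, a0 * b7 + a1 * b4 + a2 * b3 + a3 * b2 + a4 * b1, a0 * b8 + a1 * b5 + a2 * b4 + a4 * b2 + a5 *
    b1, a0 * b9 + a2 * b5 + a5 * b2, a0 * b10 + a1 * b6 + a3 * b3, a0 * b11 + a1 * b7 + a2 * b6 + a3 * b4
    + a4 * b3, a0 * b12 + a1 * b8 + a2 * b7 + a3 * b5 + a4 * b4 + a5 * b3, a0 * b13 + a1 * b9 + a2 * b8 +
    a4 * b5 + a5 * b4, a0 * b14 + a2 * b9 + a5 * b5, a1 * b10 + a3 * b6, a1 * b11 + a2 * b10 + a3 * b7 +
    a4 * b6, a1 * b12 + a2 * b11 + a3 * b8 + a4 * b7 + a5 * b6, a1 * b13 + a2 * b12 + a3 * b9 + a4 * b8 +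
    a5 * b7, a1 * b14 + a2 * b13 + a4 * b9 + a5 * b8, a2 * b14 + a5 * b9, a3 * b10, a3 * b11 + a4 * b10,
    a3 * b12 + a4 * b11 + a5 * b10, a3 * b13 + a4 * b12 + a5 * b11, a3 * b14 + a4 * b13 + a5 * b12, a4 *
    b14 + a5 * b13, a5 * b14]"
  "form x y z (Suc 0) [a0, a1, a2] * form x y z 5 [b0, b1, b2, b3, b4, b5, b6, b7, b8, b9, b10, b11, b12,
    b13, b14, b15, b16, b17, b18, b19, b20] = form x y z 6 [a0 * b0, a0 * b1 + a1 * b0, a0 * b2 + a2 *
    b0, a0 * b3 + a1 * b1, a0 * b4 + a1 * b2 + a2 * b1, a0 * b5 + a2 * b2, a0 * b6 + a1 * b3, a0 * b7 +
    a1 * b4 + a2 * b3, a0 * b8 + a1 * b5 + a2 * b4, a0 * b9 + a2 * b5, a0 * b10 + a1 * b6, a0 * b11 + a1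
    * b7 + a2 * b6, a0 * b12 + a1 * b8 + a2 * b7, a0 * b13 + a1 * b9 + a2 * b8, a0 * b14 + a2 * b9, a0 *
    b15 + a1 * b10, a0 * b16 + a1 * b11 + a2 * b10, a0 * b17 + a1 * b12 + a2 * b11, a0 * b18 + a1 * b13 +
    a2 * b12, a0 * b19 + a1 * b14 + a2 * b13, a0 * b20 + a2 * b14, a1 * b15, a1 * b16 + a2 * b15, a1 *
    b17 + a2 * b16, a1 * b18 + a2 * b17, a1 * b19 + a2 * b18, a1 * b20 + a2 * b19, a2 * b20]"
  by (simp_all add: form_simps algebra_simps power2_eq_square power_numeral_reduce)

lemma lin_eq_form: "lin x y z (a, b, c) = form x y z (Suc 0) [a, b, c]"
  by (simp add: lin_def form_simps)

lemmas form_arith = form_mult form_add form_scale_simps form_constant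

lemma linear_form_cvec: "linear_form (cvec l) = lin (Var 1) (Var 2) (Var 3) l"
  by (cases l) (simp add: linear_form_def cvec_def sum_3 vector_3 lin_def)

lemma defining_poly_cvec: "defining_poly (map cvec L) = prod_list (map (lin (Var 1) (Var 2) (Var 3)) L)"
  by (induction L) (simp_all add: linear_form_cvec)

lemma cvec_nth: "cvec l $ 1 = of_int (fst l)" "cvec l $ 2 = of_int (fst (snd l))" "cvec l $ 3 = of_int (snd (snd l))"
  by (cases l; simp add: cvec_def vector_3)+

lemma all_less_5: "(\<forall>i<5. R i) \<longleftrightarrow> R 0 \<and> R 1 \<and> R 2 \<and> R 3 \<and> R (4::nat)"
  by (auto simp: less_5_cases)

lemmas expand = form_simps algebra_simps power2_eq_square power_numeral_reduce

lemma cominor_swap: "i < j \<Longrightarrow> cominor B j i = - cominor B i j" and cominor_self: "cominor B i i = 0"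
  by (simp add: cominor_antisym[of B i]) (simp add: cominor_def)

text \<open>
  A certificate with integer coefficients for membership of a multiple \<open>N x\<close>; the integer \<open>N\<close> is
  invertible in the polynomial ring.
\<close>

lemma in_minor_idealI:
  fixes B :: "nat \<Rightarrow> nat \<Rightarrow> S"
  assumes "of_int N * x = e01 * cominor B 0 1 + e02 * cominor B 0 2 + e12 * cominor B 1 2
      + e03 * cominor B 0 3 + e13 * cominor B 1 3 + e23 * cominor B 2 3
      + e04 * cominor B 0 4 + e14 * cominor B 1 4 + e24 * cominor B 2 4 + e34 * cominor B 3 4" "N \<noteq> 0"
  shows "in_minor_ideal B x"
proof -
  define e where "e i j = Const (1 / of_int N) *
    [[], [e01], [e02, e12], [e03, e13, e23], [e04, e14, e24, e34]] ! j ! i" for i j :: nat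
  have "Const (1 / of_int N) * Const (of_int N) = 1"
    using assms(2) by (simp del: Const_of_int flip: Const_simps(6))
  then have "Const (1 / of_int N) * (of_int N * x) = x" by (simp flip: mult.assoc)
  then have "x = Const (1 / of_int N) * (of_int N * x)" by simp
  also have "\<dots> = (\<Sum>j<5. \<Sum>i<j. e i j * cominor B i j)"
    unfolding assms(1) e_def by (simp add: sum_lessThan_5 eval_nat_numeral algebra_simps)
  finally show ?thesis unfolding in_minor_ideal_def by blast
qed

text \<open>
  The data for \<open>(31, 17)\<close>. The columns of \<open>matrix_q\<close> are the relations among five generators of the
  pairs described above, found by linear algebra degree by degree and scaled to integer entries;
  \<open>vector_q\<close> and the vector with the single entry \<open>2207273\<close> are solutions \<open>v\<close> and \<open>w\<close> of
  \<open>a = M v\<close> and \<open>b = M w\<close> for these generators \<open>(a, b)\<close>, up to a common factor. The identities \<open>power_q\<close> give multiples of \<open>x\<^sup>5\<close>, \<open>y\<^sup>5\<close> and \<open>z\<^sup>5\<close> as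
  combinations of the maximal minors, with coefficients obtained by solving a linear system. The
  entry \<open>1\<close> of \<open>matrix_q\<close> in the last row is the constant by which the arrangement differs from the
  other one.
\<close>

definition matrix_q :: "'a \<Rightarrow> 'a \<Rightarrow> 'a \<Rightarrow> nat \<Rightarrow> nat \<Rightarrow> 'a::comm_ring_1" where
  "matrix_q x y z i c =
    [[0, form x y z 2 [- 270, - 255, - 4845, 0, - 4335, - 4335], form x y z 2 [2215666, 2353636, 37670395,
     0, 40011812, 69241]],
     [0, form x y z 2 [- 3533, - 260596, 1960447, - 3928568, 60581332, 64509900], form x y z 2 [- 4492749,
     61887060, - 44144705, 67153719, 11745874, 64419868]],
     [0, form x y z 2 [8123, 270796, - 1977787, 2094713, - 31165957, - 33260670], form x y z 2 [- 15515389,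
     - 54134312, - 245016659, - 73153453, 270183664, - 16146022]],
     [0, form x y z 1 [12736, 257281, - 1949992], form x y z 1 [- 2227120, - 6527943, 33293024]],
     [form x y z 0 [1], 0, 0]] ! i ! c"

definition vector_q :: "'a \<Rightarrow> 'a \<Rightarrow> 'a \<Rightarrow> nat \<Rightarrow> 'a::comm_ring_1" where
  "vector_q x y z i =
    [form x y z 2 [2207558, 4414801, 2212373, 2207273, 2211608, 4335], form x y z 2 [- 4533443, 53855759,
    56048497, 65732212, 1222312, - 64509900], form x y z 2 [- 15336859, - 62327498, - 44625709, - 50654719,
    - 17394049, 33260670], form x y z 1 [- 1975464, - 257281, 1949992], 0] ! i"

lemmas matrix_q_nth =
  matrix_q_def[of _ _ _ 0 0, simplified] matrix_q_def[of _ _ _ 0 1, simplified] matrix_q_def[of _ _ _ 0 2,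
  simplified] matrix_q_def[of _ _ _ 1 0, simplified] matrix_q_def[of _ _ _ 1 1, simplified] matrix_q_def[of
  _ _ _ 1 2, simplified] matrix_q_def[of _ _ _ 2 0, simplified] matrix_q_def[of _ _ _ 2 1, simplified]
  matrix_q_def[of _ _ _ 2 2, simplified] matrix_q_def[of _ _ _ 3 0, simplified] matrix_q_def[of _ _ _ 3 1,
  simplified] matrix_q_def[of _ _ _ 3 2, simplified] matrix_q_def[of _ _ _ 4 0, simplified] matrix_q_def[of
  _ _ _ 4 1, simplified] matrix_q_def[of _ _ _ 4 2, simplified]

lemmas vector_q_nth =
  vector_q_def[of _ _ _ 0, simplified] vector_q_def[of _ _ _ 1, simplified] vector_q_def[of _ _ _ 2,
  simplified] vector_q_def[of _ _ _ 3, simplified] vector_q_def[of _ _ _ 4, simplified]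

lemma cominor_q:
  fixes x y z :: "'a::comm_ring_1"
  shows "cominor (matrix_q x y z) 0 1 =
    form x y z 3 [179513098544, 4025147726432, - 22459144040472, 8426494233892, 45372421257056, -
    469345895868024, 5146826475934, 61027149638603, - 289475148465288, - 1138832898297904]"
    and "cominor (matrix_q x y z) 0 2 =
    form x y z 3 [- 65088066224, - 971147145448, 12682372621560, 6327086250856, 24508340977304,
    165304352497480, - 8368091997585, 398338166258054, - 1602149142366368, - 2273347876178656]"
    and "cominor (matrix_q x y z) 0 3 =
    form x y z 4 [91310469464, 4948414705964, - 38078567090384, 67425658829193, - 988937180900655, -
    1718445271179376, 83913235459100, - 379911416421273, - 17113366979363243, - 17178527278596168,
    146720546357657, - 3424862835872627, 14177103013417508, 18849756102021552, 1101069706373760]"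
    and "cominor (matrix_q x y z) 0 4 =
    0"
    and "cominor (matrix_q x y z) 1 2 =
    form x y z 3 [- 27617399776, - 597694212032, 3842562103872, - 603881198251, - 5579103234800,
    73304436897384, 0, - 10265980370267, 77888872285648, - 9305862968]"
    and "cominor (matrix_q x y z) 1 3 =
    form x y z 4 [13808699888, 600539386929, - 4217445350192, 5244983906244, - 63501403344318, -
    149456715077552, 4911537795953, 15870182506350, - 1331425409316158, - 1254219895507672, 0,
    83496142531201, - 1246007246296566, - 1331876383884607, - 2372995056840]"
    and "cominor (matrix_q x y z) 1 4 =
    0"
    and "cominor (matrix_q x y z) 2 3 =
    form x y z 4 [9040990208, 570145237719, - 4176919817912, 9283829968914, - 129156341420178, -
    216566996533232, 9229294874903, 15234587209635, - 2512528770869663, - 2430369904685512, 0,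
    156898012873351, - 2424038878452351, - 2585682881439382, - 4745990113680]"
    and "cominor (matrix_q x y z) 2 4 =
    0"
    and "cominor (matrix_q x y z) 3 4 =
    0"
  by (simp_all add: cominor_def other_rows_def det3_def matrix_q_nth form_arith)

lemma power_q_1:
  fixes x y z :: "'a::comm_ring_1"
  shows "of_int (- 701782365567526555176846652204800) * x ^ 5 =
      form x y z 2 [- 7581296458425869972623, - 15658506174511125948805, - 34873022644905197351843, -
      8273801310792560896467, 21174371277997723695690, 58065038427049571351158] * cominor (matrix_q x y z)
      0 1 +
      form x y z 2 [12063292020054273424555, - 22980319260220657648549, 227051357775275800407542, -
      34000053851934031264409, 176441962321691149363820, - 30703754902124327923235] * cominor (matrix_q x y
      z) 0 2 +
      form x y z 2 [- 14039215787507869575809, - 162608367705687554640550, - 606478267522259049769077, -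
      1195226699172861952775846, - 881672662822885304013813, 779439557032891593585416] * cominor (matrix_q
      x y z) 1 2 +
      form x y z 1 [- 2029384260069508983314, - 1648928966792916977991, - 4012096713926143261841] * cominor
      (matrix_q x y z) 0 3 +
      form x y z 1 [107942058483720940136437, - 908849044289895217686176, - 13905564248988636975796] *
      cominor (matrix_q x y z) 1 3 +
      form x y z 1 [- 27499874246527337583739, 471468459112150513400751, - 151267419492153305284066] *
      cominor (matrix_q x y z) 2 3 +
      0 * cominor (matrix_q x y z) 0 4 +
      0 * cominor (matrix_q x y z) 1 4 +
      0 * cominor (matrix_q x y z) 2 4 +
      0 * cominor (matrix_q x y z) 3 4"
  by (simp add: cominor_q[unfolded One_nat_def] form_arith) (simp add: form_simps)

lemma power_q_2:
  fixes x y z :: "'a::comm_ring_1"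
  shows "of_int (12256519361142231360139380398467425) * y ^ 5 =
      form x y z 2 [- 19789405044571600847484, - 53771529989839063813340, - 340932941896955476673754, -
      12053425445093968340171, - 15342610515720599925790, 331634443008770537093714] * cominor (matrix_q x y
      z) 0 1 +
      form x y z 2 [56045644406521763193918, - 286262603493537993802924, 1109445988895023269494361, -
      339741855130920506567227, 732951691712394919150921, - 178009259410912052407997] * cominor (matrix_q x
      y z) 0 2 +
      form x y z 2 [- 253904169081907453917277, 1518918096951439922371084, - 3328876048809605347138669, -
      8381967055709444448567709, - 4894941053592992123789470, 4224960787461823959949152] * cominor
      (matrix_q x y z) 1 2 +
      form x y z 1 [- 21043151494294863649712, - 18870551939255357206208, - 27306000772069190841688] *
      cominor (matrix_q x y z) 0 3 +
      form x y z 1 [17393245577766264230048, - 770903113717316437858594, 649913345177605942638944] *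
      cominor (matrix_q x y z) 1 3 +
      form x y z 1 [206777021204367923293840, 382259353955147681874757, - 979060277795630747689280] *
      cominor (matrix_q x y z) 2 3 +
      0 * cominor (matrix_q x y z) 0 4 +
      0 * cominor (matrix_q x y z) 1 4 +
      0 * cominor (matrix_q x y z) 2 4 +
      0 * cominor (matrix_q x y z) 3 4"
  by (simp add: cominor_q[unfolded One_nat_def] form_arith) (simp add: form_simps)

lemma power_q_3:
  fixes x y z :: "'a::comm_ring_1"
  shows "of_int (795353347643196762533759539165440) * z ^ 5 =
      form x y z 2 [4595150734433870, 13688312929557415, 133594954906392483, - 1284928398194515,
      376447889150604468, - 325943963319657285] * cominor (matrix_q x y z) 0 1 +
      form x y z 2 [11770989145443734, - 16059432343878950, 208980338377608147, - 31234649853051244,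
      247615202393602368, - 185249473944317757] * cominor (matrix_q x y z) 0 2 +
      form x y z 2 [8749773527550528, 577403188358953830, 516130629544423290, - 36476116267751178,
      643240622266192317, - 616171846841811666] * cominor (matrix_q x y z) 1 2 +
      form x y z 1 [- 1570267652482958, - 1736369760797890, 1724710082804697] * cominor (matrix_q x y z) 0
      3 +
      form x y z 1 [8988189128213387, 4441034716604963, - 252086679705181724] * cominor (matrix_q x y z) 1
      3 +
      form x y z 1 [22361913190754715, 36391617460052991, - 109182818793362998] * cominor (matrix_q x y z)
      2 3 +
      0 * cominor (matrix_q x y z) 0 4 +
      0 * cominor (matrix_q x y z) 1 4 +
      0 * cominor (matrix_q x y z) 2 4 +
      0 * cominor (matrix_q x y z) 3 4"
  by (simp add: cominor_q[unfolded One_nat_def] form_arith) (simp add: form_simps)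

lemma discriminant_q:
  fixes x y z :: "'a::comm_ring_1"
  shows "(\<Sum>i<5. vector_q x y z i * (\<Sum>m<5. cominor (matrix_q x y z) i m * (if m = 3 then of_int 2207273 else 0))) =
    of_int (10753953461807855417) * prod_list (map (lin x y z) (take 6 (drop 1 Lq)))"
  by (simp add: sum_lessThan_5 cominor_q[unfolded One_nat_def] cominor_swap[of 3 4] cominor_self vector_q_nth Lq_def lin_eq_form form_arith)

lemma tangent_q:
  fixes x y z :: "'a::comm_ring_1"
  assumes "l \<in> set (take 6 (drop 1 Lq))"
  shows "\<exists>s r. \<forall>i<5. of_int (fst l) * lin x y z (Lq ! 8) * vector_q x y z i
      + of_int (fst (snd l)) * (y * lin x y z (Lq ! 7)) * (if i = 3 then of_int 2207273 else 0) =
    (\<Sum>c<3. matrix_q x y z i c * s c) + lin x y z l * r i"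
proof -
  have "l \<in> set [(1, 1, 1), (1, 31, - 510), (8, 263, - 4080), (8, 263, 8), (1, 31, 31), (1, 1, 0)]"
    using assms by (simp add: Lq_def)
  then show ?thesis
    unfolding list.set insert_iff empty_iff
  proof (elim disjE FalseE)
    assume "l = (1, 1, 1)"
    then show ?thesis
      by (intro exI[of _ "(!)
        [0, form x y z 1 [16, 18, - 16], 0]"]
          exI[of _ "(!)
        [form x y z 2 [2211878, 2211863, 37602181, 0, 37601671, 4335], form x y z 2 [- 4476915, 62565804, -
        47966799, 70714224, - 106587684, - 64509900], form x y z 2 [- 15466827, - 51339621, - 258110925, -
        37704834, - 228922755, 33260670], form x y z 1 [- 2179240, - 2423785, 1949992], 0]"])
        (simp add: all_less_5 sum_lessThan_3 vector_q_nth matrix_q_nth Lq_def lin_def expand)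
  next
    assume "l = (1, 31, - 510)"
    then show ?thesis
      by (intro exI[of _ "(!)
        [0, form x y z 1 [14, 46, - 17], form x y z 1 [1, 1, 0]]"]
          exI[of _ "(!)
        [form x y z 2 [- 4328, - 4343, - 73576, 0, - 73831, 0], form x y z 2 [8768, 502, 90032, 3663239,
        3884732, 0], form x y z 2 [64808, 1148353, 543536, - 748495, - 1412974, 0], form x y z 1 [73352,
        2036080, 0], 0]"])
        (simp add: all_less_5 sum_lessThan_3 vector_q_nth matrix_q_nth Lq_def lin_def expand)
  next
    assume "l = (8, 263, - 4080)"
    then show ?thesis
      by (intro exI[of _ "(!)
        [0, form x y z 1 [112, 128, - 136], form x y z 1 [8, 8, 0]]"]
          exI[of _ "(!)
        [form x y z 2 [- 4328, - 4328, - 73576, 0, - 73576, 0], form x y z 2 [8768, - 121928, 90032, -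
        130696, 90032, 0], form x y z 2 [64808, 1270528, 543536, 1205720, 543536, 0], form x y z 1 [73352,
        2280625, 0], 0]"])
        (simp add: all_less_5 sum_lessThan_3 vector_q_nth matrix_q_nth Lq_def lin_def expand)
  next
    assume "l = (8, 263, 8)"
    then show ?thesis
      by (intro exI[of _ "(!)
        [0, form x y z 1 [112, 128, - 144], form x y z 1 [8, 8, 8]]"]
          exI[of _ "(!)
        [form x y z 2 [- 4328, - 4328, - 77904, 0, - 73576, - 73576], form x y z 2 [8768, - 121928, 98800,
        - 130696, - 40664, 90032], form x y z 2 [64808, 1270528, - 17049840, 1205720, - 15908928, -
        17114648], form x y z 1 [73352, 2280625, - 35243016], 0]"])
        (simp add: all_less_5 sum_lessThan_3 vector_q_nth matrix_q_nth Lq_def lin_def expand)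
  next
    assume "l = (1, 31, 31)"
    then show ?thesis
      by (intro exI[of _ "(!)
        [0, form x y z 1 [22, 294, - 250], form x y z 1 [2, 32, 32]]"]
          exI[of _ "(!)
        [form x y z 2 [- 2217834, - 2355939, - 37709299, 0, - 40050963, - 104057], form x y z 2 [4529781, -
        59801790, 26601049, - 32061936, - 619563644, 418366804], form x y z 2 [15515213, 53116297,
        245743915, 55647254, 25655089, - 233324626], form x y z 1 [2198584, 6505775, - 49023384], 0]"])
        (simp add: all_less_5 sum_lessThan_3 vector_q_nth matrix_q_nth Lq_def lin_def expand)
  next
    assume "l = (1, 1, 0)"
    then show ?thesis
      by (intro exI[of _ "(!)
        [0, form x y z 1 [17, 19, - 17], 0]"]
          exI[of _ "(!)
        [form x y z 2 [2212148, 2212118, 39818634, 0, 37606006, 37606006], form x y z 2 [- 4473382,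
        62826400, - 54407694, 74642792, - 100383360, - 175026152], form x y z 2 [- 15474950, - 51610417, -
        271591842, - 39799547, - 233366919, - 193567372], form x y z 1 [- 2191976, - 2681066, 1733480], 0]"])
        (simp add: all_less_5 sum_lessThan_3 vector_q_nth matrix_q_nth Lq_def lin_def expand)
  qed
qed

text \<open>
  The same data for \<open>(3/10, 2/7)\<close>, with the single entry \<open>421\<close> of the second vector. Here the
  matrix has no constant entries except zero.
\<close>

definition matrix_p :: "'a \<Rightarrow> 'a \<Rightarrow> 'a \<Rightarrow> nat \<Rightarrow> nat \<Rightarrow> 'a::comm_ring_1" where
  "matrix_p x y z i c =
    [[form x y z 1 [- 12, 16, 1], form x y z 2 [- 338, - 127, - 98, 57, 24, - 93], form x y z 2 [2237,
     1958, 1464, 1450, 1250, 118]],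
     [form x y z 1 [2, 2, - 3], form x y z 2 [- 52, - 116, 40, - 64, 58, 57], form x y z 2 [- 547, - 956, -
     248, - 409, - 455, 24]],
     [form x y z 1 [- 7, 0, - 2], form x y z 2 [182, 224, 185, 0, 64, 38], form x y z 2 [441, - 42, 182, 0,
     - 12, 16]],
     [0, form x y z 1 [- 110, 86, 15], form x y z 1 [147, 252, 111]],
     [0, form x y z 1 [- 1125, - 460, - 325], form x y z 1 [- 1080, - 408, - 300]]] ! i ! c"

definition vector_p :: "'a \<Rightarrow> 'a \<Rightarrow> 'a \<Rightarrow> nat \<Rightarrow> 'a::comm_ring_1" where
  "vector_p x y z i =
    [form x y z 2 [- 1583, - 837, 715, 32, 773, 114], form x y z 2 [1123, 2134, 1301, 1011, 1469, 258],
    form x y z 2 [911, 1724, 1163, 421, 673, 172], form x y z 1 [- 423, 166, 96], form x y z 1 [745, 52,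
    25]] ! i"

lemmas matrix_p_nth =
  matrix_p_def[of _ _ _ 0 0, simplified] matrix_p_def[of _ _ _ 0 1, simplified] matrix_p_def[of _ _ _ 0 2,
  simplified] matrix_p_def[of _ _ _ 1 0, simplified] matrix_p_def[of _ _ _ 1 1, simplified] matrix_p_def[of
  _ _ _ 1 2, simplified] matrix_p_def[of _ _ _ 2 0, simplified] matrix_p_def[of _ _ _ 2 1, simplified]
  matrix_p_def[of _ _ _ 2 2, simplified] matrix_p_def[of _ _ _ 3 0, simplified] matrix_p_def[of _ _ _ 3 1,
  simplified] matrix_p_def[of _ _ _ 3 2, simplified] matrix_p_def[of _ _ _ 4 0, simplified] matrix_p_def[of
  _ _ _ 4 1, simplified] matrix_p_def[of _ _ _ 4 2, simplified]

lemmas vector_p_nth =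
  vector_p_def[of _ _ _ 0, simplified] vector_p_def[of _ _ _ 1, simplified] vector_p_def[of _ _ _ 2,
  simplified] vector_p_def[of _ _ _ 3, simplified] vector_p_def[of _ _ _ 4, simplified]

lemma cominor_p:
  fixes x y z :: "'a::comm_ring_1"
  shows "cominor (matrix_p x y z) 0 1 =
    form x y z 3 [- 1989225, - 2121840, - 1894500, - 565824, - 1313520, - 599925, 0, - 161664, - 202080, -
    63150]"
    and "cominor (matrix_p x y z) 0 2 =
    form x y z 3 [- 568350, - 1174590, 473625, - 767904, 328380, 505200, - 161664, 40416, 239970, 94725]"
    and "cominor (matrix_p x y z) 0 3 =
    form x y z 4 [- 3315375, - 7986370, - 5220400, - 6026615, - 8868365, - 2178675, - 1355620, - 4035285, -
    2839645, - 273650, 0, - 387320, - 660970, - 273650, 0]"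
    and "cominor (matrix_p x y z) 0 4 =
    form x y z 4 [324170, 394898, 372585, - 182714, 95146, 35785, - 253442, - 349851, - 49257, - 12630, 0,
    - 72412, - 85042, - 12630, 0]"
    and "cominor (matrix_p x y z) 1 2 =
    form x y z 3 [- 3410100, 909360, - 1989225, 3879936, 2121840, - 189450, 1293312, 1697472, 606240,
    31575]"
    and "cominor (matrix_p x y z) 1 3 =
    form x y z 4 [- 16576875, - 31267670, - 23007650, - 16414790, - 29592090, - 10657615, - 2734816, -
    9965070, - 8884784, - 1995540, 0, - 781376, - 1507180, - 852104, - 126300]"
    and "cominor (matrix_p x y z) 1 4 =
    form x y z 4 [471520, 203343, 267335, - 368375, - 298489, - 324591, 188608, 3789, - 172610, - 174294,
    0, 53888, 31154, - 20208, - 20208]"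
    and "cominor (matrix_p x y z) 2 3 =
    form x y z 4 [947250, - 7556950, 8735750, - 21546780, 2660720, 7308560, - 16922516, - 12324775,
    4959801, 2067110, - 3879936, - 5816536, - 1111019, 1015031, 189450]"
    and "cominor (matrix_p x y z) 2 4 =
    form x y z 4 [- 421000, 256810, - 597820, 1168696, 575507, - 44626, - 34522, 530881, 1263, 128826, -
    525408, - 766220, - 210500, 3789, 30312]"
    and "cominor (matrix_p x y z) 3 4 =
    form x y z 5 [- 1915550, - 4111065, - 3346950, - 798637, - 4077385, - 1902078, 3073721, 2406436, -
    1088706, - 532986, 1676843, 3615969, 1595590, - 292174, - 62308, 0, 479098, 782218, 240812, - 62308, 0]"
  by (simp_all add: cominor_def other_rows_def det3_def matrix_p_nth form_arith)

lemma power_p_1: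
  fixes x y z :: "'a::comm_ring_1"
  shows "of_int (- 265419053291700) * x ^ 5 =
      form x y z 2 [225154543, - 54303319, - 51108612, - 105026360, - 4214389, - 561586511] * cominor
      (matrix_p x y z) 0 1 +
      form x y z 2 [26971270, - 82092542, 153114712, - 133291358, 134315806, 251155272] * cominor (matrix_p
      x y z) 0 2 +
      form x y z 2 [513382126, 249734558, 14070719, - 279475996, - 357572782, - 41390834] * cominor
      (matrix_p x y z) 1 2 +
      form x y z 1 [89394497, 141214618, - 628022007] * cominor (matrix_p x y z) 0 3 +
      form x y z 1 [- 132834794, 133363334, 191463435] * cominor (matrix_p x y z) 1 3 +
      form x y z 1 [34802259, - 81750156, - 129135540] * cominor (matrix_p x y z) 2 3 +
      form x y z 1 [203164245, 266027164, - 1101665540] * cominor (matrix_p x y z) 0 4 +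
      form x y z 1 [24454515, 203802698, 163911680] * cominor (matrix_p x y z) 1 4 +
      form x y z 1 [153819885, - 43234728, - 197580780] * cominor (matrix_p x y z) 2 4 +
      form x y z 0 [1425600] * cominor (matrix_p x y z) 3 4"
  by (simp add: cominor_p[unfolded One_nat_def] form_arith) (simp add: form_simps)

lemma power_p_2:
  fixes x y z :: "'a::comm_ring_1"
  shows "of_int (- 84934097053344) * y ^ 5 =
      form x y z 2 [170914138, - 59040123, 33306840, - 62052310, - 143089426, 45148225] * cominor (matrix_p
      x y z) 0 1 +
      form x y z 2 [27789093, 39721274, - 35348068, 73709827, - 45482750, - 53786684] * cominor (matrix_p x
      y z) 0 2 +
      form x y z 2 [324168899, 62311262, 346561169, - 397471290, - 4366926, 109018230] * cominor (matrix_p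
      x y z) 1 2 +
      form x y z 1 [- 82121542, - 116779381, - 78779861] * cominor (matrix_p x y z) 0 3 +
      form x y z 1 [- 84517748, 251842689, - 27009864] * cominor (matrix_p x y z) 1 3 +
      form x y z 1 [- 72025935, - 88399264, - 20965280] * cominor (matrix_p x y z) 2 3 +
      form x y z 1 [- 9568686, - 136944109, 220208168] * cominor (matrix_p x y z) 0 4 +
      form x y z 1 [- 65732719, 843786843, - 240012029] * cominor (matrix_p x y z) 1 4 +
      form x y z 1 [57991424, - 186622645, 7065414] * cominor (matrix_p x y z) 2 4 +
      form x y z 0 [44550000] * cominor (matrix_p x y z) 3 4"
  by (simp add: cominor_p[unfolded One_nat_def] form_arith) (simp add: form_simps)

lemma power_p_3:
  fixes x y z :: "'a::comm_ring_1"
  shows "of_int (15792173100) * z ^ 5 =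
      form x y z 2 [3718095, - 2144915, 1221433, - 2101476, 1885397, - 15441435] * cominor (matrix_p x y z)
      0 1 +
      form x y z 2 [- 1535262, - 3342209, 5114447, - 4366028, 4623251, 8368427] * cominor (matrix_p x y z)
      0 2 +
      form x y z 2 [11019967, 4379801, 287250, - 10310931, - 12329628, - 1039213] * cominor (matrix_p x y
      z) 1 2 +
      form x y z 1 [4433029, 4973684, - 17388978] * cominor (matrix_p x y z) 0 3 +
      form x y z 1 [- 3764534, 3543242, 4561599] * cominor (matrix_p x y z) 1 3 +
      form x y z 1 [448810, - 2835352, - 4137711] * cominor (matrix_p x y z) 2 3 +
      form x y z 1 [5351010, 8059128, - 30914100] * cominor (matrix_p x y z) 0 4 +
      form x y z 1 [- 2621335, 6573592, 8201855] * cominor (matrix_p x y z) 1 4 +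
      form x y z 1 [4269020, - 3099376, - 6382230] * cominor (matrix_p x y z) 2 4 +
      form x y z 0 [1425600] * cominor (matrix_p x y z) 3 4"
  by (simp add: cominor_p[unfolded One_nat_def] form_arith) (simp add: form_simps)

lemma discriminant_p:
  fixes x y z :: "'a::comm_ring_1"
  shows "(\<Sum>i<5. vector_p x y z i * (\<Sum>m<5. cominor (matrix_p x y z) i m * (if m = 3 then of_int 421 else 0))) =
    of_int (- 74618461) * prod_list (map (lin x y z) (take 6 (drop 1 Lp)))"
  by (simp add: sum_lessThan_5 cominor_p[unfolded One_nat_def] cominor_swap[of 3 4] cominor_self vector_p_nth Lp_def lin_eq_form form_arith)

lemma tangent_p:
  fixes x y z :: "'a::comm_ring_1"
  assumes "l \<in> set (take 6 (drop 1 Lp))"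
  shows "\<exists>s r. \<forall>i<5. of_int (fst l) * lin x y z (Lp ! 8) * vector_p x y z i
      + of_int (fst (snd l)) * (y * lin x y z (Lp ! 7)) * (if i = 3 then of_int 421 else 0) =
    (\<Sum>c<3. matrix_p x y z i c * s c) + lin x y z l * r i"
proof -
  have "l \<in> set [(1, 1, 1), (10, 3, 2), (- 25, - 32, - 5), (- 25, - 32, - 25), (10, 3, 3), (1, 1, 0)]"
    using assms by (simp add: Lp_def)
  then show ?thesis
    unfolding list.set insert_iff empty_iff
  proof (elim disjE FalseE)
    assume "l = (1, 1, 1)"
    then show ?thesis
      by (intro exI[of _ "(!)
        [form x y z 2 [- 1769, - 1168, - 1007, - 1065, - 1108, - 153], form x y z 1 [8, - 13, - 7], form x
        y z 1 [- 16, 12, 4]]"]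
          exI[of _ "(!)
        [form x y z 2 [6187, 3348, - 1769, 381, - 1613, - 742], form x y z 2 [3063, 9269, 2533, 6206, 2239,
        360], form x y z 2 [- 406, - 1092, 724, 0, - 312, 240], form x y z 1 [271, 1041, - 147], form x y z
        1 [- 3065, - 1084, - 1025]]"])
        (simp add: all_less_5 sum_lessThan_3 vector_p_nth matrix_p_nth Lp_def lin_def expand)
  next
    assume "l = (10, 3, 2)"
    then show ?thesis
      by (intro exI[of _ "(!)
        [form x y z 2 [- 2940, - 1730, - 2834, - 2857, - 3368, - 364], form x y z 1 [40, - 51, 2], form x y
        z 1 [- 60, 31, 4]]"]
          exI[of _ "(!)
        [form x y z 2 [165, 317, 7048, 1223, 3833, 1179], form x y z 2 [5375, 10418, 8544, 5043, 9042,
        1929], form x y z 2 [6237, 7399, 6283, 0, 2114, 1286], form x y z 1 [- 1639, 1805, 723], form x y z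
        1 [3235, - 3604, 1175]]"])
        (simp add: all_less_5 sum_lessThan_3 vector_p_nth matrix_p_nth Lp_def lin_def expand)
  next
    assume "l = (- 25, - 32, - 5)"
    then show ?thesis
      by (intro exI[of _ "(!)
        [form x y z 2 [18900, - 8902, 12620, 9137, 517, 1555], form x y z 1 [- 125, 316, - 10], form x y z
        1 [300, - 302, 20]]"]
          exI[of _ "(!)
        [form x y z 2 [8381, - 7382, 14844, - 8553, - 8741, 2109], form x y z 2 [3069, 6868, 5888, 3799,
        4793, 1629], form x y z 2 [5467, 2912, 5363, 0, 832, 1086], form x y z 1 [- 647, 1418, 1374], form
        x y z 1 [- 2120, - 692, - 300]]"])
        (simp add: all_less_5 sum_lessThan_3 vector_p_nth matrix_p_nth Lp_def lin_def expand)
  next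
    assume "l = (- 25, - 32, - 25)"
    then show ?thesis
      by (intro exI[of _ "(!)
        [form x y z 2 [21375, - 8084, - 2775, 6129, 5695, - 1275], form x y z 1 [- 175, 252, 200], form x y
        z 1 [350, - 238, - 150]]"]
          exI[of _ "(!)
        [form x y z 2 [12343, - 500, - 3261, - 7271, - 6779, - 1275], form x y z 2 [2277, 5198, 5403, 2921,
        4437, 981], form x y z 2 [5292, 3038, 3801, 0, 868, 654], form x y z 1 [- 133, 1750, - 354], form x
        y z 1 [- 2030, - 588, - 750]]"])
        (simp add: all_less_5 sum_lessThan_3 vector_p_nth matrix_p_nth Lp_def lin_def expand)
  next
    assume "l = (10, 3, 3)"
    then show ?thesis
      by (intro exI[of _ "(!)
        [form x y z 2 [- 2970, - 1729, - 2535, - 2854, - 4092, - 630], form x y z 1 [60, - 45, - 41], form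
        x y z 1 [- 70, 28, 18]]"]
          exI[of _ "(!)
        [form x y z 2 [3042, 2589, 3605, 2543, 1218, - 1009], form x y z 2 [4938, 9698, 8283, 4760, 8550,
        1725], form x y z 2 [6293, 6916, 5823, 0, 1976, 1150], form x y z 1 [- 1272, 1885, 179], form x y z
        1 [4405, - 3092, - 2475]]"])
        (simp add: all_less_5 sum_lessThan_3 vector_p_nth matrix_p_nth Lp_def lin_def expand)
  next
    assume "l = (1, 1, 0)"
    then show ?thesis
      by (intro exI[of _ "(!)
        [form x y z 2 [- 1774, - 1205, - 1334, - 1097, - 1169, - 194], form x y z 1 [7, - 14, - 2], form x
        y z 1 [- 15, 13, 2]]"]
          exI[of _ "(!)
        [form x y z 2 [3552, 959, 5101, - 500, 1165, 531], form x y z 2 [3568, 10183, 5689, 6615, 8486,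
        1331], form x y z 2 [- 700, - 1050, - 2006, 0, - 300, - 516], form x y z 1 [14, 875, 872], form x y
        z 1 [- 3110, - 1136, - 650]]"])
        (simp add: all_less_5 sum_lessThan_3 vector_p_nth matrix_p_nth Lp_def lin_def expand)
  qed
qed


subsection \<open>The resolutions\<close>

lemma homogeneous_int_form: "d = int e \<Longrightarrow> homogeneous_int d (form (Var 1) (Var 2) (Var 3) e cs)"
  by (simp add: homogeneous_form)

lemma homogeneous_int_of_int: "homogeneous_int 0 (of_int k)"
  using homogeneous_int_Const[of "of_int k"] by simp

lemma lookup_0_form: "d \<noteq> 0 \<Longrightarrow> lookup (form (Var 1) (Var 2) (Var 3) d cs) 0 = 0"
  by (rule lookup_0_homogeneous[OF homogeneous_form])

lemma lines_q: "vector [0, 1, 0] # map cvec (take 6 (drop 1 Lq)) @ [cvec (Lq ! 7), cvec (Lq ! 8), vector [0, 0, 1]] = map cvec Lq"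
  by (simp add: Lq_def cvec_def)

lemma lines_p: "vector [0, 1, 0] # map cvec (take 6 (drop 1 Lp)) @ [cvec (Lp ! 7), cvec (Lp ! 8), vector [0, 0, 1]] = map cvec Lp"
  by (simp add: Lp_def cvec_def)

lemma indexed_q: "indexed_arrangement (map cvec Lq)" and indexed_p: "indexed_arrangement (map cvec Lp)"
  by (rule indexed_arrangement_cvec[OF general_Lq] indexed_arrangement_cvec[OF general_Lp]; simp add: Lq_def Lp_def)+

lemma resolution_q: "\<exists>g. AR_resolution (defining_poly (map cvec Lq)) [6, 6, 6, 7, 7] [7, 8, 8] g (matrix_q (Var 1) (Var 2) (Var 3))"
proof -
  interpret fibred_arrangement "map cvec (take 6 (drop 1 Lq))" "cvec (Lq ! 7)" "cvec (Lq ! 8)"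
    "[6, 6, 6, 7, 7]" "[7, 8, 8]" "matrix_q (Var 1) (Var 2) (Var 3)" "vector_q (Var 1) (Var 2) (Var 3)" "\<lambda>i. if i = 3 then of_int 2207273 else 0" 5 "of_int 10753953461807855417"
  proof
    show "line_arrangement (vector [0, 1, 0] # map cvec (take 6 (drop 1 Lq)) @ [cvec (Lq ! 7), cvec (Lq ! 8), vector [0, 0, 1]])"
      unfolding lines_q by (rule indexed_arrangement_line_arrangement[OF indexed_q])
    show "l $ 1 \<noteq> 0" if "l \<in> set (map cvec (take 6 (drop 1 Lq)))" for l
      using that by (auto simp: Lq_def cvec_nth)
    show "in_minor_ideal (matrix_q (Var 1) (Var 2) (Var 3)) (Var i ^ 5)" for i
      using exhaust_3[of i] in_minor_idealI[OF power_q_1] in_minor_idealI[OF power_q_2] in_minor_idealI[OF power_q_3]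
      by auto
    show "homogeneous_int (int ([7, 8, 8] ! c) - int ([6, 6, 6, 7, 7] ! i)) (matrix_q (Var 1) (Var 2) (Var 3) i c)"
      if "i < 5" "c < 3" for i c
      using that unfolding less_5_cases less_3_cases
      by (elim disjE; simp add: matrix_q_def homogeneous_int_form)
    show "homogeneous_int (8 - int ([6, 6, 6, 7, 7] ! i)) (vector_q (Var 1) (Var 2) (Var 3) i)" if "i < 5" for i
      using that unfolding less_5_cases by (elim disjE; simp add: vector_q_def homogeneous_int_form)
    show "homogeneous_int (7 - int ([6, 6, 6, 7, 7] ! i)) (if i = 3 then of_int 2207273 else 0)" if "i < 5" for i
      using that homogeneous_int_of_int[of 2207273] unfolding less_5_cases by auto
    show "\<exists>s r. \<forall>i<5. Const (l $ 1) * linear_form (cvec (Lq ! 8)) * vector_q (Var 1) (Var 2) (Var 3) i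
        + Const (l $ 2) * (Var 2 * linear_form (cvec (Lq ! 7))) * (if i = 3 then of_int 2207273 else 0)
        = (\<Sum>c<3. matrix_q (Var 1) (Var 2) (Var 3) i c * s c) + linear_form l * r i"
      if l: "l \<in> set (map cvec (take 6 (drop 1 Lq)))" for l
    proof -
      obtain t where t: "t \<in> set (take 6 (drop 1 Lq))" "l = cvec t" using l unfolding set_map by (elim imageE)
      show ?thesis using tangent_q[OF t(1), of "Var 1 :: S" "Var 2" "Var 3"]
        unfolding t(2) linear_form_cvec cvec_nth Const_of_int .
    qed
    show "(\<Sum>i<5. vector_q (Var 1) (Var 2) (Var 3) i * (\<Sum>m<5. cominor (matrix_q (Var 1) (Var 2) (Var 3)) i m
        * (if m = 3 then of_int 2207273 else 0))) = Const (of_int (10753953461807855417)) * defining_poly (map cvec (take 6 (drop 1 Lq)))"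
      unfolding defining_poly_cvec Const_of_int by (rule discriminant_q)
  qed (simp_all add: Lq_def cvec_nth)
  show ?thesis using AR_resolution_exists unfolding f_def lines_q .
qed

lemma resolution_p: "\<exists>g. AR_resolution (defining_poly (map cvec Lp)) [6, 6, 6, 7, 7] [7, 8, 8] g (matrix_p (Var 1) (Var 2) (Var 3))"
proof -
  interpret fibred_arrangement "map cvec (take 6 (drop 1 Lp))" "cvec (Lp ! 7)" "cvec (Lp ! 8)"
    "[6, 6, 6, 7, 7]" "[7, 8, 8]" "matrix_p (Var 1) (Var 2) (Var 3)" "vector_p (Var 1) (Var 2) (Var 3)" "\<lambda>i. if i = 3 then of_int 421 else 0" 5 "of_int (- 74618461)"
  proof
    show "line_arrangement (vector [0, 1, 0] # map cvec (take 6 (drop 1 Lp)) @ [cvec (Lp ! 7), cvec (Lp ! 8), vector [0, 0, 1]])"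
      unfolding lines_p by (rule indexed_arrangement_line_arrangement[OF indexed_p])
    show "l $ 1 \<noteq> 0" if "l \<in> set (map cvec (take 6 (drop 1 Lp)))" for l
      using that by (auto simp: Lp_def cvec_nth)
    show "in_minor_ideal (matrix_p (Var 1) (Var 2) (Var 3)) (Var i ^ 5)" for i
      using exhaust_3[of i] in_minor_idealI[OF power_p_1] in_minor_idealI[OF power_p_2] in_minor_idealI[OF power_p_3]
      by auto
    show "homogeneous_int (int ([7, 8, 8] ! c) - int ([6, 6, 6, 7, 7] ! i)) (matrix_p (Var 1) (Var 2) (Var 3) i c)"
      if "i < 5" "c < 3" for i c
      using that unfolding less_5_cases less_3_cases
      by (elim disjE; simp add: matrix_p_def homogeneous_int_form)
    show "homogeneous_int (8 - int ([6, 6, 6, 7, 7] ! i)) (vector_p (Var 1) (Var 2) (Var 3) i)" if "i < 5" for i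
      using that unfolding less_5_cases by (elim disjE; simp add: vector_p_def homogeneous_int_form)
    show "homogeneous_int (7 - int ([6, 6, 6, 7, 7] ! i)) (if i = 3 then of_int 421 else 0)" if "i < 5" for i
      using that homogeneous_int_of_int[of 421] unfolding less_5_cases by auto
    show "\<exists>s r. \<forall>i<5. Const (l $ 1) * linear_form (cvec (Lp ! 8)) * vector_p (Var 1) (Var 2) (Var 3) i
        + Const (l $ 2) * (Var 2 * linear_form (cvec (Lp ! 7))) * (if i = 3 then of_int 421 else 0)
        = (\<Sum>c<3. matrix_p (Var 1) (Var 2) (Var 3) i c * s c) + linear_form l * r i"
      if l: "l \<in> set (map cvec (take 6 (drop 1 Lp)))" for l
    proof -
      obtain t where t: "t \<in> set (take 6 (drop 1 Lp))" "l = cvec t" using l unfolding set_map by (elim imageE)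
      show ?thesis using tangent_p[OF t(1), of "Var 1 :: S" "Var 2" "Var 3"]
        unfolding t(2) linear_form_cvec cvec_nth Const_of_int .
    qed
    show "(\<Sum>i<5. vector_p (Var 1) (Var 2) (Var 3) i * (\<Sum>m<5. cominor (matrix_p (Var 1) (Var 2) (Var 3)) i m
        * (if m = 3 then of_int 421 else 0))) = Const (of_int (- 74618461)) * defining_poly (map cvec (take 6 (drop 1 Lp)))"
      unfolding defining_poly_cvec Const_of_int by (rule discriminant_p)
  qed (simp_all add: Lp_def cvec_nth)
  show ?thesis using AR_resolution_exists unfolding f_def lines_p .
qed

text \<open>
  A relation with a nonzero constant entry makes one generator redundant, and both can be left out.
  Here the relation is a unit vector, so that the generator itself is zero.
\<close>

lemma AR_resolution_cancel:
  assumes res: "AR_resolution f (ds @ [d]) (e # es) g B"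
    and last: "B (length ds) 0 = 1" "\<And>c. c < length es \<Longrightarrow> B (length ds) (Suc c) = 0"
    and first: "\<And>i. i < length ds \<Longrightarrow> B i 0 = 0"
  shows "AR_resolution f ds es g (\<lambda>i c. B i (Suc c))"
proof -
  let ?n = "length ds" and ?m = "length es"
  have hom: "homogeneous ((ds @ [d]) ! i) (g i $ c)" if "i < Suc ?n" for i c
    using res that unfolding AR_resolution_def by simp
  have AR: "AR f = range (\<lambda>t. \<Sum>i<Suc ?n. t i *s g i)" using res unfolding AR_resolution_def by simp
  have syz: "(\<Sum>i<Suc ?n. t i *s g i) = 0 \<longleftrightarrow> (\<exists>s. \<forall>i<Suc ?n. t i = (\<Sum>c<Suc ?m. B i c * s c))" for t
    using res unfolding AR_resolution_def length_append list.size(3,4) add_Suc_right add_0_right by (elim conjE) (erule spec)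
  have inj: "\<forall>s. (\<forall>i<Suc ?n. (\<Sum>c<Suc ?m. B i c * s c) = 0) \<longrightarrow> (\<forall>c<Suc ?m. s c = 0)"
    using res unfolding AR_resolution_def length_append list.size(3,4) add_Suc_right add_0_right
    by (elim conjE)
  have homB: "homogeneous_int (int ((e # es) ! c) - int ((ds @ [d]) ! i)) (B i c)"
    if "i < Suc ?n" "c < Suc ?m" for i c
    using res that unfolding AR_resolution_def by simp
  have row: "(\<Sum>c<Suc ?m. B i c * s c) = (if i = ?n then s 0 else \<Sum>c<?m. B i (Suc c) * s (Suc c))"
    if "i < Suc ?n" for i s
    using that last first[of i] unfolding sum.lessThan_Suc_shift by auto
  have gn: "g ?n = 0"
  proof -
    have "(\<Sum>i<Suc ?n. (if i = ?n then 1 else 0) *s g i) = 0"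
      unfolding syz
    proof (intro exI[of _ "\<lambda>c. if c = 0 then 1 else 0"] allI impI)
      fix i assume i: "i < Suc ?n"
      show "(if i = ?n then 1 else 0) = (\<Sum>c<Suc ?m. B i c * (if c = 0 then 1 else 0))"
        unfolding row[OF i] by simp
    qed
    then show ?thesis by (simp add: vec_eq_iff)
  qed
  have sum: "(\<Sum>i<Suc ?n. t i *s g i) = (\<Sum>i<?n. t i *s g i)" for t using gn by (simp add: vec_eq_iff)
  have syz': "(\<Sum>i<?n. t i *s g i) = 0 \<longleftrightarrow> (\<exists>s. \<forall>i<?n. t i = (\<Sum>c<?m. B i (Suc c) * s c))" for t
  proof -
    let ?t = "\<lambda>i. if i = ?n then 0 else t i"
    have "(\<Sum>i<?n. t i *s g i) = (\<Sum>i<Suc ?n. ?t i *s g i)" unfolding sum by (intro sum.cong) auto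
    then have eq: "(\<Sum>i<?n. t i *s g i) = 0 \<longleftrightarrow> (\<exists>s. \<forall>i<Suc ?n. ?t i = (\<Sum>c<Suc ?m. B i c * s c))"
      by (simp only: syz)
    show ?thesis unfolding eq
    proof
      assume "\<exists>s. \<forall>i<Suc ?n. ?t i = (\<Sum>c<Suc ?m. B i c * s c)"
      then obtain s where s: "\<And>i. i < Suc ?n \<Longrightarrow> ?t i = (\<Sum>c<Suc ?m. B i c * s c)" by blast
      have "t i = (\<Sum>c<?m. B i (Suc c) * s (Suc c))" if "i < ?n" for i
        using s[of i] row[of i s] that by simp
      then show "\<exists>s. \<forall>i<?n. t i = (\<Sum>c<?m. B i (Suc c) * s c)" by (intro exI[of _ "\<lambda>c. s (Suc c)"]) blast
    next
      assume "\<exists>s. \<forall>i<?n. t i = (\<Sum>c<?m. B i (Suc c) * s c)"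
      then obtain s where s: "\<And>i. i < ?n \<Longrightarrow> t i = (\<Sum>c<?m. B i (Suc c) * s c)" by blast
      have "?t i = (\<Sum>c<Suc ?m. B i c * case_nat 0 s c)" if "i < Suc ?n" for i
        using row[OF that, of "case_nat 0 s"] s[of i] that by auto
      then show "\<exists>s. \<forall>i<Suc ?n. ?t i = (\<Sum>c<Suc ?m. B i c * s c)" by (intro exI[of _ "case_nat 0 s"]) blast
    qed
  qed
  have inj': "\<forall>c<?m. s c = 0" if s: "\<forall>i<?n. (\<Sum>c<?m. B i (Suc c) * s c) = 0" for s
  proof -
    have "\<forall>i<Suc ?n. (\<Sum>c<Suc ?m. B i c * case_nat 0 s c) = 0"
      using row[of _ "case_nat 0 s"] s by auto
    from inj[THEN spec, THEN mp, OF this] show ?thesis by force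
  qed
  have hom': "homogeneous (ds ! i) (g i $ c)" if "i < ?n" for i c
    using hom[of i c] that by (simp add: nth_append)
  have homB': "homogeneous_int (int (es ! c) - int (ds ! i)) (B i (Suc c))" if "i < ?n" "c < ?m" for i c
    using homB[of i "Suc c"] that by (simp add: nth_append)
  show ?thesis
    unfolding AR_resolution_def
    by (intro conjI allI impI) (use hom' AR[unfolded sum] syz' inj' homB' in \<open>simp_all\<close>)
qed

lemma exponents_eq:
  assumes "AR_resolution f ds es g B" "\<And>i c. i < length ds \<Longrightarrow> c < length es \<Longrightarrow> lookup (B i c) 0 = 0"
    "sorted ds" "AR (defining_poly ls) = AR f"
  shows "exponents ls = ds"
  unfolding exponents_def assms(4)
proof (rule the_equality)
  show ds: "is_degree_sequence (AR f) ds"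
    by (rule degree_sequence_exists[OF assms(1) AR_resolution_minimal[OF assms(1,2)] assms(3)])
  show "ds' = ds" if "is_degree_sequence (AR f) ds'" for ds'
    by (rule degree_sequence_unique[OF that ds])
qed

lemma is_betti_table_2:
  assumes "AR_resolution f ds es g B" "\<And>i c. i < length ds \<Longrightarrow> c < length es \<Longrightarrow> lookup (B i c) 0 = 0"
    "homogeneous 10 f" "\<And>i. i < length ds \<Longrightarrow> 0 < ds ! i" "is_betti_table (jacobian_ideal f) \<beta>"
  shows "\<beta> 2 (int d + 9) = count_list ds d"
  using assms(5) betti_numbers_2[OF assms(1-4)] unfolding is_betti_table_def by auto

theorem mainTheorem9:
  fixes Bq Bp :: "(complex^3) list"
  assumes "Bq = ten_lines 31 17"
    and "Bp = ten_lines (3 / 10) (2 / 7)"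
  shows "card (plane ` set Bq) = 10 \<and> card (plane ` set Bp) = 10 \<and>
    isomorphic_lattices Bq Bp \<and>
    (\<forall>B\<in>{Bq, Bp}.
       card (points_of_mult B 2) = 15 \<and>
       card (points_of_mult B 3) = 10 \<and>
       (\<forall>k>3. points_of_mult B k = {})) \<and>
    exponents Bq = [6, 6, 6, 7] \<and>
    exponents Bp = [6, 6, 6, 7, 7] \<and>
    ziegler_pair Bq Bp \<and>
    mdr Bq = mdr Bp \<and>
    hilbert_function (jacobian_ideal (defining_poly Bq)) =
      hilbert_function (jacobian_ideal (defining_poly Bp))"
proof -
  let ?Lq = "map cvec Lq" and ?Lp = "map cvec Lp"
  let ?fq = "defining_poly ?Lq" and ?fp = "defining_poly ?Lp"
  note rescaled = ten_lines_q[folded assms(1)] ten_lines_p[folded assms(2)]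
  note planes = rescaled_planes[OF rescaled(1)] rescaled_planes[OF rescaled(2)]
  have len: "length Lq = 10" "length Lp = 10" by (simp_all add: Lq_def Lp_def)
  have one: "1 < length Lq" "1 < length Lp" by (simp_all add: len)
  have card: "card (plane ` set Bq) = 10" "card (plane ` set Bp) = 10"
    unfolding planes using indexed_arrangement.card_planes[OF indexed_q]
      indexed_arrangement.card_planes[OF indexed_p] by (simp_all add: len)
  have iso: "isomorphic_lattices Bq Bp"
    by (rule isomorphic_lattices_cong[OF planes isomorphic_lattices_cvec[OF general_Lq general_Lp one(1) _ same_blocks]])
      (simp add: len)
  have points: "\<forall>B\<in>{Bq, Bp}. card (points_of_mult B 2) = 15 \<and> card (points_of_mult B 3) = 10 \<and>
      (\<forall>k>3. points_of_mult B k = {})"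
    using card_points_cvec[OF general_Lq one(1)] card_points_cvec[OF general_Lp one(2)] blocks_Lq blocks_Lp
      no_points_cvec[OF general_Lq one(1) blocks_Lq(3)] no_points_cvec[OF general_Lp one(2) blocks_Lp(3)]
      points_of_mult_cong[OF planes(1)] points_of_mult_cong[OF planes(2)] by simp
  obtain cq where cq: "cq \<noteq> 0" "defining_poly Bq = Const cq * ?fq"
    using rescaled_defining_poly[OF rescaled(1)] by blast
  obtain cp where cp: "cp \<noteq> 0" "defining_poly Bp = Const cp * ?fp"
    using rescaled_defining_poly[OF rescaled(2)] by blast
  have AR: "AR (defining_poly Bq) = AR ?fq" "AR (defining_poly Bp) = AR ?fp"
    using AR_Const_mult cq cp by simp_all
  have J: "jacobian_ideal (defining_poly Bq) = jacobian_ideal ?fq"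
    "jacobian_ideal (defining_poly Bp) = jacobian_ideal ?fp"
    using jacobian_ideal_Const_mult cq cp by simp_all
  have hom: "homogeneous 10 ?fq" "homogeneous 10 ?fp"
    using homogeneous_defining_poly[of ?Lq] homogeneous_defining_poly[of ?Lp] by (simp_all add: len)
  obtain gq where gq: "AR_resolution ?fq [6, 6, 6, 7, 7] [7, 8, 8] gq (matrix_q (Var 1) (Var 2) (Var 3))" using resolution_q by blast
  obtain gp where gp: "AR_resolution ?fp [6, 6, 6, 7, 7] [7, 8, 8] gp (matrix_p (Var 1) (Var 2) (Var 3))" using resolution_p by blast
  let ?Mq = "\<lambda>i c. matrix_q (Var 1) (Var 2) (Var 3) i (Suc c)"
  have res_q: "AR_resolution ?fq [6, 6, 6, 7] [8, 8] gq ?Mq"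
  proof (rule AR_resolution_cancel)
    show "AR_resolution ?fq ([6, 6, 6, 7] @ [7]) (7 # [8, 8]) gq (matrix_q (Var 1) (Var 2) (Var 3))" using gq by simp
    show "matrix_q (Var 1) (Var 2) (Var 3) (length [6, 6, 6, 7 :: nat]) 0 = 1" by (simp add: matrix_q_def expand)
    show "matrix_q (Var 1) (Var 2) (Var 3) (length [6, 6, 6, 7 :: nat]) (Suc c) = 0" if "c < length [8, 8 :: nat]" for c
      using that by (auto simp: matrix_q_def less_Suc_eq)
    show "matrix_q (Var 1) (Var 2) (Var 3) i 0 = 0" if "i < length [6, 6, 6, 7 :: nat]" for i
      using that by (auto simp: matrix_q_def less_Suc_eq)
  qed
  have min_q: "lookup (?Mq i c) 0 = 0" if "i < length [6, 6, 6, 7 :: nat]" "c < length [8, 8 :: nat]" for i c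
    using that by (auto simp: matrix_q_def less_Suc_eq lookup_0_form)
  have min_p: "lookup (matrix_p (Var 1) (Var 2) (Var 3) i c) 0 = 0"
    if "i < length [6, 6, 6, 7, 7 :: nat]" "c < length [7, 8, 8 :: nat]" for i c
    using that by (auto simp: matrix_p_def less_Suc_eq lookup_0_form)
  have pos_q: "0 < [6, 6, 6, 7 :: nat] ! i" if "i < length [6, 6, 6, 7 :: nat]" for i
    using that by (auto simp: less_Suc_eq)
  have pos_p: "0 < [6, 6, 6, 7, 7 :: nat] ! i" if "i < length [6, 6, 6, 7, 7 :: nat]" for i
    using that by (auto simp: less_Suc_eq)
  have exps: "exponents Bq = [6, 6, 6, 7]" "exponents Bp = [6, 6, 6, 7, 7]"
    by (rule exponents_eq[OF res_q min_q _ AR(1)] exponents_eq[OF gp min_p _ AR(2)]; simp)+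
  have "distinct_betti_tables (jacobian_ideal (defining_poly Bq)) (jacobian_ideal (defining_poly Bp))"
    unfolding distinct_betti_tables_def J
  proof (intro conjI allI impI notI)
    show "\<exists>\<beta>. is_betti_table (jacobian_ideal ?fq) \<beta>"
      by (rule AR_resolution_betti_table[OF res_q min_q hom(1) pos_q])
    show "\<exists>\<beta>. is_betti_table (jacobian_ideal ?fp) \<beta>"
      by (rule AR_resolution_betti_table[OF gp min_p hom(2) pos_p])
    fix \<beta> \<beta>' assume b: "is_betti_table (jacobian_ideal ?fq) \<beta>" "is_betti_table (jacobian_ideal ?fp) \<beta>'" "\<beta> = \<beta>'"
    have "\<beta> 2 (int 7 + 9) = count_list [6, 6, 6, 7 :: nat] 7"
      by (rule is_betti_table_2[OF res_q min_q hom(1) pos_q b(1)])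
    moreover have "\<beta>' 2 (int 7 + 9) = count_list [6, 6, 6, 7, 7 :: nat] 7"
      by (rule is_betti_table_2[OF gp min_p hom(2) pos_p b(2)])
    ultimately show False using b(3) by simp
  qed
  moreover have "line_arrangement Bq" "line_arrangement Bp"
    using indexed_arrangement_line_arrangement rescaled_indexed_arrangement rescaled indexed_q indexed_p by blast+
  ultimately have zieg: "ziegler_pair Bq Bp" using iso by (simp add: ziegler_pair_def)
  have hilb: "hilbert_function (jacobian_ideal (defining_poly Bq)) = hilbert_function (jacobian_ideal (defining_poly Bp))"
    unfolding J by (rule same_hilbert_function[OF gq hom(1) gp hom(2)])
  show ?thesis using card iso points exps zieg hilb by (simp add: mdr_def)
qed

end
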